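(* Let $k\ge 3$ and $n\ge 1$. (a) Suppose voters vote independently and uniformly at random from the rankings of $k$ alternatives, and let $\frac1{324}>\epsilon>0$. If $F$ is a constitution on $n$ voters and $k$ alternatives satisfying IIA and $$P(F)<\frac1{36}\epsilon^3n^{-3},$$ then there exists $G\in\mathcal F_k(n)$ satisfying $D(F,G)\le 10k^2\epsilon$. (b) Suppose voters vote independently, each following a symmetric distribution $\mu$ on the rankings of $k$ alternatives with minimal probability $\alpha=\min_\sigma\mu(\sigma)$, and let $\frac{\alpha^2}{9}>\epsilon>0$. If $F$ is a constitution on $n$ voters and $k$ alternatives satisfying IIA and $$P(F)<\alpha^2\,\epsilon^{\frac1{2\alpha}}\,n^{-3},$$ then there exists $G\in\mathcal F_k(n)$ satisfying $D(F,G)\le 10k^2\epsilon$.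
   Context: $S(k)$ is the set of rankings (strict linear orders) of $k$ alternatives; $-\sigma$ denotes the reverse of the ranking $\sigma$. A distribution $\mu$ on $S(k)$ is symmetric if $\mu(-\sigma)=\mu(\sigma)$ for all $\sigma\in S(k)$. A profile is an $n$-tuple $\sigma=(\sigma(1),\ldots,\sigma(n))\in S(k)^n$. A constitution $F$ associates to every profile $\sigma$ and every pair of distinct alternatives $a,b$ a strict preference between $a$ and $b$ (the outcome $F(\sigma)$ need not be transitive). $F$ is transitive if $F(\sigma)$ is transitive for all $\sigma$. $F$ satisfies IIA (Independence of Irrelevant Alternatives) if for every pair $a,b$ the preference of $F(\sigma)$ between $a$ and $b$ depends only on the relative rankings of $a$ and $b$ by all the voters. $\mathcal F_k(n)$ is the set of all constitutions on $k$ alternatives and $n$ voters satisfying IIA and Transitivity. $\mathbf P$ is the probability under the stated product distribution of the profile (uniform on $S(k)^n$ in (a), $\mu^n$ in (b)). $D(F,G)=\mathbf P[F(\sigma)\ne G(\sigma)]$ and $P(F)=\mathbf P[F(\sigma)\text{ is not transitive}]$. *)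

theory Defs
  imports "HOL-Probability.Product_PMF"
begin

text \<open>
  The alternatives are \<open>{..<k}\<close> and the voters are \<open>{..<n}\<close>.
  A preference is a strict relation \<open>r\<close>, where \<open>(a, b) \<in> r\<close> means that \<open>a\<close> is preferred
  to \<open>b\<close>; the reverse of a ranking is its converse.
\<close>

definition rankings :: "nat \<Rightarrow> nat rel set" where
  "rankings k = {r. r \<subseteq> {..<k} \<times> {..<k} \<and> strict_linear_order_on {..<k} r}"

definition strict_preferences :: "nat \<Rightarrow> nat rel set" where
  "strict_preferences k =
     {r. r \<subseteq> {..<k} \<times> {..<k} \<and> asym r \<and> total_on {..<k} r}"

definition profiles :: "nat \<Rightarrow> nat \<Rightarrow> (nat \<Rightarrow> nat rel) set" where
  "profiles k n = {..<n} \<rightarrow>\<^sub>E rankings k"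

definition constitutions :: "nat \<Rightarrow> nat \<Rightarrow> ((nat \<Rightarrow> nat rel) \<Rightarrow> nat rel) set" where
  "constitutions k n = profiles k n \<rightarrow>\<^sub>E strict_preferences k"

definition transitive_constitution ::
    "nat \<Rightarrow> nat \<Rightarrow> ((nat \<Rightarrow> nat rel) \<Rightarrow> nat rel) \<Rightarrow> bool" where
  "transitive_constitution k n F \<longleftrightarrow> (\<forall>\<sigma> \<in> profiles k n. trans (F \<sigma>))"

definition IIA :: "nat \<Rightarrow> nat \<Rightarrow> ((nat \<Rightarrow> nat rel) \<Rightarrow> nat rel) \<Rightarrow> bool" where
  "IIA k n F \<longleftrightarrow>
     (\<forall>a<k. \<forall>b<k. a \<noteq> b \<longrightarrow>
       (\<forall>\<sigma> \<in> profiles k n. \<forall>\<tau> \<in> profiles k n.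
          (\<forall>i<n. (a, b) \<in> \<sigma> i \<longleftrightarrow> (a, b) \<in> \<tau> i) \<longrightarrow>
          ((a, b) \<in> F \<sigma> \<longleftrightarrow> (a, b) \<in> F \<tau>)))"

definition IIA_transitive_constitutions ::
    "nat \<Rightarrow> nat \<Rightarrow> ((nat \<Rightarrow> nat rel) \<Rightarrow> nat rel) set" where
  "IIA_transitive_constitutions k n =
     {F \<in> constitutions k n. IIA k n F \<and> transitive_constitution k n F}"

definition symmetric_distribution :: "nat \<Rightarrow> nat rel pmf \<Rightarrow> bool" where
  "symmetric_distribution k \<mu> \<longleftrightarrow> (\<forall>r \<in> rankings k. pmf \<mu> (r\<inverse>) = pmf \<mu> r)"

text \<open>
  The law \<open>\<mu>\<^sup>n\<close> of a profile. The default value \<open>undefined\<close> outside \<open>{..<n}\<close> makes the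
  samples extensional, hence elements of \<open>profiles k n\<close>.
\<close>

definition profile_pmf :: "nat \<Rightarrow> nat rel pmf \<Rightarrow> (nat \<Rightarrow> nat rel) pmf" where
  "profile_pmf n \<mu> = Pi_pmf {..<n} undefined (\<lambda>_. \<mu>)"

definition constitution_dist ::
    "nat \<Rightarrow> nat rel pmf \<Rightarrow> ((nat \<Rightarrow> nat rel) \<Rightarrow> nat rel) \<Rightarrow>
     ((nat \<Rightarrow> nat rel) \<Rightarrow> nat rel) \<Rightarrow> real" where
  "constitution_dist n \<mu> F G = measure_pmf.prob (profile_pmf n \<mu>) {\<sigma>. F \<sigma> \<noteq> G \<sigma>}"

definition nontransitive_prob ::
    "nat \<Rightarrow> nat rel pmf \<Rightarrow> ((nat \<Rightarrow> nat rel) \<Rightarrow> nat rel) \<Rightarrow> real" where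
  "nontransitive_prob n \<mu> F = measure_pmf.prob (profile_pmf n \<mu>) {\<sigma>. \<not> trans (F \<sigma>)}"

text \<open>
  \<open>pmf_of_set (rankings k)\<close> and \<open>Min (pmf \<mu> ` rankings k)\<close> are meaningful by the next two facts.
\<close>

lemma finite_rankings: "finite (rankings k)"
  by (rule finite_subset[of _ "Pow ({..<k} \<times> {..<k})"]) (auto simp: rankings_def)

lemma rankings_nonempty: "rankings k \<noteq> {}"
proof -
  have "{(i, j). i < j \<and> j < k} \<in> rankings k"
    by (auto simp: rankings_def strict_linear_order_on_def irrefl_def total_on_def
        intro!: transI)
  then show ?thesis by blast
qed

lemma set_profile_pmf:
  assumes "set_pmf \<mu> \<subseteq> rankings k"
  shows "set_pmf (profile_pmf n \<mu>) \<subseteq> profiles k n"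
proof -
  have "set_pmf (profile_pmf n \<mu>) = {..<n} \<rightarrow>\<^sub>E set_pmf \<mu>"
    by (auto simp: profile_pmf_def set_Pi_pmf PiE_dflt_def PiE_def extensional_def)
  with assms show ?thesis
    by (auto simp: profiles_def)
qed

end

theory Submission imports Defs begin

text \<open>
  On a pair \<open>a, b\<close> an IIA constitution is a Boolean function \<open>f\<^sub>a\<^sub>b\<close> of the set of voters who
  prefer \<open>a\<close> to \<open>b\<close>. Under a symmetric \<open>\<mu>\<close> this set is uniformly distributed, and for two pairs
  sharing an alternative the two sets are coordinatewise correlated, with a correlation \<open>\<rho>\<close>
  satisfying \<open>\<bar>\<rho>\<bar> \<le> 1 - 4\<beta>\<close> if every strict order of three alternatives has probability
  at least \<open>\<beta>\<close>. Here \<open>\<beta> = 1/6\<close> for the uniform distribution, whatever \<open>k\<close> is, and \<open>\<beta> = \<alpha>\<close> in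
  general; both parts of the theorem are the same statement about \<open>\<beta>\<close>. Put \<open>m = 1/(2\<beta>)\<close>.

  If voter \<open>i\<close> is pivotal for \<open>f\<^sub>a\<^sub>b\<close> and another voter \<open>j\<close> for \<open>f\<^sub>b\<^sub>c\<close> at the same profile, then
  changing the rankings of \<open>i\<close> and \<open>j\<close> alone creates a cycle (\<open>pivotal_pair_paradox\<close>), so this
  event has probability at most \<open>P(F)/\<beta>\<^sup>2 < \<epsilon>\<^sup>m / n\<^sup>3\<close>. What is needed is a lower bound for the sum
  of these probabilities that does not decay with \<open>n\<close>. Reverse hypercontractivity applied to
  the events ``\<open>i\<close> is pivotal'', of measure about \<open>\<epsilon>/n\<close>, gives \<open>(\<epsilon>/n)\<^sup>m\<close> only, which is too weak as
  soon as \<open>m > 3\<close>. Instead the correlation is factored as noise, a slightly larger correlation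
  \<open>\<rho>'\<close>, and noise again. Given a centre \<open>x\<close>, the variance of \<open>f\<close> under the noise around \<open>x\<close> is at
  most the expected number of pivotal voters there; reverse hypercontractivity for \<open>\<rho>'\<close> reduces
  the problem to the moments of order \<open>1/m\<close> of these local variances; and reverse
  hypercontractivity of the noise operator itself bounds those moments by the square root of
  the global variance. The exponents of the two steps multiply to exactly \<open>m\<close>, and
  \<open>joint_pivotality_lower_bound\<close> results: the sum over \<open>i \<in> U\<close> and \<open>j \<in> W\<close> is at least
  \<open>(2/3 \<surd>(Var\<^sub>U f\<^sub>a\<^sub>b \<cdot> Var\<^sub>W f\<^sub>b\<^sub>c))\<^sup>m\<close>, where \<open>Var\<^sub>U\<close> is the mean variance when only the votes in \<open>U\<close>
  are resampled.

  Hence there are no disjoint \<open>U\<close>, \<open>W\<close> on which both variances reach \<open>3\<epsilon>/2\<close>. Adding the voters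
  to \<open>U\<close> one at a time shows that of two adjacent pairs one is nearly constant, or else both
  are nearly decided by the same voter (\<open>block_variance_split\<close>). Round every pair accordingly:
  to a constant, to a function of one voter, or not at all. A cycle of the rounded rule would
  either involve two constant pairs, which already force the third one, or be determined by
  the ranking of one voter; in the latter case it has probability at least \<open>\<beta>\<close>, more than
  \<open>P(F)\<close> and the rounding errors can account for. Each of the at most \<open>k\<^sup>2\<close> pairs costs at most \<open>9\<epsilon>\<close>.
\<close>

section \<open>Two-point inequalities\<close>

text \<open>
  The derivative of the difference is nonnegative by convexity of \<open>x powr (M - 1)\<close>.
\<close>

lemma one_plus_powr_diff_ge:
  fixes s M :: real
  assumes "0 \<le> s" "s < 1" "2 \<le> M"
  shows "2 * M * s \<le> (1 + s) powr M - (1 - s) powr M"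
proof -
  define h where "h s = (1 + s) powr M - (1 - s) powr M - 2 * M * s" for s :: real
  have "h 0 \<le> h s"
  proof (rule DERIV_nonneg_imp_nondecreasing[OF assms(1)])
    fix t assume t: "0 \<le> t" "t \<le> s"
    let ?d = "M * (1 + t) powr (M - 1) + M * (1 - t) powr (M - 1) - 2 * M"
    have "(h has_real_derivative ?d) (at t)"
      unfolding h_def using t assms by (auto intro!: derivative_eq_intros)
    moreover have "convex_on {0<..} (\<lambda>x::real. x powr (M - 1))"
      by (rule powr_convex) (use assms in auto)
    from convex_onD[OF this, of "1/2" "1 + t" "1 - t"] t assms
    have "1 \<le> ((1 + t) powr (M - 1) + (1 - t) powr (M - 1)) / 2"
      by (simp add: field_simps)
    then have "0 \<le> ?d" using assms mult_left_mono[of 1 "((1 + t) powr (M - 1) + (1 - t) powr (M - 1)) / 2" "2 * M"]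
      by (simp add: algebra_simps)
    ultimately show "\<exists>y. (h has_real_derivative y) (at t) \<and> 0 \<le> y" by blast
  qed
  then show ?thesis by (simp add: h_def)
qed

text \<open>
  The case \<open>\<phi> = \<psi>\<close> and \<open>\<rho> = 1/r - 1\<close> of the two-point inequality below, normalised so that
  the values of \<open>\<phi> powr (1/r)\<close> are \<open>1 + s\<close> and \<open>1 - s\<close>. Both sides vanish at \<open>s = 0\<close>; the derivative
  of the difference is nonnegative by the previous lemma with \<open>M = 2r - 1\<close>.
\<close>

lemma two_point_diagonal:
  fixes s r :: real
  assumes s: "0 \<le> s" "s \<le> 1" and r: "3/2 \<le> r"
  shows "r * (1 - (1 - s\<^sup>2) powr r) \<le> (((1 + s) powr r - (1 - s) powr r) / 2)\<^sup>2"
proof -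
  define h where "h s = (((1 + s) powr r - (1 - s) powr r) / 2)\<^sup>2 - r * (1 - ((1 + s) * (1 - s)) powr r)" for s :: real
  have "h 0 \<le> h s"
  proof (cases "s = 0")
    case False
    show ?thesis
    proof (rule DERIV_nonneg_imp_increasing_open[OF s(1)])
      show "continuous_on {0..s} h"
        unfolding h_def using s r by (auto intro!: continuous_intros continuous_on_powr')
    next
      fix t assume t: "0 < t" "t < s"
      have t1: "0 < 1 - t" "0 < 1 + t" "0 < (1+t)*(1-t)" using t s by (auto intro!: mult_pos_pos)
      define p where "p = (1 + t) powr (r - 1)"
      define m where "m = (1 - t) powr (r - 1)"
      have pr: "(1 + t) powr r = (1 + t) * p" "(1 - t) powr r = (1 - t) * m"
        using t1 by (auto simp: p_def m_def powr_mult_base)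
      have d1: "((\<lambda>s. ((1 + s) powr r - (1 - s) powr r)) has_real_derivative (r * p + r * m)) (at t)"
        using t1 by (auto intro!: derivative_eq_intros simp: p_def m_def)
      have d2: "((\<lambda>s. ((1 + s) * (1 - s)) powr r) has_real_derivative (r * (p * m) * (- 2 * t))) (at t)"
      proof -
        have "((\<lambda>s. ((1 + s) * (1 - s)) powr r) has_real_derivative
            (r * ((1 + t) * (1 - t)) powr (r - 1) * (- 2 * t))) (at t)"
          using t1 by (auto intro!: derivative_eq_intros)
        also have "((1 + t) * (1 - t)) powr (r - 1) = p * m"
          using t1 by (simp add: p_def m_def powr_mult)
        finally show ?thesis .
      qed
      let ?d = "((1 + t) * p - (1 - t) * m) * (r * p + r * m) / 2 + r * (r * (p * m) * (- 2 * t))"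
      have "((\<lambda>s. (((1 + s) powr r - (1 - s) powr r) / 2)\<^sup>2) has_real_derivative
          ((1 + t) * p - (1 - t) * m) * (r * p + r * m) / 2) (at t)"
        by (rule DERIV_cong[OF DERIV_power[OF DERIV_cdivide[OF d1]]]) (simp add: pr)
      then have "(h has_real_derivative ?d) (at t)"
        unfolding h_def
        by (rule DERIV_cong[OF DERIV_diff[OF _ DERIV_cmult[OF DERIV_diff[OF DERIV_const d2]]]]) simp
      moreover have "0 \<le> ?d"
      proof -
        have sq: "(1 + t) powr (2 * r - 1) = (1 + t) * p * p" "(1 - t) powr (2 * r - 1) = (1 - t) * m * m"
          using t1 by (auto simp: p_def m_def powr_mult_base simp flip: powr_add)
        have g: "2 * (2 * r - 1) * t \<le> (1 + t) * p * p - (1 - t) * m * m"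
          using one_plus_powr_diff_ge[of t "2 * r - 1"] t s r by (simp add: sq)
        have "p * m = ((1 + t) * (1 - t)) powr (r - 1)"
          using t1 by (simp add: p_def m_def powr_mult)
        also have "\<dots> \<le> 1" using t1 t r
          by (intro powr_le1) (auto simp: algebra_simps)
        finally have pm: "2 * (2 * r - 1) * t * (p * m) \<le> 2 * (2 * r - 1) * t * 1"
          using t r by (intro mult_left_mono) auto
        have "?d = r / 2 * ((1 + t) * p * p - (1 - t) * m * m - 2 * (2 * r - 1) * t * (p * m))"
          by (simp add: field_simps)
        also have "\<dots> \<ge> 0" using order_trans[OF pm[unfolded mult_1_right] g] r by (intro mult_nonneg_nonneg) auto
        finally show ?thesis .
      qed
      ultimately show "\<exists>y. (h has_real_derivative y) (at t) \<and> 0 \<le> y" by blast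
    qed
  qed auto
  moreover have "1 - s\<^sup>2 = (1 + s) * (1 - s)" by (simp add: algebra_simps power2_eq_square)
  ultimately show ?thesis by (simp add: h_def)
qed

text \<open>
  Reverse Cauchy--Schwarz for the Lorentz form. It reduces a bilinear two-point inequality
  to its diagonal case.
\<close>

lemma aczel:
  fixes a b c d :: real
  assumes "\<bar>b\<bar> \<le> a" "\<bar>d\<bar> \<le> c"
  shows "sqrt (a\<^sup>2 - b\<^sup>2) * sqrt (c\<^sup>2 - d\<^sup>2) \<le> a * c - \<bar>b\<bar> * \<bar>d\<bar>"
proof -
  have "(a\<^sup>2 - b\<^sup>2) * (c\<^sup>2 - d\<^sup>2) \<le> (a * c - \<bar>b\<bar> * \<bar>d\<bar>)\<^sup>2"
  proof -
    have "(a * c - \<bar>b\<bar> * \<bar>d\<bar>)\<^sup>2 - (a\<^sup>2 - \<bar>b\<bar>\<^sup>2) * (c\<^sup>2 - \<bar>d\<bar>\<^sup>2) = (a * \<bar>d\<bar> - \<bar>b\<bar> * c)\<^sup>2"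
      by (simp only: power2_eq_square) algebra
    moreover have "0 \<le> (a * \<bar>d\<bar> - \<bar>b\<bar> * c)\<^sup>2" by simp
    ultimately show ?thesis unfolding power2_abs by linarith
  qed
  moreover have "0 \<le> a * c - \<bar>b\<bar> * \<bar>d\<bar>"
    using mult_mono[of "\<bar>b\<bar>" a "\<bar>d\<bar>" c] assms by linarith
  ultimately show ?thesis
    unfolding real_sqrt_mult[symmetric] by (rule real_le_lsqrt[rotated])
qed
text \<open>
  The previous diagonal inequality without the normalisation.
\<close>

lemma two_point_norm:
  fixes A B m :: real
  assumes "0 \<le> A" "0 \<le> B" "3/2 \<le> m"
  shows "((A powr (1/m) + B powr (1/m)) / 2) powr (2 * m)
         \<le> ((A + B) / 2)\<^sup>2 - (1 - 1/m) * ((A - B) / 2)\<^sup>2"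
proof -
  have *: "((A powr (1/m) + B powr (1/m)) / 2) powr (2 * m)
         \<le> ((A + B) / 2)\<^sup>2 - (1 - 1/m) * ((A - B) / 2)\<^sup>2"
    if AB: "0 \<le> B" "B \<le> A" "0 < A" for A B :: real
  proof -
    define a where "a = A powr (1/m)"
    define b where "b = B powr (1/m)"
    have ab: "0 < a" "0 \<le> b" "b \<le> a" using AB assms by (auto simp: a_def b_def intro!: powr_mono2)
    have A: "A = a powr m" "B = b powr m" using AB assms by (auto simp: a_def b_def powr_powr)
    define c where "c = (a + b) / 2"
    define s where "s = (a - b) / (a + b)"
    have c: "0 < c" using ab by (simp add: c_def)
    have s: "0 \<le> s" "s \<le> 1" using ab by (auto simp: s_def)
    have "a = c * (1 + s)" "b = c * (1 - s)" using ab by (auto simp: c_def s_def field_simps)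
    then have A': "A = c powr m * (1 + s) powr m" "B = c powr m * (1 - s) powr m"
      using c s by (auto simp: A powr_mult)
    let ?p = "(1 + s) powr m" and ?n = "(1 - s) powr m"
    have "1 * m \<le> ((?p - ?n) / 2)\<^sup>2 + m * (?p * ?n)"
    proof -
      have "1 - s\<^sup>2 = (1 + s) * (1 - s)" by (simp add: algebra_simps power2_eq_square)
      with two_point_diagonal[OF s assms(3)] s have "m * (1 - ?p * ?n) \<le> ((?p - ?n) / 2)\<^sup>2"
        by (simp add: powr_mult)
      then show ?thesis by (simp add: right_diff_distrib)
    qed
    then have "1 \<le> ((?p - ?n) / 2)\<^sup>2 / m + ?p * ?n"
      using assms by (simp add: field_simps)
    also have "\<dots> = ((?p + ?n) / 2)\<^sup>2 - (1 - 1/m) * ((?p - ?n) / 2)\<^sup>2"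
      using assms by (simp add: field_simps power2_eq_square)
    finally have "(c powr m)\<^sup>2 * 1 \<le> (c powr m)\<^sup>2 * (((?p + ?n) / 2)\<^sup>2 - (1 - 1/m) * ((?p - ?n) / 2)\<^sup>2)"
      by (intro mult_left_mono) auto
    also have "\<dots> = ((A + B) / 2)\<^sup>2 - (1 - 1/m) * ((A - B) / 2)\<^sup>2"
      by (simp add: A' power2_eq_square algebra_simps)
    finally show ?thesis
      using c by (simp add: a_def[symmetric] b_def[symmetric] c_def[symmetric] power2_eq_square powr_add[symmetric])
  qed
  show ?thesis
  proof (cases "A = 0 \<and> B = 0")
    case False
    show ?thesis
    proof (cases "B \<le> A")
      case True
      with *[of B A] False assms show ?thesis by force
    next
      case F: False
      have "((A - B) / 2)\<^sup>2 = ((B - A) / 2)\<^sup>2"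
        by (simp add: power2_eq_square algebra_simps)
      with *[of A B] F assms show ?thesis by (simp add: add.commute)
    qed
  qed (use assms in auto)
qed

text \<open>
  Borell's reverse hypercontractive inequality on a two-point space. The right-hand side is
  the mean of \<open>\<phi>(x) \<psi>(y)\<close> for \<open>\<rho>\<close>-correlated fair bits, where \<open>\<phi>\<close> has the values \<open>A, B\<close> and \<open>\<psi>\<close>
  the values \<open>C, D\<close>; it equals \<open>(A+B)/2 \<cdot> (C+D)/2 + \<rho> (A-B)/2 \<cdot> (C-D)/2\<close>.
\<close>

lemma two_point_reverse:
  fixes A B C D m \<rho> :: real
  assumes nn: "0 \<le> A" "0 \<le> B" "0 \<le> C" "0 \<le> D" and m: "3/2 \<le> m" and \<rho>: "\<bar>\<rho>\<bar> \<le> 1 - 1/m"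
  shows "((A powr (1/m) + B powr (1/m)) / 2) powr m * ((C powr (1/m) + D powr (1/m)) / 2) powr m
    \<le> (1 + \<rho>) / 4 * (A * C + B * D) + (1 - \<rho>) / 4 * (A * D + B * C)"
proof -
  let ?N = "\<lambda>A B. ((A powr (1/m) + B powr (1/m)) / 2) powr m"
  \<comment> \<open>rescaling the odd parts turns the diagonal inequality into a bound by a Lorentz form\<close>
  define k where "k = sqrt (1 - 1/m)"
  have k: "0 \<le> k" "k \<le> 1" "k\<^sup>2 = 1 - 1/m" using m by (auto simp: k_def)
  have N: "?N A B \<le> sqrt (((A + B) / 2)\<^sup>2 - (k * ((A - B) / 2))\<^sup>2)" if "0 \<le> A" "0 \<le> B" for A B
    using two_point_norm[OF that m] unfolding power_mult_distrib k
    by (intro real_le_rsqrt) (simp add: power2_eq_square[of "_ powr _"] powr_add[symmetric])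
  have kb: "\<bar>k * ((A - B) / 2)\<bar> \<le> (A + B) / 2" if "0 \<le> A" "0 \<le> B" for A B
  proof -
    have "\<bar>k * ((A - B) / 2)\<bar> = k * \<bar>(A - B) / 2\<bar>" using k by (simp add: abs_mult)
    also have "\<dots> \<le> 1 * \<bar>(A - B) / 2\<bar>" using k by (intro mult_right_mono) auto
    also have "\<dots> \<le> (A + B) / 2" using that by auto
    finally show ?thesis .
  qed
  have "?N A B * ?N C D \<le> sqrt (((A + B) / 2)\<^sup>2 - (k * ((A - B) / 2))\<^sup>2) * sqrt (((C + D) / 2)\<^sup>2 - (k * ((C - D) / 2))\<^sup>2)"
    using nn by (intro mult_mono N order_trans[OF _ N]) auto
  also have "\<dots> \<le> (A + B) / 2 * ((C + D) / 2) - \<bar>k * ((A - B) / 2)\<bar> * \<bar>k * ((C - D) / 2)\<bar>"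
    using kb nn by (intro aczel) auto
  also have "\<bar>k * ((A - B) / 2)\<bar> * \<bar>k * ((C - D) / 2)\<bar> = (1 - 1/m) * \<bar>(A - B) / 2 * ((C - D) / 2)\<bar>"
    using k by (simp add: abs_mult power2_eq_square)
  also have "(A + B) / 2 * ((C + D) / 2) - (1 - 1/m) * \<bar>(A - B) / 2 * ((C - D) / 2)\<bar>
    \<le> (A + B) / 2 * ((C + D) / 2) - \<bar>\<rho>\<bar> * \<bar>(A - B) / 2 * ((C - D) / 2)\<bar>"
    using \<rho> by (intro diff_left_mono mult_right_mono) auto
  also have "\<dots> \<le> (A + B) / 2 * ((C + D) / 2) + \<rho> * ((A - B) / 2 * ((C - D) / 2))"
    using abs_ge_minus_self[of "\<rho> * ((A - B) / 2 * ((C - D) / 2))"] unfolding abs_mult by linarith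
  also have "\<dots> = (1 + \<rho>) / 4 * (A * C + B * D) + (1 - \<rho>) / 4 * (A * D + B * C)"
    by (simp add: field_simps)
  finally show ?thesis .
qed

lemma sinh_mult_ge:
  fixes r v :: real
  assumes "1 \<le> r" "0 \<le> v"
  shows "r * sinh v \<le> sinh (r * v)"
proof -
  have "sinh (r * 0) - r * sinh 0 \<le> sinh (r * v) - r * sinh v"
  proof (rule DERIV_nonneg_imp_nondecreasing[OF assms(2)])
    fix t assume t: "0 \<le> t" "t \<le> v"
    have "((\<lambda>v. sinh (r * v) - r * sinh v) has_real_derivative (cosh (r * t) * r - r * cosh t)) (at t)"
      by (auto intro!: derivative_eq_intros)
    moreover have "cosh t \<le> cosh (r * t)"
      using t assms mult_right_mono[of 1 r t] by (subst cosh_real_nonneg_le_iff) auto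
    then have "0 \<le> r * (cosh (r * t) - cosh t)" using assms by simp
    ultimately show "\<exists>y. ((\<lambda>v. sinh (r * v) - r * sinh v) has_real_derivative y) (at t) \<and> 0 \<le> y"
      by (intro exI[of _ "cosh (r * t) * r - r * cosh t"]) (simp add: algebra_simps)
  qed
  then show ?thesis by simp
qed

text \<open>
  This is \<open>d tanh v \<le> tanh (d v)\<close>, the concavity of \<open>tanh\<close>.
\<close>

lemma tanh_mult_ge:
  fixes d v :: real
  assumes "0 \<le> d" "d \<le> 1" "0 \<le> v"
  shows "d * sinh v * cosh (d * v) \<le> sinh (d * v) * cosh v"
proof -
  have "sinh (d * 0) * cosh 0 - d * sinh 0 * cosh (d * 0) \<le> sinh (d * v) * cosh v - d * sinh v * cosh (d * v)"
  proof (rule DERIV_nonneg_imp_nondecreasing[OF assms(3)])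
    fix t assume t: "0 \<le> t" "t \<le> v"
    let ?y = "(1 - d\<^sup>2) * (sinh (d * t) * sinh t)"
    have "((\<lambda>v. sinh (d * v) * cosh v - d * sinh v * cosh (d * v)) has_real_derivative ?y) (at t)"
      by (auto intro!: derivative_eq_intros simp: algebra_simps power2_eq_square)
    moreover have "0 \<le> ?y" using t assms
      by (intro mult_nonneg_nonneg) (auto simp: power_le_one)
    ultimately show "\<exists>y. ((\<lambda>v. sinh (d * v) * cosh v - d * sinh v * cosh (d * v)) has_real_derivative y) (at t) \<and> 0 \<le> y"
      by blast
  qed
  then show ?thesis by simp
qed

lemma positive_pair_exp:
  fixes X Y :: real
  assumes "0 < Y" "Y \<le> X"
  obtains c L where "0 < c" "0 \<le> L" "X = c * exp L" "Y = c * exp (- L)"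
proof (rule that[of "sqrt (X * Y)" "ln (X / Y) / 2"])
  have "exp (ln (X / Y) / 2) = sqrt (X / Y)" "exp (- (ln (X / Y) / 2)) = sqrt (Y / X)"
    using assms by (auto simp: exp_minus ln_sqrt[symmetric] real_sqrt_divide)
  then show "X = sqrt (X * Y) * exp (ln (X / Y) / 2)" "Y = sqrt (X * Y) * exp (- (ln (X / Y) / 2))"
    using assms by (auto simp: real_sqrt_mult[symmetric] power2_eq_square[symmetric])
qed (use assms in auto)

lemma exp_cosh_sinh: "exp t = cosh t + sinh t" "exp (- t) = cosh t - sinh t" for t :: real
  by (simp_all add: cosh_plus_sinh cosh_minus_sinh)

text \<open>
  In the variable \<open>L = ln (X/Y) / 2\<close> this is again \<open>q tanh L \<le> tanh (q L)\<close>.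
\<close>

lemma powr_ratio_ge:
  fixes X Y q :: real
  assumes "0 < Y" "Y \<le> X" "0 < q" "q \<le> 1"
  shows "q * (X - Y) * (X powr q + Y powr q) \<le> (X powr q - Y powr q) * (X + Y)"
proof -
  obtain c L where c: "0 < c" and L: "0 \<le> L" and X: "X = c * exp L" "Y = c * exp (- L)"
    by (rule positive_pair_exp[OF assms(1,2)])
  have Xq: "X powr q = c powr q * exp (q * L)" "Y powr q = c powr q * exp (- (q * L))"
    using c by (simp_all add: X powr_mult exp_powr_real mult.commute)
  have "q * sinh L * cosh (q * L) \<le> sinh (q * L) * cosh L"
    using tanh_mult_ge[of q L] assms L by simp
  then have "4 * c * c powr q * (q * sinh L * cosh (q * L)) \<le> 4 * c * c powr q * (sinh (q * L) * cosh L)"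
    using c by (intro mult_left_mono) auto
  moreover have "4 * c * c powr q * (q * sinh L * cosh (q * L)) = q * (X - Y) * (X powr q + Y powr q)"
    unfolding Xq unfolding X exp_cosh_sinh by (simp add: algebra_simps)
  moreover have "4 * c * c powr q * (sinh (q * L) * cosh L) = (X powr q - Y powr q) * (X + Y)"
    unfolding Xq unfolding X exp_cosh_sinh by (simp add: algebra_simps)
  ultimately show ?thesis by simp
qed

text \<open>
  With \<open>z = cosh y / cosh v\<close> the bracket is \<open>2 - 1/z \<le> z\<close>. It then remains to compare \<open>sinh (d v)\<close>
  with \<open>d sinh v / cosh v\<close> if \<open>d \<le> 1\<close>, and with \<open>d sinh v\<close> otherwise.
\<close>

lemma hyperbolic_key:
  fixes v d :: real
  assumes v: "0 \<le> v" and d: "0 \<le> d"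
  defines "y \<equiv> v + d * v"
  shows "d * sinh v * (2 - cosh v / cosh y) \<le> cosh y * sinh (d * v)"
proof -
  have cv: "1 \<le> cosh v" "1 \<le> cosh y" "1 \<le> cosh (d * v)" by (auto simp: cosh_real_ge_1)
  have sv: "0 \<le> sinh v" using v by simp
  have "2 - cosh v / cosh y \<le> cosh y / cosh v"
  proof -
    have "0 \<le> (cosh v - cosh y)\<^sup>2" by simp
    then have "2 * cosh v * cosh y \<le> cosh v * cosh v + cosh y * cosh y"
      by (simp add: power2_eq_square algebra_simps)
    then show ?thesis using cv by (simp add: field_simps)
  qed
  then have 1: "d * sinh v * (2 - cosh v / cosh y) \<le> d * sinh v * (cosh y / cosh v)"
    using d sv by (intro mult_left_mono) auto
  show ?thesis
  proof (cases "d \<le> 1")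
    case True
    have "d * sinh v * 1 \<le> d * sinh v * cosh (d * v)"
      using d sv cv by (intro mult_left_mono) auto
    also have "\<dots> \<le> sinh (d * v) * cosh v" by (rule tanh_mult_ge[OF d True v])
    finally have "d * sinh v / cosh v \<le> sinh (d * v)" using cv by (simp add: field_simps)
    then have "d * sinh v / cosh v * cosh y \<le> sinh (d * v) * cosh y"
      using cv by (intro mult_right_mono) auto
    with 1 show ?thesis by (simp add: mult.commute)
  next
    case False
    then have "d * sinh v \<le> sinh (d * v)" using v by (intro sinh_mult_ge) auto
    then have "d * sinh v * cosh y \<le> sinh (d * v) * cosh y"
      using cv by (intro mult_right_mono) auto
    moreover have "d * sinh v * (cosh y / cosh v) \<le> d * sinh v * cosh y"
      using cv d sv by (intro mult_left_mono) (auto simp: field_simps)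
    ultimately have "d * sinh v * (2 - cosh v / cosh y) \<le> sinh (d * v) * cosh y"
      using 1 by linarith
    then show ?thesis by (simp only: mult.commute)
  qed
qed

lemma smoothing_rate_less_1:
  fixes m \<tau> :: real
  assumes "2 < m" "0 \<le> \<tau>" "\<tau>\<^sup>2 = (m - 2) / (m - 1)"
  shows "\<tau> < 1"
proof -
  have "\<tau>\<^sup>2 < 1" using assms by simp
  then show ?thesis using assms(2) by (simp add: power2_less_1_iff)
qed

text \<open>
  The function with values \<open>exp y\<close> and \<open>exp (- y)\<close> becomes, after noise, \<open>cosh y \<plusminus> \<tau> sinh y\<close>. The
  inequality is an equality at \<open>y = 0\<close>, so logarithmic derivatives are compared. Writing \<open>X\<close>, \<open>Y\<close>
  for the two smoothed values, that of the right-hand side is a mean of \<open>X'/X\<close> and \<open>Y'/Y\<close> with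
  weights \<open>X powr q\<close>, \<open>Y powr q\<close>; once \<open>powr_ratio_ge\<close> bounds their relative difference by
  \<open>q\<close> times that of \<open>X\<close> and \<open>Y\<close>, everything is hyperbolic and reduces to \<open>hyperbolic_key\<close> with \<open>v = 2y/m\<close>.
\<close>

lemma two_point_smoothing_exp:
  fixes y m \<tau> :: real
  assumes y: "0 \<le> y" and m: "2 < m" and \<tau>: "0 \<le> \<tau>" "\<tau>\<^sup>2 = (m - 2) / (m - 1)"
  shows "sqrt (cosh (2 * y / m))
    \<le> ((cosh y + \<tau> * sinh y) powr (1/m) + (cosh y - \<tau> * sinh y) powr (1/m)) / 2"
proof -
  define q where "q = 1 / m"
  define X where "X t = cosh t + \<tau> * sinh t" for t
  define Y where "Y t = cosh t - \<tau> * sinh t" for t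
  define h where "h t = ln ((X t powr q + Y t powr q) / 2) - ln (cosh (2 * t / m)) / 2" for t
  have q: "0 < q" "q \<le> 1" using m by (auto simp: q_def)
  note \<tau>1 = smoothing_rate_less_1[OF m \<tau>]
  have pos: "0 < Y t" "Y t \<le> X t" if "0 \<le> t" for t
  proof -
    have "\<tau> * sinh t \<le> 1 * sinh t" using \<tau>1 that by (intro mult_right_mono) auto
    also have "\<dots> < cosh t" by (simp add: sinh_less_cosh_real)
    finally show "0 < Y t" by (simp add: Y_def)
    show "Y t \<le> X t" using \<tau>(1) that by (simp add: X_def Y_def)
  qed
  have "h 0 \<le> h y"
  proof (rule DERIV_nonneg_imp_nondecreasing[OF y])
    fix t assume t: "0 \<le> t" "t \<le> y"
    note p = pos[OF t(1)]
    have pX: "0 < X t" using p by linarith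
    define X' where "X' = sinh t + \<tau> * cosh t"
    define Y' where "Y' = sinh t - \<tau> * cosh t"
    have dX: "(X has_real_derivative X') (at t)" "(Y has_real_derivative Y') (at t)"
      unfolding X_def[abs_def] Y_def[abs_def] X'_def Y'_def by (auto intro!: derivative_eq_intros)
    define P where "P = X t powr q"
    define N where "N = Y t powr q"
    have PN: "0 < P" "0 < N" using p pX by (auto simp: P_def N_def)
    have XY1: "X t powr (q - 1) = P / X t" "Y t powr (q - 1) = N / Y t"
      using p pX by (auto simp: P_def N_def powr_diff)
    have dXq: "((\<lambda>t. X t powr q) has_real_derivative q * (P * (X' / X t))) (at t)"
              "((\<lambda>t. Y t powr q) has_real_derivative q * (N * (Y' / Y t))) (at t)"
      using p pX by (auto intro!: derivative_eq_intros dX simp: XY1 P_def[symmetric] N_def[symmetric])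
    let ?d = "q * ((P * (X' / X t) + N * (Y' / Y t)) / (P + N) - tanh (2 * t / m))"
    have d1: "((\<lambda>t. ln ((X t powr q + Y t powr q) / 2)) has_real_derivative
        (q * (P * (X' / X t)) + q * (N * (Y' / Y t))) / (P + N)) (at t)"
    proof (rule DERIV_cong[OF DERIV_chain2[OF DERIV_ln DERIV_cdivide[OF DERIV_add[OF dXq]]]])
      show "0 < (X t powr q + Y t powr q) / 2" using PN by (auto simp: P_def N_def intro!: add_pos_pos)
    qed (use PN in \<open>simp add: P_def[symmetric] N_def[symmetric] field_simps\<close>)
    have d2: "((\<lambda>t. ln (cosh (2 * t / m)) / 2) has_real_derivative q * tanh (2 * t / m)) (at t)"
      using m by (auto intro!: derivative_eq_intros simp: tanh_def q_def cosh_real_pos)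
    have "(h has_real_derivative ?d) (at t)"
      unfolding h_def by (rule DERIV_cong[OF DERIV_diff[OF d1 d2]]) (simp add: right_diff_distrib add_divide_distrib distrib_left)
    moreover have "0 \<le> ?d"
    proof -
      define s c where "s = sinh t" and "c = cosh t"
      have s: "0 \<le> s" and c: "1 \<le> c" using t by (auto simp: s_def c_def cosh_real_ge_1)
      have c2: "c\<^sup>2 = 1 + s\<^sup>2" by (simp add: s_def c_def cosh_square_eq)
      \<comment> \<open>the claim becomes an inequality between \<open>tanh v\<close> and functions of \<open>t = v + d v\<close>\<close>
      define v d where "v = 2 * t / m" and "d = m / 2 - 1"
      have v: "0 \<le> v" and d: "0 \<le> d" and tv: "t = v + d * v" and m_d: "m = 2 * (d + 1)"
        using t m by (auto simp: v_def d_def field_simps)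
      have cv: "1 \<le> cosh v" "0 \<le> sinh v" using v by (auto simp: cosh_real_ge_1)
      have rs: "(1 + d) * sinh v \<le> s"
        using sinh_mult_ge[of "1 + d" v] d v by (simp add: s_def tv algebra_simps)
      define Z where "Z = X t * Y t"
      have Z: "0 < Z" using p pX by (simp add: Z_def)
      have Zeq: "Z = 1 + (1 - \<tau>\<^sup>2) * s\<^sup>2"
        using c2 by (simp add: Z_def X_def Y_def s_def[symmetric] c_def[symmetric] algebra_simps power2_eq_square)
      have ratio: "q * (\<tau> * s / c) \<le> (P - N) / (P + N)"
      proof -
        have "q * (2 * \<tau> * s) * (P + N) \<le> (P - N) * (2 * c)"
          using powr_ratio_ge[OF p q] by (simp add: P_def N_def X_def Y_def s_def c_def)
        then show ?thesis using PN c by (simp add: field_simps)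
      qed
      have half: "(P * (X' / X t) + N * (Y' / Y t)) / (P + N)
        = (X' / X t + Y' / Y t) / 2 + (X' / X t - Y' / Y t) / 2 * ((P - N) / (P + N))"
      proof -
        have "(P * a + N * b) / (P + N) = (a + b) / 2 + (a - b) / 2 * ((P - N) / (P + N))" for a b
          using PN by (simp add: field_simps)
        then show ?thesis .
      qed
      have sum: "X' / X t + Y' / Y t = 2 * (1 - \<tau>\<^sup>2) * s * c / Z"
      proof -
        have "X' / X t + Y' / Y t = (X' * Y t + Y' * X t) / Z" using p pX by (simp add: Z_def field_simps)
        also have "X' * Y t + Y' * X t = 2 * (1 - \<tau>\<^sup>2) * s * c"
          by (simp add: X'_def Y'_def X_def Y_def s_def c_def algebra_simps power2_eq_square)
        finally show ?thesis .
      qed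
      have diff: "X' / X t - Y' / Y t = 2 * \<tau> / Z"
      proof -
        have "X' / X t - Y' / Y t = (X' * Y t - Y' * X t) / Z" using p pX by (simp add: Z_def field_simps)
        also have "X' * Y t - Y' * X t = 2 * \<tau> * (c\<^sup>2 - s\<^sup>2)"
          by (simp add: X'_def Y'_def X_def Y_def s_def c_def algebra_simps power2_eq_square)
        finally show ?thesis by (simp add: c2)
      qed
      have "((1 - \<tau>\<^sup>2) * s * c + q * \<tau>\<^sup>2 * (s / c)) / Z
          = 2 * (1 - \<tau>\<^sup>2) * s * c / Z / 2 + 2 * \<tau> / Z / 2 * (q * (\<tau> * s / c))"
        using Z by (simp add: field_simps power2_eq_square)
      also have "\<dots> \<le> (P * (X' / X t) + N * (Y' / Y t)) / (P + N)"
        unfolding half sum diff using ratio Z \<tau>(1) by (intro add_left_mono mult_left_mono) auto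
      finally have A: "((1 - \<tau>\<^sup>2) * s * c + q * \<tau>\<^sup>2 * (s / c)) / Z
          \<le> (P * (X' / X t) + N * (Y' / Y t)) / (P + N)" .
      have t2: "1 - \<tau>\<^sup>2 = 1 / (2 * d + 1)" "q * \<tau>\<^sup>2 = d / (1 + d) / (2 * d + 1)"
        using m d by (auto simp: \<tau> q_def m_d divide_simps) (auto simp: algebra_simps)
      have key: "d * sinh v * (2 - cosh v / c) \<le> c * sinh (d * v)"
        using hyperbolic_key[OF v d] by (simp add: c_def tv)
      have e1: "c * sinh (d * v) = s * (c * cosh v - s * sinh v) - sinh v"
      proof -
        have "d * v = t - v" by (simp add: tv)
        then have "c * sinh (d * v) = c * (s * cosh v - c * sinh v)"
          by (simp add: sinh_diff s_def c_def)
        also have "\<dots> = s * c * cosh v - c\<^sup>2 * sinh v" by (simp add: algebra_simps power2_eq_square)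
        also have "\<dots> = s * (c * cosh v - s * sinh v) - sinh v"
          unfolding c2 by (simp add: algebra_simps power2_eq_square)
        finally show ?thesis .
      qed
      have "d * sinh v * (cosh v / c) = d / (1 + d) * ((1 + d) * sinh v) * (cosh v / c)"
        using d by simp
      also have "\<dots> \<le> d / (1 + d) * s * (cosh v / c)"
        using d cv c rs by (intro mult_right_mono mult_left_mono) auto
      finally have e2: "d * sinh v * (cosh v / c) \<le> d / (1 + d) * (s / c) * cosh v" by simp
      have "(2 * d + 1 + s\<^sup>2) * sinh v \<le> (s * c + d / (1 + d) * (s / c)) * cosh v"
        using key e2 unfolding e1 by (simp add: algebra_simps power2_eq_square)
      then have "(2 * d + 1 + s\<^sup>2) * tanh v \<le> s * c + d / (1 + d) * (s / c)"
        using cv by (simp add: tanh_def field_simps)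
      then have "(2 * d + 1 + s\<^sup>2) * tanh v / (2 * d + 1) \<le> (s * c + d / (1 + d) * (s / c)) / (2 * d + 1)"
        using d by (intro divide_right_mono) auto
      moreover have "(2 * d + 1 + s\<^sup>2) * tanh v / (2 * d + 1) = Z * tanh v"
      proof -
        have "2 * d + 1 \<noteq> 0" using d by linarith
        then show ?thesis unfolding Zeq t2 by (simp add: field_simps)
      qed
      moreover have "(s * c + d / (1 + d) * (s / c)) / (2 * d + 1) = (1 - \<tau>\<^sup>2) * s * c + q * \<tau>\<^sup>2 * (s / c)"
        unfolding t2 by (simp add: add_divide_distrib)
      ultimately have "tanh v \<le> ((1 - \<tau>\<^sup>2) * s * c + q * \<tau>\<^sup>2 * (s / c)) / Z"
        using Z by (simp add: pos_le_divide_eq mult.commute)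
      with A have "tanh v \<le> (P * (X' / X t) + N * (Y' / Y t)) / (P + N)" by linarith
      then show ?thesis using q by (simp add: v_def)
    qed
    ultimately show "\<exists>z. (h has_real_derivative z) (at t) \<and> 0 \<le> z" by blast
  qed
  then have "ln (cosh (2 * y / m)) / 2 \<le> ln ((X y powr q + Y y powr q) / 2)"
    by (simp add: h_def X_def Y_def)
  then have "ln (sqrt (cosh (2 * y / m))) \<le> ln ((X y powr q + Y y powr q) / 2)"
    by (simp add: ln_sqrt)
  moreover have "0 < (X y powr q + Y y powr q) / 2" using pos[OF y] by (simp add: add_pos_pos)
  ultimately have "sqrt (cosh (2 * y / m)) \<le> (X y powr q + Y y powr q) / 2"
    by (subst (asm) ln_le_cancel_iff) auto
  then show ?thesis by (simp add: X_def Y_def q_def)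
qed

text \<open>
  Reverse hypercontractivity of the noise operator on a two-point space, from the moment of
  order \<open>2/m\<close> to that of order \<open>1/m\<close>: the condition on \<open>\<tau>\<close> is Borell's \<open>\<tau>\<^sup>2 = (1 - 2/m) / (1 - 1/m)\<close>.
  Positive values are a multiple of \<open>exp y, exp (- y)\<close>, and a zero value is a limit.
\<close>

lemma two_point_smoothing:
  fixes A B m \<tau> :: real
  assumes AB: "0 \<le> A" "0 \<le> B" and m: "2 < m" and \<tau>: "0 \<le> \<tau>" "\<tau>\<^sup>2 = (m - 2) / (m - 1)"
  shows "sqrt ((A powr (2/m) + B powr (2/m)) / 2)
    \<le> (((1 + \<tau>) / 2 * A + (1 - \<tau>) / 2 * B) powr (1/m) + ((1 - \<tau>) / 2 * A + (1 + \<tau>) / 2 * B) powr (1/m)) / 2"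
proof -
  let ?L = "\<lambda>A B. sqrt ((A powr (2/m) + B powr (2/m)) / 2)"
  let ?R = "\<lambda>A B. (((1 + \<tau>) / 2 * A + (1 - \<tau>) / 2 * B) powr (1/m) + ((1 - \<tau>) / 2 * A + (1 + \<tau>) / 2 * B) powr (1/m)) / 2"
  note \<tau>1 = smoothing_rate_less_1[OF m \<tau>]
  have pos: "?L A B \<le> ?R A B" if "0 < B" "B \<le> A" for A B
  proof -
    obtain c y where c: "0 < c" and y: "0 \<le> y" and ex: "A = c * exp y" "B = c * exp (- y)"
      by (rule positive_pair_exp[OF \<open>0 < B\<close> \<open>B \<le> A\<close>])
    have "sinh y < cosh y" by (rule sinh_less_cosh_real)
    moreover have "\<tau> * sinh y \<le> 1 * sinh y" using \<tau>1 y by (intro mult_right_mono) auto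
    ultimately have nn: "0 \<le> cosh y - \<tau> * sinh y" "0 \<le> cosh y + \<tau> * sinh y"
      using \<tau>(1) y by (auto intro!: add_nonneg_nonneg)
    have "A powr (2/m) + B powr (2/m) = c powr (2/m) * (exp (2 * y / m) + exp (- (2 * y / m)))"
      using c by (simp add: ex powr_mult exp_powr_real algebra_simps)
    also have "\<dots> = 2 * (c powr (2/m) * cosh (2 * y / m))" by (simp add: exp_cosh_sinh)
    finally have "?L A B = sqrt (c powr (2/m)) * sqrt (cosh (2 * y / m))"
      by (simp add: real_sqrt_mult)
    also have "sqrt (c powr (2/m)) = c powr (1/m)"
      using c by (simp add: powr_half_sqrt[symmetric] powr_powr)
    also have "c powr (1/m) * sqrt (cosh (2 * y / m))
      \<le> c powr (1/m) * (((cosh y + \<tau> * sinh y) powr (1/m) + (cosh y - \<tau> * sinh y) powr (1/m)) / 2)"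
      by (intro mult_left_mono two_point_smoothing_exp y m \<tau>) auto
    also have "\<dots> = ((c * (cosh y + \<tau> * sinh y)) powr (1/m) + (c * (cosh y - \<tau> * sinh y)) powr (1/m)) / 2"
      unfolding powr_mult by (simp add: field_simps)
    also have "c * (cosh y + \<tau> * sinh y) = (1 + \<tau>) / 2 * A + (1 - \<tau>) / 2 * B"
      unfolding ex exp_cosh_sinh by (simp add: field_simps)
    also have "c * (cosh y - \<tau> * sinh y) = (1 - \<tau>) / 2 * A + (1 + \<tau>) / 2 * B"
      unfolding ex exp_cosh_sinh by (simp add: field_simps)
    finally show ?thesis .
  qed
  have le: "?L A B \<le> ?R A B" if "0 \<le> B" "B \<le> A" "0 < A" for A B
  proof (cases "B = 0")
    case True
    have ev0: "\<forall>\<^sub>F t in at_right 0. 0 \<le> (t::real)"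
      by (rule eventually_mono[OF eventually_at_right_less]) simp
    have L: "((\<lambda>t. ?L A t) \<longlongrightarrow> ?L A 0) (at_right 0)"
      using m that ev0 by (intro tendsto_intros tendsto_powr') auto
    have R: "((\<lambda>t. ?R A t) \<longlongrightarrow> ?R A 0) (at_right 0)"
      using m that \<tau>(1) \<tau>1 by (intro tendsto_intros tendsto_powr') auto
    have "eventually (\<lambda>t. ?L A t \<le> ?R A t) (at_right 0)"
      using eventually_at_right_real[OF that(3)] by eventually_elim (use pos in auto)
    then have "?L A 0 \<le> ?R A 0" by (rule tendsto_le[OF trivial_limit_at_right_real R L])
    then show ?thesis using True by simp
  qed (use pos that in auto)
  show ?thesis
  proof (cases "A = 0 \<and> B = 0")
    case False
    show ?thesis
    proof (cases "B \<le> A")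
      case True
      then show ?thesis using le[of B A] AB False by force
    next
      case F: False
      then have "?L B A \<le> ?R B A" using AB by (intro le) auto
      then show ?thesis by (simp only: add.commute)
    qed
  qed (use m in auto)
qed

section \<open>Mean and noise on the discrete cube\<close>

text \<open>
  Points of the cube \<open>{0,1}\<close>\<open>\<^sup>I\<close> are encoded as subsets of \<open>I\<close>.
\<close>

definition cube_mean :: "'a set \<Rightarrow> ('a set \<Rightarrow> real) \<Rightarrow> real" where
  "cube_mean I \<phi> = (\<Sum>x\<in>Pow I. \<phi> x) / 2 ^ card I"

text \<open>
  The transition probabilities of independent bit flips. Negative \<open>\<rho>\<close> matter: the votes on two
  adjacent pairs have correlation \<open>-1/3\<close> under the uniform distribution.
\<close>

definition noise_kernel :: "real \<Rightarrow> 'a set \<Rightarrow> 'a set \<Rightarrow> 'a set \<Rightarrow> real" where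
  "noise_kernel \<rho> I x y = (\<Prod>i\<in>I. if (i \<in> x) = (i \<in> y) then (1 + \<rho>) / 2 else (1 - \<rho>) / 2)"

definition noise :: "real \<Rightarrow> 'a set \<Rightarrow> ('a set \<Rightarrow> real) \<Rightarrow> 'a set \<Rightarrow> real" where
  "noise \<rho> I \<phi> x = (\<Sum>y\<in>Pow I. noise_kernel \<rho> I x y * \<phi> y)"

lemma sum_Pow_Un:
  fixes \<phi> :: "'a set \<Rightarrow> real"
  assumes "A \<inter> B = {}"
  shows "(\<Sum>x\<in>Pow (A \<union> B). \<phi> x) = (\<Sum>z\<in>Pow A. \<Sum>u\<in>Pow B. \<phi> (z \<union> u))"
proof -
  have "(\<Sum>z\<in>Pow A. \<Sum>u\<in>Pow B. \<phi> (z \<union> u)) = (\<Sum>(z, u)\<in>Pow A \<times> Pow B. \<phi> (z \<union> u))"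
    by (rule sum.cartesian_product)
  also have "\<dots> = (\<Sum>x\<in>Pow (A \<union> B). \<phi> x)"
    by (rule sum.reindex_bij_witness[where i = "\<lambda>x. (x \<inter> A, x \<inter> B)" and j = "\<lambda>(z, u). z \<union> u"])
      (use assms in auto)
  finally show ?thesis by simp
qed

lemma cube_mean_Un:
  assumes "finite A" "finite B" "A \<inter> B = {}"
  shows "cube_mean (A \<union> B) \<phi> = cube_mean A (\<lambda>z. cube_mean B (\<lambda>u. \<phi> (z \<union> u)))"
  using assms by (simp add: cube_mean_def sum_Pow_Un card_Un_disjoint power_add sum_divide_distrib mult.commute)

lemma cube_mean_empty [simp]: "cube_mean {} \<phi> = \<phi> {}"
  by (simp add: cube_mean_def)

lemma cube_mean_singleton: "cube_mean {i} \<phi> = (\<phi> {} + \<phi> {i}) / 2"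
  by (simp add: cube_mean_def Pow_insert)

lemma cube_mean_insert:
  assumes "finite I" "i \<notin> I"
  shows "cube_mean (insert i I) \<phi> = (cube_mean I \<phi> + cube_mean I (\<lambda>x. \<phi> (insert i x))) / 2"
  using cube_mean_Un[of I "{i}" \<phi>] assms
  by (simp add: cube_mean_singleton)
     (simp add: cube_mean_def sum.distrib sum_divide_distrib[symmetric] add_divide_distrib)

lemma cube_mean_cong: "(\<And>x. x \<subseteq> I \<Longrightarrow> \<phi> x = \<psi> x) \<Longrightarrow> cube_mean I \<phi> = cube_mean I \<psi>"
  by (simp add: cube_mean_def)

lemma cube_mean_mono: "(\<And>x. x \<subseteq> I \<Longrightarrow> \<phi> x \<le> \<psi> x) \<Longrightarrow> cube_mean I \<phi> \<le> cube_mean I \<psi>"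
  unfolding cube_mean_def by (intro divide_right_mono sum_mono) auto

lemma cube_mean_nonneg: "(\<And>x. x \<subseteq> I \<Longrightarrow> 0 \<le> \<phi> x) \<Longrightarrow> 0 \<le> cube_mean I \<phi>"
  unfolding cube_mean_def by (intro divide_nonneg_pos sum_nonneg) auto

lemma cube_mean_add: "cube_mean I (\<lambda>x. \<phi> x + \<psi> x) = cube_mean I \<phi> + cube_mean I \<psi>"
  by (simp add: cube_mean_def sum.distrib add_divide_distrib)

lemma cube_mean_diff: "cube_mean I (\<lambda>x. \<phi> x - \<psi> x) = cube_mean I \<phi> - cube_mean I \<psi>"
  by (simp add: cube_mean_def sum_subtractf diff_divide_distrib)

lemma cube_mean_cmult: "cube_mean I (\<lambda>x. c * \<phi> x) = c * cube_mean I \<phi>"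
  by (simp add: cube_mean_def sum_distrib_left)

lemma cube_mean_const: "finite I \<Longrightarrow> cube_mean I (\<lambda>x. c) = c"
  by (simp add: cube_mean_def card_Pow)

lemma cube_mean_sum: "cube_mean I (\<lambda>x. \<Sum>j\<in>J. \<phi> j x) = (\<Sum>j\<in>J. cube_mean I (\<phi> j))"
  unfolding cube_mean_def sum_divide_distrib by (rule sum.swap)

lemma cube_mean_swap: "cube_mean A (\<lambda>z. cube_mean B (\<phi> z)) = cube_mean B (\<lambda>u. cube_mean A (\<lambda>z. \<phi> z u))"
  unfolding cube_mean_def sum_divide_distrib by (subst sum.swap) (simp add: mult.commute)

lemma cube_mean_complement: "cube_mean I (\<lambda>x. \<phi> (I - x)) = cube_mean I \<phi>"
  unfolding cube_mean_def
  by (rule arg_cong[where f = "\<lambda>s. s / _"], rule sum.reindex_bij_witness[where i = "\<lambda>x. I - x" and j = "\<lambda>x. I - x"]) auto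

lemma cube_mean_square_ge:
  assumes "finite I"
  shows "(cube_mean I \<phi>)\<^sup>2 \<le> cube_mean I (\<lambda>x. (\<phi> x)\<^sup>2)"
proof -
  let ?a = "cube_mean I \<phi>"
  have "0 \<le> cube_mean I (\<lambda>x. (\<phi> x - ?a)\<^sup>2)" by (intro cube_mean_nonneg) auto
  also have "cube_mean I (\<lambda>x. (\<phi> x - ?a)\<^sup>2) = cube_mean I (\<lambda>x. (\<phi> x)\<^sup>2 - (2 * ?a) * \<phi> x + ?a\<^sup>2)"
    by (intro cube_mean_cong) (simp add: power2_eq_square algebra_simps)
  also have "\<dots> = cube_mean I (\<lambda>x. (\<phi> x)\<^sup>2) - ?a\<^sup>2"
    by (simp only: cube_mean_add cube_mean_diff cube_mean_cmult cube_mean_const[OF assms])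
       (simp add: power2_eq_square)
  finally show ?thesis by simp
qed

lemma noise_kernel_nonneg: "\<bar>\<rho>\<bar> \<le> 1 \<Longrightarrow> 0 \<le> noise_kernel \<rho> I x y"
  unfolding noise_kernel_def by (intro prod_nonneg) auto

lemma noise_kernel_sym: "noise_kernel \<rho> I x y = noise_kernel \<rho> I y x"
  unfolding noise_kernel_def by (intro prod.cong) auto

lemma noise_kernel_cong:
  assumes "x \<inter> I = x' \<inter> I" "y \<inter> I = y' \<inter> I"
  shows "noise_kernel \<rho> I x y = noise_kernel \<rho> I x' y'"
proof -
  have "i \<in> x \<longleftrightarrow> i \<in> x'" "i \<in> y \<longleftrightarrow> i \<in> y'" if "i \<in> I" for i
    using assms that by blast+
  then show ?thesis unfolding noise_kernel_def by (intro prod.cong) simp_all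
qed

lemma noise_kernel_Un:
  assumes "finite A" "finite B" "A \<inter> B = {}" "x \<subseteq> A" "y \<subseteq> A" "u \<subseteq> B" "w \<subseteq> B"
  shows "noise_kernel \<rho> (A \<union> B) (x \<union> u) (y \<union> w) = noise_kernel \<rho> A x y * noise_kernel \<rho> B u w"
proof -
  have "noise_kernel \<rho> (A \<union> B) (x \<union> u) (y \<union> w)
      = noise_kernel \<rho> A (x \<union> u) (y \<union> w) * noise_kernel \<rho> B (x \<union> u) (y \<union> w)"
    using assms unfolding noise_kernel_def by (intro prod.union_disjoint) auto
  also have "noise_kernel \<rho> A (x \<union> u) (y \<union> w) = noise_kernel \<rho> A x y"
    using assms by (intro noise_kernel_cong) auto
  also have "noise_kernel \<rho> B (x \<union> u) (y \<union> w) = noise_kernel \<rho> B u w"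
    using assms by (intro noise_kernel_cong) auto
  finally show ?thesis .
qed

lemma noise_Un:
  assumes "finite A" "finite B" "A \<inter> B = {}" "x \<subseteq> A" "u \<subseteq> B"
  shows "noise \<rho> (A \<union> B) \<phi> (x \<union> u) = noise \<rho> A (\<lambda>z. noise \<rho> B (\<lambda>w. \<phi> (z \<union> w)) u) x"
proof -
  have "noise \<rho> (A \<union> B) \<phi> (x \<union> u)
      = (\<Sum>z\<in>Pow A. \<Sum>w\<in>Pow B. noise_kernel \<rho> (A \<union> B) (x \<union> u) (z \<union> w) * \<phi> (z \<union> w))"
    unfolding noise_def by (rule sum_Pow_Un[OF assms(3)])
  also have "\<dots> = (\<Sum>z\<in>Pow A. \<Sum>w\<in>Pow B. noise_kernel \<rho> A x z * (noise_kernel \<rho> B u w * \<phi> (z \<union> w)))"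
    using assms by (intro sum.cong refl) (simp add: noise_kernel_Un)
  finally show ?thesis by (simp add: noise_def sum_distrib_left)
qed

lemma noise_empty [simp]: "noise \<rho> {} \<phi> x = \<phi> {}"
  by (simp add: noise_def noise_kernel_def)

lemma noise_singleton:
  "noise \<rho> {i} \<phi> x = (if i \<in> x then (1 - \<rho>) / 2 * \<phi> {} + (1 + \<rho>) / 2 * \<phi> {i}
     else (1 + \<rho>) / 2 * \<phi> {} + (1 - \<rho>) / 2 * \<phi> {i})"
  by (simp add: noise_def noise_kernel_def Pow_insert)

lemma noise_add: "noise \<rho> I (\<lambda>x. \<phi> x + \<psi> x) z = noise \<rho> I \<phi> z + noise \<rho> I \<psi> z"
  by (simp add: noise_def sum.distrib algebra_simps)

lemma noise_diff: "noise \<rho> I (\<lambda>x. \<phi> x - \<psi> x) z = noise \<rho> I \<phi> z - noise \<rho> I \<psi> z"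
  by (simp add: noise_def sum_subtractf algebra_simps)

lemma noise_cmult: "noise \<rho> I (\<lambda>x. c * \<phi> x) z = c * noise \<rho> I \<phi> z"
  by (simp add: noise_def sum_distrib_left algebra_simps)

lemma noise_sum: "noise \<rho> I (\<lambda>x. \<Sum>j\<in>J. \<phi> j x) z = (\<Sum>j\<in>J. noise \<rho> I (\<phi> j) z)"
  unfolding noise_def sum_distrib_left by (rule sum.swap)

lemma noise_cong: "(\<And>x. x \<subseteq> I \<Longrightarrow> \<phi> x = \<psi> x) \<Longrightarrow> noise \<rho> I \<phi> z = noise \<rho> I \<psi> z"
  by (simp add: noise_def)

lemma noise_mono: "\<bar>\<rho>\<bar> \<le> 1 \<Longrightarrow> (\<And>x. x \<subseteq> I \<Longrightarrow> \<phi> x \<le> \<psi> x) \<Longrightarrow> noise \<rho> I \<phi> z \<le> noise \<rho> I \<psi> z"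
  unfolding noise_def by (intro sum_mono mult_left_mono noise_kernel_nonneg) auto

lemma noise_nonneg: "\<bar>\<rho>\<bar> \<le> 1 \<Longrightarrow> (\<And>x. x \<subseteq> I \<Longrightarrow> 0 \<le> \<phi> x) \<Longrightarrow> 0 \<le> noise \<rho> I \<phi> z"
  unfolding noise_def by (intro sum_nonneg mult_nonneg_nonneg noise_kernel_nonneg) auto

lemma noise_insert:
  assumes "finite I" "i \<notin> I" "x \<subseteq> I"
  shows "noise \<rho> (insert i I) \<phi> x
      = (1 + \<rho>) / 2 * noise \<rho> I \<phi> x + (1 - \<rho>) / 2 * noise \<rho> I (\<lambda>y. \<phi> (insert i y)) x" (is ?A)
    and "noise \<rho> (insert i I) \<phi> (insert i x)
      = (1 - \<rho>) / 2 * noise \<rho> I \<phi> x + (1 + \<rho>) / 2 * noise \<rho> I (\<lambda>y. \<phi> (insert i y)) x" (is ?B)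
proof -
  have "noise \<rho> (I \<union> {i}) \<phi> (x \<union> {}) = noise \<rho> I (\<lambda>z. noise \<rho> {i} (\<lambda>w. \<phi> (z \<union> w)) {}) x"
    by (rule noise_Un) (use assms in auto)
  also have "(\<lambda>z. noise \<rho> {i} (\<lambda>w. \<phi> (z \<union> w)) {})
      = (\<lambda>z. (1 + \<rho>) / 2 * \<phi> z + (1 - \<rho>) / 2 * \<phi> (insert i z))"
    by (simp add: noise_singleton)
  finally show ?A by (simp only: noise_add noise_cmult Un_insert_right Un_empty_right)
  have "noise \<rho> (I \<union> {i}) \<phi> (x \<union> {i}) = noise \<rho> I (\<lambda>z. noise \<rho> {i} (\<lambda>w. \<phi> (z \<union> w)) {i}) x"
    by (rule noise_Un) (use assms in auto)
  also have "(\<lambda>z. noise \<rho> {i} (\<lambda>w. \<phi> (z \<union> w)) {i})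
      = (\<lambda>z. (1 - \<rho>) / 2 * \<phi> z + (1 + \<rho>) / 2 * \<phi> (insert i z))"
    by (simp add: noise_singleton)
  finally show ?B by (simp only: noise_add noise_cmult Un_insert_right Un_empty_right)
qed

lemma noise_const:
  assumes "finite I" "x \<subseteq> I"
  shows "noise \<rho> I (\<lambda>_. c) x = c"
  using assms
proof (induction I arbitrary: x rule: finite_induct)
  case (insert i I)
  have "noise \<rho> (insert i I) (\<lambda>_. c) x = c" if "i \<notin> x"
    using that insert by (subst noise_insert) (auto simp: field_simps)
  moreover have "noise \<rho> (insert i I) (\<lambda>_. c) x = c" if "i \<in> x"
  proof -
    define y where "y = x - {i}"
    then have "x = insert i y" "y \<subseteq> I" using that insert.prems by auto
    then show ?thesis using insert by (simp add: noise_insert) (simp add: field_simps)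
  qed
  ultimately show ?case by blast
qed simp

text \<open>
  The noise operators form a semigroup; this is how a correlation is factored into smaller
  steps.
\<close>

lemma noise_noise:
  assumes "finite I" "x \<subseteq> I"
  shows "noise \<rho> I (noise \<tau> I \<phi>) x = noise (\<rho> * \<tau>) I \<phi> x"
  using assms
proof (induction I arbitrary: x \<phi> rule: finite_induct)
  case (insert i I)
  let ?\<psi> = "\<lambda>y. \<phi> (insert i y)"
  have *: "noise \<rho> I (noise \<tau> (insert i I) \<phi>) y
      = (1 + \<tau>) / 2 * noise (\<rho> * \<tau>) I \<phi> y + (1 - \<tau>) / 2 * noise (\<rho> * \<tau>) I ?\<psi> y" (is ?A)
     and **: "noise \<rho> I (\<lambda>x. noise \<tau> (insert i I) \<phi> (insert i x)) y
      = (1 - \<tau>) / 2 * noise (\<rho> * \<tau>) I \<phi> y + (1 + \<tau>) / 2 * noise (\<rho> * \<tau>) I ?\<psi> y" (is ?B)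
    if y: "y \<subseteq> I" for y
  proof -
    have "noise \<rho> I (noise \<tau> (insert i I) \<phi>) y
      = noise \<rho> I (\<lambda>x. (1 + \<tau>) / 2 * noise \<tau> I \<phi> x + (1 - \<tau>) / 2 * noise \<tau> I ?\<psi> x) y"
      by (rule noise_cong, rule noise_insert(1)[OF insert.hyps])
    then show ?A by (simp only: noise_add noise_cmult insert.IH[OF y])
    have "noise \<rho> I (\<lambda>x. noise \<tau> (insert i I) \<phi> (insert i x)) y
      = noise \<rho> I (\<lambda>x. (1 - \<tau>) / 2 * noise \<tau> I \<phi> x + (1 + \<tau>) / 2 * noise \<tau> I ?\<psi> x) y"
      by (rule noise_cong, rule noise_insert(2)[OF insert.hyps])
    then show ?B by (simp only: noise_add noise_cmult insert.IH[OF y])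
  qed
  show ?case
  proof (cases "i \<in> x")
    case True
    define y where "y = x - {i}"
    then have y: "x = insert i y" "y \<subseteq> I" using True insert.prems by auto
    show ?thesis unfolding y(1) noise_insert(2)[OF insert.hyps y(2)] *[OF y(2)] **[OF y(2)] by (simp add: field_simps)
  next
    case False
    then have y: "x \<subseteq> I" using insert.prems by auto
    show ?thesis unfolding noise_insert(1)[OF insert.hyps y] *[OF y] **[OF y] by (simp add: field_simps)
  qed
qed simp

lemma cube_mean_noise_sym: "cube_mean I (\<lambda>x. \<phi> x * noise \<rho> I \<psi> x) = cube_mean I (\<lambda>x. noise \<rho> I \<phi> x * \<psi> x)"
proof -
  have "(\<Sum>x\<in>Pow I. \<phi> x * noise \<rho> I \<psi> x) = (\<Sum>x\<in>Pow I. \<Sum>y\<in>Pow I. \<phi> x * (noise_kernel \<rho> I x y * \<psi> y))"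
    by (simp add: noise_def sum_distrib_left)
  also have "\<dots> = (\<Sum>y\<in>Pow I. \<Sum>x\<in>Pow I. \<phi> x * (noise_kernel \<rho> I x y * \<psi> y))"
    by (rule sum.swap)
  also have "\<dots> = (\<Sum>y\<in>Pow I. noise \<rho> I \<phi> y * \<psi> y)"
    unfolding noise_def sum_distrib_right
    by (intro sum.cong refl) (simp add: noise_kernel_sym mult_ac)
  finally show ?thesis by (simp add: cube_mean_def)
qed

lemma cube_mean_noise_insert:
  fixes \<phi> \<psi> :: "'a set \<Rightarrow> real" and \<rho> :: real
  assumes "finite I" "i \<notin> I"
  defines "E \<equiv> \<lambda>\<phi> \<psi>. cube_mean I (\<lambda>x. \<phi> x * noise \<rho> I \<psi> x)"
    and "s \<equiv> \<lambda>\<phi> x. \<phi> (insert i x)"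
  shows "cube_mean (insert i I) (\<lambda>x. \<phi> x * noise \<rho> (insert i I) \<psi> x)
    = (1 + \<rho>) / 4 * (E \<phi> \<psi> + E (s \<phi>) (s \<psi>)) + (1 - \<rho>) / 4 * (E \<phi> (s \<psi>) + E (s \<phi>) \<psi>)"
proof -
  have "cube_mean I (\<lambda>x. \<phi> x * noise \<rho> (insert i I) \<psi> x)
    = cube_mean I (\<lambda>x. (1 + \<rho>) / 2 * (\<phi> x * noise \<rho> I \<psi> x) + (1 - \<rho>) / 2 * (\<phi> x * noise \<rho> I (s \<psi>) x))"
    by (rule cube_mean_cong) (simp add: noise_insert(1)[OF assms(1,2)] s_def distrib_left mult_ac)
  moreover have "cube_mean I (\<lambda>x. \<phi> (insert i x) * noise \<rho> (insert i I) \<psi> (insert i x))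
    = cube_mean I (\<lambda>x. (1 - \<rho>) / 2 * (s \<phi> x * noise \<rho> I \<psi> x) + (1 + \<rho>) / 2 * (s \<phi> x * noise \<rho> I (s \<psi>) x))"
    by (rule cube_mean_cong) (simp add: noise_insert(2)[OF assms(1,2)] s_def distrib_left mult_ac)
  ultimately show ?thesis
    unfolding cube_mean_insert[OF assms(1,2)] cube_mean_add cube_mean_cmult E_def by (simp add: field_simps)
qed

lemma cube_mean_of_bool_bounds:
  assumes "finite U"
  shows "0 \<le> cube_mean U (\<lambda>u. of_bool (f u))" "cube_mean U (\<lambda>u. of_bool (f u)) \<le> 1"
  using cube_mean_mono[of U "\<lambda>u. of_bool (f u)" "\<lambda>_. 1"] cube_mean_const[OF assms, of 1]
  by (auto intro!: cube_mean_nonneg)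

lemma noise_of_bool_bounds:
  assumes "finite U" "u \<subseteq> U" "\<bar>\<tau>\<bar> \<le> 1"
  shows "0 \<le> noise \<tau> U (\<lambda>w. of_bool (f w)) u" "noise \<tau> U (\<lambda>w. of_bool (f w)) u \<le> 1"
  using noise_nonneg[OF assms(3), of U "\<lambda>w. of_bool (f w)" u]
    noise_mono[OF assms(3), of U "\<lambda>w. of_bool (f w)" "\<lambda>_. 1" u] noise_const[OF assms(1,2), of \<tau> 1]
  by auto

section \<open>Reverse hypercontractivity on the cube\<close>

text \<open>
  Tensorisation of \<open>two_point_reverse\<close>: split off one coordinate and apply the two-point
  inequality to the norms of the four restrictions.
\<close>

lemma reverse_holder_noise:
  fixes m :: real
  assumes I: "finite I" and m: "3/2 \<le> m" and \<rho>: "\<bar>\<rho>\<bar> \<le> 1 - 1/m"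
    and "\<And>x. x \<subseteq> I \<Longrightarrow> 0 \<le> \<phi> x" "\<And>x. x \<subseteq> I \<Longrightarrow> 0 \<le> \<psi> x"
  shows "cube_mean I (\<lambda>x. \<phi> x powr (1/m)) powr m * cube_mean I (\<lambda>x. \<psi> x powr (1/m)) powr m
    \<le> cube_mean I (\<lambda>x. \<phi> x * noise \<rho> I \<psi> x)"
  using I assms(4,5)
proof (induction I arbitrary: \<phi> \<psi> rule: finite_induct)
  case empty
  then show ?case using m by (simp add: powr_powr)
next
  case (insert i I)
  let ?\<phi> = "\<lambda>x. \<phi> (insert i x)" and ?\<psi> = "\<lambda>x. \<psi> (insert i x)"
  define N where "N \<phi> = cube_mean I (\<lambda>x. \<phi> x powr (1/m)) powr m" for \<phi> :: "'a set \<Rightarrow> real"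
  have Nq: "N \<phi> powr (1/m) = cube_mean I (\<lambda>x. \<phi> x powr (1/m))" for \<phi>
    using m by (simp add: N_def powr_powr cube_mean_nonneg)
  have N0: "0 \<le> N \<phi>" for \<phi> by (simp add: N_def)
  let ?E = "\<lambda>\<phi> \<psi>. cube_mean I (\<lambda>x. \<phi> x * noise \<rho> I \<psi> x)"
  have nn: "\<And>x. x \<subseteq> I \<Longrightarrow> 0 \<le> \<phi> x" "\<And>x. x \<subseteq> I \<Longrightarrow> 0 \<le> ?\<phi> x"
    "\<And>x. x \<subseteq> I \<Longrightarrow> 0 \<le> \<psi> x" "\<And>x. x \<subseteq> I \<Longrightarrow> 0 \<le> ?\<psi> x"
    by (rule insert.prems, blast)+
  have IH: "N \<phi> * N \<psi> \<le> ?E \<phi> \<psi>" "N ?\<phi> * N ?\<psi> \<le> ?E ?\<phi> ?\<psi>"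
    "N \<phi> * N ?\<psi> \<le> ?E \<phi> ?\<psi>" "N ?\<phi> * N \<psi> \<le> ?E ?\<phi> \<psi>"
    unfolding N_def by (intro insert.IH nn; assumption)+
  have \<rho>1: "\<bar>\<rho>\<bar> \<le> 1" using \<rho> m divide_nonneg_nonneg[of 1 m] by linarith
  have "cube_mean (insert i I) (\<lambda>x. \<phi> x powr (1/m)) powr m * cube_mean (insert i I) (\<lambda>x. \<psi> x powr (1/m)) powr m
    = ((N \<phi> powr (1/m) + N ?\<phi> powr (1/m)) / 2) powr m * ((N \<psi> powr (1/m) + N ?\<psi> powr (1/m)) / 2) powr m"
    unfolding Nq using insert.hyps by (simp add: cube_mean_insert)
  also have "\<dots> \<le> (1 + \<rho>) / 4 * (N \<phi> * N \<psi> + N ?\<phi> * N ?\<psi>) + (1 - \<rho>) / 4 * (N \<phi> * N ?\<psi> + N ?\<phi> * N \<psi>)"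
    by (rule two_point_reverse[OF N0 N0 N0 N0 m \<rho>])
  also have "\<dots> \<le> (1 + \<rho>) / 4 * (?E \<phi> \<psi> + ?E ?\<phi> ?\<psi>) + (1 - \<rho>) / 4 * (?E \<phi> ?\<psi> + ?E ?\<phi> \<psi>)"
    using \<rho>1 by (intro add_mono mult_left_mono IH) auto
  also have "\<dots> = cube_mean (insert i I) (\<lambda>x. \<phi> x * noise \<rho> (insert i I) \<psi> x)"
    by (rule cube_mean_noise_insert[OF insert.hyps, symmetric])
  finally show ?case .
qed

text \<open>
  The triangle inequality in \<open>L\<^sup>2\<close>, for the mean of a family of functions.
\<close>

lemma cube_mean_minkowski:
  assumes "finite B"
  shows "sqrt (cube_mean A (\<lambda>z. (cube_mean B (\<lambda>u. \<phi> z u))\<^sup>2))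
    \<le> cube_mean B (\<lambda>u. sqrt (cube_mean A (\<lambda>z. (\<phi> z u)\<^sup>2)))"
proof -
  have L2: "sqrt (cube_mean A (\<lambda>z. (\<psi> z)\<^sup>2)) = L2_set \<psi> (Pow A) / sqrt (2 ^ card A)" for \<psi>
    by (simp add: cube_mean_def L2_set_def real_sqrt_divide)
  have sub: "L2_set (\<lambda>z. \<Sum>u\<in>S. \<phi> z u) (Pow A) \<le> (\<Sum>u\<in>S. L2_set (\<lambda>z. \<phi> z u) (Pow A))" if "finite S" for S
    using that
  proof (induction S rule: finite_induct)
    case (insert u S)
    then show ?case by (simp add: order_trans[OF L2_set_triangle_ineq])
  qed (simp add: L2_set_def)
  have "L2_set (\<lambda>z. cube_mean B (\<lambda>u. \<phi> z u)) (Pow A) = L2_set (\<lambda>z. \<Sum>u\<in>Pow B. \<phi> z u) (Pow A) / 2 ^ card B"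
    using L2_set_right_distrib[of "1 / 2 ^ card B" "\<lambda>z. \<Sum>u\<in>Pow B. \<phi> z u" "Pow A"]
    by (simp add: cube_mean_def mult.commute)
  also have "\<dots> \<le> (\<Sum>u\<in>Pow B. L2_set (\<lambda>z. \<phi> z u) (Pow A)) / 2 ^ card B"
    using assms by (intro divide_right_mono sub) auto
  finally have "L2_set (\<lambda>z. cube_mean B (\<lambda>u. \<phi> z u)) (Pow A) / sqrt (2 ^ card A)
      \<le> (\<Sum>u\<in>Pow B. L2_set (\<lambda>z. \<phi> z u) (Pow A)) / 2 ^ card B / sqrt (2 ^ card A)"
    by (rule divide_right_mono) simp
  then show ?thesis unfolding L2 by (simp add: cube_mean_def sum_divide_distrib mult.commute)
qed

text \<open>
  Reverse hypercontractivity of the noise operator: the norm of order \<open>1/m\<close> of the smoothed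
  function is at least the norm of order \<open>2/m\<close> of \<open>\<phi>\<close>. Both sides are raised to the power \<open>1/m\<close>.
\<close>

definition smoothing :: "real \<Rightarrow> real \<Rightarrow> 'a set \<Rightarrow> bool" where
  "smoothing m \<tau> I \<longleftrightarrow> (\<forall>\<phi>. (\<forall>x\<subseteq>I. 0 \<le> \<phi> x) \<longrightarrow>
     sqrt (cube_mean I (\<lambda>x. \<phi> x powr (2/m))) \<le> cube_mean I (\<lambda>x. noise \<tau> I \<phi> x powr (1/m)))"

text \<open>
  Noise acts on the block \<open>A\<close> only, while on the block \<open>B\<close> a lower bound \<open>h\<close> of the moment is
  known already. Minkowski's inequality exchanges the two blocks. This serves both for the
  tensorisation of the smoothing inequality (\<open>B\<close> a single coordinate) and for local variances
  (\<open>B\<close> the block of resampled coordinates).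
\<close>

lemma smoothing_mixed:
  assumes fin: "finite A" "finite B" and sm: "smoothing m \<tau> A"
    and nn: "\<And>z u. z \<subseteq> A \<Longrightarrow> u \<subseteq> B \<Longrightarrow> 0 \<le> g z u" and h0: "\<And>z. z \<subseteq> A \<Longrightarrow> 0 \<le> h z"
    and h: "\<And>z. z \<subseteq> A \<Longrightarrow> h z \<le> cube_mean B (\<lambda>u. g z u powr (1/m))"
  shows "sqrt (cube_mean A (\<lambda>z. (h z)\<^sup>2))
    \<le> cube_mean A (\<lambda>x. cube_mean B (\<lambda>u. noise \<tau> A (\<lambda>z. g z u) x powr (1/m)))"
proof -
  have "cube_mean A (\<lambda>z. (h z)\<^sup>2) \<le> cube_mean A (\<lambda>z. (cube_mean B (\<lambda>u. g z u powr (1/m)))\<^sup>2)"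
    using h h0 by (intro cube_mean_mono power_mono)
  then have "sqrt (cube_mean A (\<lambda>z. (h z)\<^sup>2)) \<le> sqrt (cube_mean A (\<lambda>z. (cube_mean B (\<lambda>u. g z u powr (1/m)))\<^sup>2))"
    by simp
  also have "\<dots> \<le> cube_mean B (\<lambda>u. sqrt (cube_mean A (\<lambda>z. (g z u powr (1/m))\<^sup>2)))"
    by (rule cube_mean_minkowski[OF fin(2)])
  also have "\<dots> = cube_mean B (\<lambda>u. sqrt (cube_mean A (\<lambda>z. g z u powr (2/m))))"
    by (simp add: power2_eq_square powr_add[symmetric])
  also have "\<dots> \<le> cube_mean B (\<lambda>u. cube_mean A (\<lambda>x. noise \<tau> A (\<lambda>z. g z u) x powr (1/m)))"
    using sm nn unfolding smoothing_def by (intro cube_mean_mono) simp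
  also have "\<dots> = cube_mean A (\<lambda>x. cube_mean B (\<lambda>u. noise \<tau> A (\<lambda>z. g z u) x powr (1/m)))"
    by (rule cube_mean_swap)
  finally show ?thesis .
qed

lemma smoothing_noise:
  assumes I: "finite I" and m: "2 < m" and \<tau>: "0 \<le> \<tau>" "\<tau>\<^sup>2 = (m - 2) / (m - 1)"
  shows "smoothing m \<tau> I"
  using I
proof (induction I rule: finite_induct)
  case empty
  then show ?case using m by (auto simp: smoothing_def powr_half_sqrt[symmetric] powr_powr)
next
  case (insert i I)
  note \<tau>1 = smoothing_rate_less_1[OF m \<tau>]
  show ?case unfolding smoothing_def
  proof (intro allI impI)
    fix \<phi> :: "'a set \<Rightarrow> real" assume nn: "\<forall>x\<subseteq>insert i I. 0 \<le> \<phi> x"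
    define g where "g z u = noise \<tau> {i} (\<lambda>w. \<phi> (z \<union> w)) u" for z u
    define h where "h z = sqrt (cube_mean {i} (\<lambda>u. \<phi> (z \<union> u) powr (2/m)))" for z
    have dj: "I \<inter> {i} = {}" using insert.hyps by auto
    have "sqrt (cube_mean I (\<lambda>z. (h z)\<^sup>2))
        \<le> cube_mean I (\<lambda>x. cube_mean {i} (\<lambda>u. noise \<tau> I (\<lambda>z. g z u) x powr (1/m)))"
    proof (rule smoothing_mixed[OF insert.hyps(1) _ insert.IH])
      show "0 \<le> g z u" if "z \<subseteq> I" "u \<subseteq> {i}" for z u
        unfolding g_def
      proof (rule noise_nonneg)
        show "0 \<le> \<phi> (z \<union> w)" if "w \<subseteq> {i}" for w
          using nn \<open>z \<subseteq> I\<close> that by (blast intro: spec[OF nn, THEN mp])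
      qed (use \<tau>(1) \<tau>1 in auto)
      show "0 \<le> h z" if "z \<subseteq> I" for z
        unfolding h_def by (auto intro!: cube_mean_nonneg)
      show "h z \<le> cube_mean {i} (\<lambda>u. g z u powr (1/m))" if "z \<subseteq> I" for z
      proof -
        have "0 \<le> \<phi> z" "0 \<le> \<phi> (insert i z)"
          using that by (blast intro: spec[OF nn, THEN mp])+
        from two_point_smoothing[OF this m \<tau>] show ?thesis
          by (simp add: h_def g_def cube_mean_singleton noise_singleton)
      qed
    qed simp
    moreover have "cube_mean I (\<lambda>z. (h z)\<^sup>2) = cube_mean (I \<union> {i}) (\<lambda>x. \<phi> x powr (2/m))"
      unfolding cube_mean_Un[OF insert.hyps(1) finite.emptyI[THEN finite.insertI] dj]
      by (auto simp: h_def intro!: cube_mean_cong cube_mean_nonneg real_sqrt_pow2)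
    moreover have "cube_mean I (\<lambda>x. cube_mean {i} (\<lambda>u. noise \<tau> I (\<lambda>z. g z u) x powr (1/m)))
      = cube_mean (I \<union> {i}) (\<lambda>x. noise \<tau> (I \<union> {i}) \<phi> x powr (1/m))"
      unfolding cube_mean_Un[OF insert.hyps(1) finite.emptyI[THEN finite.insertI] dj] g_def
      using insert.hyps dj by (intro cube_mean_cong) (simp add: noise_Un del: Un_insert_right)
    ultimately show "sqrt (cube_mean (insert i I) (\<lambda>x. \<phi> x powr (2/m)))
      \<le> cube_mean (insert i I) (\<lambda>x. noise \<tau> (insert i I) \<phi> x powr (1/m))"
      by simp
  qed
qed

section \<open>Pivotal coordinates and local variance\<close>

definition flip :: "'a \<Rightarrow> 'a set \<Rightarrow> 'a set" where
  "flip i x = (if i \<in> x then x - {i} else insert i x)"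

definition pivotal :: "'a \<Rightarrow> ('a set \<Rightarrow> bool) \<Rightarrow> 'a set \<Rightarrow> bool" where
  "pivotal i f x \<longleftrightarrow> f (flip i x) \<noteq> f x"

text \<open>
  The mean of the conditional variance of \<open>f\<close> given the coordinates outside \<open>U\<close>.
\<close>

definition block_variance :: "'a set \<Rightarrow> 'a set \<Rightarrow> ('a set \<Rightarrow> bool) \<Rightarrow> real" where
  "block_variance I U f = cube_mean (I - U)
     (\<lambda>z. cube_mean U (\<lambda>u. of_bool (f (z \<union> u))) * (1 - cube_mean U (\<lambda>u. of_bool (f (z \<union> u)))))"

text \<open>
  The probability that \<open>i\<close> is pivotal for \<open>f\<close> at \<open>x\<close> and \<open>j\<close> for \<open>g\<close> at \<open>y\<close>, for uniformly distributed
  points \<open>x\<close>, \<open>y\<close> with correlation \<open>\<rho>\<close>.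
\<close>

definition joint_pivotality ::
    "real \<Rightarrow> 'a set \<Rightarrow> 'a \<Rightarrow> ('a set \<Rightarrow> bool) \<Rightarrow> 'a \<Rightarrow> ('a set \<Rightarrow> bool) \<Rightarrow> real" where
  "joint_pivotality \<rho> I i f j g
     = cube_mean I (\<lambda>x. of_bool (pivotal i f x) * noise \<rho> I (\<lambda>y. of_bool (pivotal j g y)) x)"

lemma block_variance_nonneg:
  assumes "finite U"
  shows "0 \<le> block_variance I U f"
  unfolding block_variance_def
  by (intro cube_mean_nonneg mult_nonneg_nonneg) (simp_all add: cube_mean_of_bool_bounds[OF assms])

text \<open>
  Treats the two values of the bit \<open>i\<close> of the starting point uniformly.
\<close>

lemma noise_insert_mixture:
  assumes "finite I" "i \<notin> I" "x \<subseteq> insert i I" and \<tau>: "\<bar>\<tau>\<bar> \<le> 1"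
  obtains \<alpha> where "0 \<le> \<alpha>" "\<alpha> \<le> 1"
    "\<And>\<phi>. noise \<tau> (insert i I) \<phi> x = \<alpha> * noise \<tau> I (\<lambda>y. \<phi> (insert i y)) (x - {i}) + (1 - \<alpha>) * noise \<tau> I \<phi> (x - {i})"
proof (cases "i \<in> x")
  case True
  then have x: "x = insert i (x - {i})" "x - {i} \<subseteq> I" using assms by auto
  show ?thesis
  proof (rule that[of "(1 + \<tau>) / 2"])
    show "noise \<tau> (insert i I) \<phi> x = (1 + \<tau>) / 2 * noise \<tau> I (\<lambda>y. \<phi> (insert i y)) (x - {i}) + (1 - (1 + \<tau>) / 2) * noise \<tau> I \<phi> (x - {i})" for \<phi>
      by (subst x(1), subst noise_insert(2)[OF assms(1,2) x(2)]) (simp add: field_simps)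
  qed (use \<tau> in auto)
next
  case False
  then have x: "x - {i} = x" "x \<subseteq> I" using assms by auto
  show ?thesis
  proof (rule that[of "(1 - \<tau>) / 2"])
    show "noise \<tau> (insert i I) \<phi> x = (1 - \<tau>) / 2 * noise \<tau> I (\<lambda>y. \<phi> (insert i y)) (x - {i}) + (1 - (1 - \<tau>) / 2) * noise \<tau> I \<phi> (x - {i})" for \<phi>
      unfolding x(1) noise_insert(1)[OF assms(1,2) x(2)] by (simp add: field_simps)
  qed (use \<tau> in auto)
qed

lemma noise_abs_le:
  assumes "\<bar>\<tau>\<bar> \<le> 1"
  shows "\<bar>noise \<tau> I \<phi> x\<bar> \<le> noise \<tau> I (\<lambda>y. \<bar>\<phi> y\<bar>) x"
  unfolding noise_def
  by (rule order_trans[OF sum_abs]) (simp add: abs_mult noise_kernel_nonneg[OF assms])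

text \<open>
  Efron--Stein inequality for the product measure that noise around \<open>u\<close> defines. The first
  summand on the right vanishes for Boolean \<open>f\<close>; it makes the induction work for all functions
  with values in the unit interval.
\<close>

lemma noise_poincare:
  assumes "finite U" "u \<subseteq> U" "\<bar>\<tau>\<bar> \<le> 1" "\<And>w. w \<subseteq> U \<Longrightarrow> 0 \<le> f w" "\<And>w. w \<subseteq> U \<Longrightarrow> f w \<le> 1"
  shows "noise \<tau> U f u * (1 - noise \<tau> U f u)
    \<le> noise \<tau> U (\<lambda>w. f w * (1 - f w)) u + (\<Sum>i\<in>U. noise \<tau> U (\<lambda>w. \<bar>f (flip i w) - f w\<bar>) u)"
  using assms(1,2,4,5)
proof (induction U arbitrary: u f rule: finite_induct)
  case empty
  then show ?case by simp
next
  case (insert i U)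
  define x where "x = u - {i}"
  have x: "x \<subseteq> U" using insert.prems(1) by (auto simp: x_def)
  let ?f = "\<lambda>w. f (insert i w)"
  let ?D = "\<lambda>f j. noise \<tau> U (\<lambda>w. \<bar>f (flip j w) - f w\<bar>) x"
  let ?N = "\<lambda>f. noise \<tau> U (\<lambda>w. f w * (1 - f w)) x"
  let ?d = "noise \<tau> U (\<lambda>w. \<bar>?f w - f w\<bar>) x"
  obtain \<alpha> where \<alpha>: "0 \<le> \<alpha>" "\<alpha> \<le> 1"
    and mix: "\<And>\<phi>. noise \<tau> (insert i U) \<phi> u = \<alpha> * noise \<tau> U (\<lambda>y. \<phi> (insert i y)) x + (1 - \<alpha>) * noise \<tau> U \<phi> x"
    using noise_insert_mixture[OF insert.hyps insert.prems(1) assms(3)] x_def by blast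
  define a where "a = noise \<tau> U f x"
  define b where "b = noise \<tau> U ?f x"
  have f01: "0 \<le> f w" "f w \<le> 1" "0 \<le> ?f w" "?f w \<le> 1" if "w \<subseteq> U" for w
    using that by (auto intro!: insert.prems)
  have "0 \<le> a" "0 \<le> b" unfolding a_def b_def using f01 assms(3) by (auto intro!: noise_nonneg)
  moreover have "a \<le> 1" "b \<le> 1"
    using noise_mono[OF assms(3), of U f "\<lambda>_. 1" x] noise_mono[OF assms(3), of U ?f "\<lambda>_. 1" x] f01
    by (simp_all add: a_def b_def noise_const[OF insert.hyps(1) x])
  ultimately have ab: "\<bar>b - a\<bar> \<le> 1" by linarith
  have IH: "a * (1 - a) \<le> ?N f + (\<Sum>j\<in>U. ?D f j)"
    "b * (1 - b) \<le> ?N ?f + (\<Sum>j\<in>U. ?D ?f j)"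
    unfolding a_def b_def by (rule insert.IH[OF x], (simp add: f01)+)+
  have i: "noise \<tau> (insert i U) (\<lambda>w. \<bar>f (flip i w) - f w\<bar>) u = ?d"
  proof -
    have "noise \<tau> U (\<lambda>w. \<bar>f (flip i (insert i w)) - f (insert i w)\<bar>) x = ?d"
    proof (intro noise_cong)
      fix w assume "w \<subseteq> U"
      then have "w - {i} = w" using insert.hyps by auto
      then show "\<bar>f (flip i (insert i w)) - f (insert i w)\<bar> = \<bar>?f w - f w\<bar>"
        by (simp add: flip_def abs_minus_commute)
    qed
    moreover have "noise \<tau> U (\<lambda>w. \<bar>f (flip i w) - f w\<bar>) x = ?d"
      using insert.hyps by (intro noise_cong) (auto simp: flip_def)
    ultimately show ?thesis by (simp add: mix algebra_simps)
  qed
  have j: "(\<Sum>j\<in>U. noise \<tau> (insert i U) (\<lambda>w. \<bar>f (flip j w) - f w\<bar>) u)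
    = \<alpha> * (\<Sum>j\<in>U. ?D ?f j) + (1 - \<alpha>) * (\<Sum>j\<in>U. ?D f j)"
    unfolding mix sum.distrib sum_distrib_left
  proof (intro arg_cong2[where f = "(+)"] sum.cong refl)
    fix j assume "j \<in> U"
    then have "flip j (insert i w) = insert i (flip j w)" for w
      using insert.hyps by (auto simp: flip_def)
    then show "\<alpha> * noise \<tau> U (\<lambda>w. \<bar>f (flip j (insert i w)) - f (insert i w)\<bar>) x = \<alpha> * ?D ?f j"
      by simp
  qed
  have "\<bar>b - a\<bar> \<le> ?d"
    unfolding a_def b_def noise_diff[symmetric] by (rule noise_abs_le[OF assms(3)])
  moreover have "\<alpha> * (1 - \<alpha>) * (b - a)\<^sup>2 \<le> 1 * \<bar>b - a\<bar>"
  proof (rule mult_mono)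
    show "\<alpha> * (1 - \<alpha>) \<le> 1" using \<alpha> mult_mono[of \<alpha> 1 "1 - \<alpha>" 1] by simp
    show "(b - a)\<^sup>2 \<le> \<bar>b - a\<bar>"
      using ab mult_left_mono[of "\<bar>b - a\<bar>" 1 "\<bar>b - a\<bar>"] by (simp add: power2_eq_square flip: abs_mult)
  qed auto
  ultimately have sq: "\<alpha> * (1 - \<alpha>) * (b - a)\<^sup>2 \<le> ?d"
    unfolding mult_1 by (rule order_trans[rotated])
  have "noise \<tau> (insert i U) f u * (1 - noise \<tau> (insert i U) f u)
      = \<alpha> * (b * (1 - b)) + (1 - \<alpha>) * (a * (1 - a)) + \<alpha> * (1 - \<alpha>) * (b - a)\<^sup>2"
    unfolding mix a_def[symmetric] b_def[symmetric] by (simp add: power2_eq_square algebra_simps)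
  also have "\<dots> \<le> \<alpha> * (?N ?f + (\<Sum>j\<in>U. ?D ?f j))
     + (1 - \<alpha>) * (?N f + (\<Sum>j\<in>U. ?D f j))
     + ?d"
    using \<alpha> by (intro add_mono mult_left_mono IH sq) auto
  also have "\<dots> = noise \<tau> (insert i U) (\<lambda>w. f w * (1 - f w)) u + (\<Sum>j\<in>insert i U. noise \<tau> (insert i U) (\<lambda>w. \<bar>f (flip j w) - f w\<bar>) u)"
    unfolding sum.insert[OF insert.hyps] i j mix[of "\<lambda>w. f w * (1 - f w)"] by (simp add: algebra_simps)
  finally show ?case .
qed

text \<open>
  With \<open>S = \<surd>t + \<surd>(1 - t)\<close> the product \<open>t (1 - t)\<close> is \<open>(S\<^sup>2 - 1)\<^sup>2 / 4\<close>, so the claim amounts to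
  \<open>(S + 1)\<^sup>2 \<le> 6\<close>, and \<open>S\<^sup>2 \<le> 2\<close>.
\<close>

lemma sqrt_sum_bound:
  fixes t :: real
  assumes "0 \<le> t" "t \<le> 1"
  shows "sqrt (2/3 * (t * (1 - t))) \<le> sqrt t + sqrt (1 - t) - 1"
proof -
  define S where "S = sqrt t + sqrt (1 - t)"
  define P where "P = sqrt (t * (1 - t))"
  have P: "0 \<le> P" "P\<^sup>2 = t * (1 - t)" using assms by (auto simp: P_def)
  have S2: "S\<^sup>2 = 1 + 2 * P" using assms by (simp add: S_def P_def power2_sum real_sqrt_mult)
  have S0: "0 \<le> S" using assms by (simp add: S_def)
  have S1: "1 \<le> S" using P S2 S0 by (intro power2_le_imp_le[of 1 S]) auto
  have "P\<^sup>2 \<le> (1/2)\<^sup>2"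
    using zero_le_power2[of "t - 1/2"] unfolding P by (simp add: power2_eq_square algebra_simps)
  then have "P \<le> 1/2" by (rule power2_le_imp_le) simp
  then have "S\<^sup>2 \<le> (3/2)\<^sup>2" unfolding S2 by (simp add: power2_eq_square)
  then have S3: "S \<le> 3/2" by (rule power2_le_imp_le) simp
  have "(S + 1)\<^sup>2 \<le> 6" using S2 \<open>P \<le> 1/2\<close> S3 by (simp add: power2_sum)
  then have "(S - 1)\<^sup>2 * (S + 1)\<^sup>2 \<le> (S - 1)\<^sup>2 * 6" by (intro mult_left_mono) auto
  moreover have "(S - 1)\<^sup>2 * (S + 1)\<^sup>2 = 4 * (t * (1 - t))"
  proof -
    have "(S - 1)\<^sup>2 * (S + 1)\<^sup>2 = (S\<^sup>2 - 1)\<^sup>2" by (simp add: power2_eq_square algebra_simps)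
    also have "\<dots> = 4 * P\<^sup>2" by (simp add: S2 power_mult_distrib)
    finally show ?thesis by (simp add: P)
  qed
  ultimately have "2/3 * (t * (1 - t)) \<le> (S - 1)\<^sup>2" by simp
  then have "sqrt (2/3 * (t * (1 - t))) \<le> S - 1"
    using S1 by (intro real_le_lsqrt) auto
  then show ?thesis by (simp add: S_def)
qed

text \<open>
  Let \<open>a\<close> be the smoothed function and \<open>q = 1/m\<close>. Since \<open>(1 - a\<^sup>q) (1 - (1-a)\<^sup>q) \<ge> 0\<close>, the mean of
  \<open>(a (1-a))\<^sup>q\<close> is at least the sum of the means of \<open>a\<^sup>q\<close> and \<open>(1-a)\<^sup>q\<close>, minus \<open>1\<close>. As \<open>f\<close> and its
  complement are indicators, the smoothing inequality bounds these means by \<open>\<surd>\<theta>\<close> and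
  \<open>\<surd>(1 - \<theta>)\<close>.
\<close>

lemma smoothing_product_ge:
  fixes f :: "'a set \<Rightarrow> bool"
  assumes U: "finite U" and m: "2 < m" and \<tau>: "0 \<le> \<tau>" "\<tau>\<^sup>2 = (m - 2) / (m - 1)"
  defines "\<theta> \<equiv> cube_mean U (\<lambda>u. of_bool (f u))" and "a \<equiv> noise \<tau> U (\<lambda>u. of_bool (f u))"
  shows "sqrt (2/3 * (\<theta> * (1 - \<theta>))) \<le> cube_mean U (\<lambda>u. (a u * (1 - a u)) powr (1/m))"
proof -
  have \<tau>1: "\<bar>\<tau>\<bar> \<le> 1" using smoothing_rate_less_1[OF m \<tau>] \<tau>(1) by simp
  have \<theta>: "0 \<le> \<theta>" "\<theta> \<le> 1" unfolding \<theta>_def by (rule cube_mean_of_bool_bounds[OF U])+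
  have na: "noise \<tau> U (\<lambda>u. of_bool (\<not> f u)) x = 1 - a x" if "x \<subseteq> U" for x
    using noise_diff[of \<tau> U "\<lambda>_. 1" "\<lambda>u. of_bool (f u)" x] noise_const[OF U that]
    by (simp add: a_def of_bool_not_iff)
  have a: "0 \<le> a x" "0 \<le> 1 - a x" if "x \<subseteq> U" for x
    using noise_of_bool_bounds[OF U that \<tau>1, of f] by (simp_all add: a_def)
  have sm: "sqrt (cube_mean U (\<lambda>x. \<phi> x powr (2/m))) \<le> cube_mean U (\<lambda>x. noise \<tau> U \<phi> x powr (1/m))"
    if "\<And>x. 0 \<le> \<phi> x" for \<phi> :: "'a set \<Rightarrow> real"
    using smoothing_noise[OF U m \<tau>] that by (simp add: smoothing_def)
  have 1: "sqrt \<theta> \<le> cube_mean U (\<lambda>x. a x powr (1/m))"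
    using sm[of "\<lambda>u. of_bool (f u)"] m by (simp add: \<theta>_def a_def of_bool_def if_distrib[of "\<lambda>t. t powr _"] cong: if_cong)
  have "sqrt (1 - \<theta>) = sqrt (cube_mean U (\<lambda>u. of_bool (\<not> f u)))"
    using cube_mean_diff[of U "\<lambda>_. 1" "\<lambda>u. of_bool (f u)"] cube_mean_const[OF U, of 1]
    by (simp add: \<theta>_def of_bool_not_iff)
  also have "\<dots> \<le> cube_mean U (\<lambda>x. noise \<tau> U (\<lambda>u. of_bool (\<not> f u)) x powr (1/m))"
    using sm[of "\<lambda>u. of_bool (\<not> f u)"] m by (simp add: of_bool_def if_distrib[of "\<lambda>t. t powr _"] cong: if_cong)
  also have "\<dots> = cube_mean U (\<lambda>x. (1 - a x) powr (1/m))"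
    by (rule cube_mean_cong) (simp add: na)
  finally have 2: "sqrt (1 - \<theta>) \<le> cube_mean U (\<lambda>x. (1 - a x) powr (1/m))" .
  have "sqrt (2/3 * (\<theta> * (1 - \<theta>))) \<le> sqrt \<theta> + sqrt (1 - \<theta>) - 1" by (rule sqrt_sum_bound[OF \<theta>])
  also have "\<dots> \<le> cube_mean U (\<lambda>x. a x powr (1/m)) + cube_mean U (\<lambda>x. (1 - a x) powr (1/m)) - cube_mean U (\<lambda>_. 1)"
    using 1 2 cube_mean_const[OF U, of 1] by linarith
  also have "\<dots> = cube_mean U (\<lambda>x. a x powr (1/m) + (1 - a x) powr (1/m) - 1)"
    by (simp only: cube_mean_add cube_mean_diff)
  also have "\<dots> \<le> cube_mean U (\<lambda>u. (a u * (1 - a u)) powr (1/m))"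
  proof (rule cube_mean_mono)
    fix x assume x: "x \<subseteq> U"
    let ?p = "a x powr (1/m)" and ?r = "(1 - a x) powr (1/m)"
    have "?p \<le> 1" "?r \<le> 1" using a[OF x] m by (auto intro!: powr_le1)
    then have "0 \<le> (1 - ?p) * (1 - ?r)" by (intro mult_nonneg_nonneg) auto
    then have "?p + ?r - 1 \<le> ?p * ?r" by (simp add: algebra_simps)
    then show "?p + ?r - 1 \<le> (a x * (1 - a x)) powr (1/m)" by (simp add: powr_mult)
  qed
  finally show ?thesis .
qed

text \<open>
  The local counterpart of \<open>block_variance\<close>: the uniform measure is replaced by the noise
  distribution around \<open>x\<close>.
\<close>

definition smoothed_variance ::
    "real \<Rightarrow> 'a set \<Rightarrow> 'a set \<Rightarrow> ('a set \<Rightarrow> bool) \<Rightarrow> 'a set \<Rightarrow> real" where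
  "smoothed_variance \<tau> I U f x = noise \<tau> (I - U)
     (\<lambda>z. noise \<tau> U (\<lambda>w. of_bool (f (z \<union> w))) (x \<inter> U)
        * (1 - noise \<tau> U (\<lambda>w. of_bool (f (z \<union> w))) (x \<inter> U))) (x - U)"

lemma smoothed_variance_nonneg:
  assumes "finite U" "\<bar>\<tau>\<bar> \<le> 1"
  shows "0 \<le> smoothed_variance \<tau> I U f x"
  unfolding smoothed_variance_def
  using noise_of_bool_bounds[OF assms(1) _ assms(2), of "x \<inter> U"]
  by (intro noise_nonneg[OF assms(2)] mult_nonneg_nonneg) auto

lemma smoothed_variance_le_influence:
  assumes I: "finite I" "U \<subseteq> I" and x: "x \<subseteq> I" and \<tau>: "\<bar>\<tau>\<bar> \<le> 1"
  shows "smoothed_variance \<tau> I U f x \<le> (\<Sum>i\<in>U. noise \<tau> I (\<lambda>y. of_bool (pivotal i f y)) x)"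
proof -
  have U: "finite U" using I finite_subset by auto
  have "smoothed_variance \<tau> I U f x
    \<le> noise \<tau> (I - U) (\<lambda>z. \<Sum>i\<in>U. noise \<tau> U (\<lambda>w. of_bool (pivotal i f (z \<union> w))) (x \<inter> U)) (x - U)"
    unfolding smoothed_variance_def
  proof (rule noise_mono[OF \<tau>])
    fix z assume z: "z \<subseteq> I - U"
    let ?f = "\<lambda>w. of_bool (f (z \<union> w)) :: real"
    have "noise \<tau> U ?f (x \<inter> U) * (1 - noise \<tau> U ?f (x \<inter> U))
      \<le> noise \<tau> U (\<lambda>w. ?f w * (1 - ?f w)) (x \<inter> U) + (\<Sum>i\<in>U. noise \<tau> U (\<lambda>w. \<bar>?f (flip i w) - ?f w\<bar>) (x \<inter> U))"
      using \<tau> by (intro noise_poincare[OF U]) auto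
    also have "(\<lambda>w. ?f w * (1 - ?f w)) = (\<lambda>_. 0)" by auto
    also have "noise \<tau> U (\<lambda>_. 0) (x \<inter> U) = 0" by (simp add: noise_def)
    also have "(\<Sum>i\<in>U. noise \<tau> U (\<lambda>w. \<bar>?f (flip i w) - ?f w\<bar>) (x \<inter> U))
      = (\<Sum>i\<in>U. noise \<tau> U (\<lambda>w. of_bool (pivotal i f (z \<union> w))) (x \<inter> U))"
    proof (intro sum.cong refl noise_cong)
      fix i w assume "i \<in> U" "w \<subseteq> U"
      then have "flip i (z \<union> w) = z \<union> flip i w" using z by (auto simp: flip_def)
      then show "\<bar>?f (flip i w) - ?f w\<bar> = of_bool (pivotal i f (z \<union> w))"
        by (simp add: pivotal_def)
    qed
    finally show "noise \<tau> U ?f (x \<inter> U) * (1 - noise \<tau> U ?f (x \<inter> U))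
      \<le> (\<Sum>i\<in>U. noise \<tau> U (\<lambda>w. of_bool (pivotal i f (z \<union> w))) (x \<inter> U))" by simp
  qed
  also have "\<dots> = (\<Sum>i\<in>U. noise \<tau> ((I - U) \<union> U) (\<lambda>y. of_bool (pivotal i f y)) ((x - U) \<union> (x \<inter> U)))"
    unfolding noise_sum using x I U by (intro sum.cong refl noise_Un[symmetric]) auto
  also have "(I - U) \<union> U = I" using I by auto
  also have "(x - U) \<union> (x \<inter> U) = x" by auto
  finally show ?thesis .
qed

text \<open>
  The coordinates outside \<open>U\<close> are smoothed as well. Without this the moment of order \<open>1/m\<close> would
  be bounded by the mean of the square roots of the conditional variances, not by the square
  root of their mean, and a function that is constant for most values of the other coordinates
  would be out of reach.
\<close>

lemma smoothed_variance_ge: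
  assumes I: "finite I" "U \<subseteq> I" and m: "2 < m" and \<tau>: "0 \<le> \<tau>" "\<tau>\<^sup>2 = (m - 2) / (m - 1)"
  shows "sqrt (2/3 * block_variance I U f) \<le> cube_mean I (\<lambda>x. smoothed_variance \<tau> I U f x powr (1/m))"
proof -
  have \<tau>1: "\<bar>\<tau>\<bar> \<le> 1" using smoothing_rate_less_1[OF m \<tau>] \<tau>(1) by simp
  have U: "finite U" and IU: "finite (I - U)" using I finite_subset by auto
  define a where "a z = noise \<tau> U (\<lambda>w. of_bool (f (z \<union> w)))" for z
  define \<theta> where "\<theta> z = cube_mean U (\<lambda>u. of_bool (f (z \<union> u)))" for z
  have \<theta>: "0 \<le> \<theta> z" "\<theta> z \<le> 1" for z
    unfolding \<theta>_def by (rule cube_mean_of_bool_bounds[OF U])+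
  have "sqrt (cube_mean (I - U) (\<lambda>z. (sqrt (2/3 * (\<theta> z * (1 - \<theta> z))))\<^sup>2))
    \<le> cube_mean (I - U) (\<lambda>x. cube_mean U (\<lambda>u. noise \<tau> (I - U) (\<lambda>z. a z u * (1 - a z u)) x powr (1/m)))"
  proof (rule smoothing_mixed[OF IU U smoothing_noise[OF IU m \<tau>]])
    show "0 \<le> a z u * (1 - a z u)" if "u \<subseteq> U" for z u
      unfolding a_def using noise_of_bool_bounds[OF U that \<tau>1] by (intro mult_nonneg_nonneg) auto
    show "0 \<le> sqrt (2/3 * (\<theta> z * (1 - \<theta> z)))" for z using \<theta>[of z] by simp
    show "sqrt (2/3 * (\<theta> z * (1 - \<theta> z))) \<le> cube_mean U (\<lambda>u. (a z u * (1 - a z u)) powr (1/m))" for z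
      unfolding a_def \<theta>_def by (rule smoothing_product_ge[OF U m \<tau>])
  qed
  also have "cube_mean (I - U) (\<lambda>z. (sqrt (2/3 * (\<theta> z * (1 - \<theta> z))))\<^sup>2) = 2/3 * block_variance I U f"
    unfolding block_variance_def \<theta>_def[symmetric] cube_mean_cmult[symmetric]
    using \<theta> by (intro cube_mean_cong real_sqrt_pow2) simp
  also have "cube_mean (I - U) (\<lambda>x. cube_mean U (\<lambda>u. noise \<tau> (I - U) (\<lambda>z. a z u * (1 - a z u)) x powr (1/m)))
    = cube_mean (I - U) (\<lambda>x. cube_mean U (\<lambda>u. smoothed_variance \<tau> I U f (x \<union> u) powr (1/m)))"
  proof (intro cube_mean_cong)
    fix x u assume "x \<subseteq> I - U" "u \<subseteq> U"
    then have "(x \<union> u) \<inter> U = u" "(x \<union> u) - U = x" by auto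
    then show "noise \<tau> (I - U) (\<lambda>z. a z u * (1 - a z u)) x powr (1/m) = smoothed_variance \<tau> I U f (x \<union> u) powr (1/m)"
      by (simp add: smoothed_variance_def a_def)
  qed
  also have "\<dots> = cube_mean ((I - U) \<union> U) (\<lambda>x. smoothed_variance \<tau> I U f x powr (1/m))"
    using IU U by (intro cube_mean_Un[symmetric]) auto
  also have "(I - U) \<union> U = I" using I by auto
  finally show ?thesis .
qed

text \<open>
  The expected number of pairs \<open>i \<in> U\<close>, \<open>j \<in> V\<close> such that \<open>i\<close> is pivotal for \<open>f\<close> at \<open>x\<close> and \<open>j\<close> for \<open>g\<close>
  at \<open>y\<close>, for \<open>\<rho>\<close>-correlated \<open>x\<close>, \<open>y\<close>. The noise rate is chosen such that the remaining
  correlation \<open>\<rho>' = \<rho> / \<tau>\<^sup>2\<close> is still admissible in \<open>reverse_holder_noise\<close> with exponent \<open>1/m\<close>: the loss of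
  exponent from \<open>m/2\<close> to \<open>m\<close> per function is exactly recovered by the square roots in
  \<open>smoothed_variance_ge\<close>.
\<close>

theorem joint_pivotality_lower_bound:
  fixes f g :: "'a set \<Rightarrow> bool" and m \<rho> :: real
  assumes I: "finite I" "U \<subseteq> I" "V \<subseteq> I" and m: "2 < m" and \<rho>: "\<bar>\<rho>\<bar> \<le> 1 - 2/m"
  shows "(2/3 * sqrt (block_variance I U f * block_variance I V g)) powr m
    \<le> (\<Sum>i\<in>U. \<Sum>j\<in>V. joint_pivotality \<rho> I i f j g)"
proof -
  define \<tau> where "\<tau> = sqrt ((m - 2) / (m - 1))"
  have \<tau>: "0 \<le> \<tau>" "\<tau>\<^sup>2 = (m - 2) / (m - 1)" using m by (auto simp: \<tau>_def)
  have \<tau>1: "\<bar>\<tau>\<bar> \<le> 1" using smoothing_rate_less_1[OF m \<tau>] \<tau>(1) by simp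
  have \<tau>0: "0 < \<tau>\<^sup>2" using m by (simp add: \<tau>)
  define \<rho>' where "\<rho>' = \<rho> / \<tau>\<^sup>2"
  have \<rho>'\<rho>: "\<tau> * (\<rho>' * \<tau>) = \<rho>" using \<tau>0 by (auto simp: \<rho>'_def power2_eq_square)
  have \<rho>': "\<bar>\<rho>'\<bar> \<le> 1 - 1/m"
  proof -
    have "\<bar>\<rho>'\<bar> = \<bar>\<rho>\<bar> / \<tau>\<^sup>2" by (simp add: \<rho>'_def)
    also have "\<dots> \<le> (1 - 2/m) / \<tau>\<^sup>2" using \<rho> by (intro divide_right_mono) auto
    also have "\<dots> = 1 - 1/m" using m by (simp add: \<tau> field_simps)
    finally show ?thesis .
  qed
  then have \<rho>'1: "\<bar>\<rho>'\<bar> \<le> 1" using m divide_nonneg_nonneg[of 1 m] by linarith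
  define v w where "v = smoothed_variance \<tau> I U f" and "w = smoothed_variance \<tau> I V g"
  have fin: "finite U" "finite V" using I finite_subset by auto
  have vw0: "0 \<le> v x" "0 \<le> w x" for x
    unfolding v_def w_def using fin \<tau>1 by (auto intro!: smoothed_variance_nonneg)
  define S T where "S x = (\<Sum>i\<in>U. noise \<tau> I (\<lambda>y. of_bool (pivotal i f y)) x)"
    and "T x = (\<Sum>j\<in>V. noise \<tau> I (\<lambda>y. of_bool (pivotal j g y)) x)" for x
  have vS: "v x \<le> S x" and wT: "w x \<le> T x" if "x \<subseteq> I" for x
    unfolding v_def w_def S_def T_def using I that \<tau>1 by (auto intro!: smoothed_variance_le_influence)
  have bv: "0 \<le> block_variance I U f" "0 \<le> block_variance I V g"
    using fin by (auto intro: block_variance_nonneg)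
  have "(2/3 * sqrt (block_variance I U f * block_variance I V g)) powr m
    = sqrt (2/3 * block_variance I U f) powr m * sqrt (2/3 * block_variance I V g) powr m"
  proof -
    have "sqrt (2/3 * A) * sqrt (2/3 * B) = sqrt ((2/3)\<^sup>2) * sqrt (A * B)" for A B :: real
      unfolding real_sqrt_mult[symmetric] by (rule arg_cong[where f = sqrt]) (simp add: power2_eq_square)
    then have "sqrt (2/3 * A) * sqrt (2/3 * B) = 2/3 * sqrt (A * B)" for A B :: real by simp
    then show ?thesis by (simp only: powr_mult[symmetric])
  qed
  also have "\<dots> \<le> cube_mean I (\<lambda>x. v x powr (1/m)) powr m * cube_mean I (\<lambda>x. w x powr (1/m)) powr m"
    unfolding v_def w_def using I m \<tau> bv
    by (intro mult_mono powr_mono2 smoothed_variance_ge) auto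
  also have "\<dots> \<le> cube_mean I (\<lambda>x. v x * noise \<rho>' I w x)"
    using m vw0 by (intro reverse_holder_noise I \<rho>') auto
  also have "\<dots> \<le> cube_mean I (\<lambda>x. S x * noise \<rho>' I T x)"
  proof (intro cube_mean_mono mult_mono)
    show "noise \<rho>' I w x \<le> noise \<rho>' I T x" for x by (rule noise_mono[OF \<rho>'1 wT])
    show "0 \<le> noise \<rho>' I w x" for x by (rule noise_nonneg[OF \<rho>'1 vw0(2)])
    show "0 \<le> S x" if "x \<subseteq> I" for x using vS[OF that] vw0(1)[of x] by linarith
  qed (rule vS)
  also have "\<dots> = (\<Sum>i\<in>U. \<Sum>j\<in>V. cube_mean I (\<lambda>x. noise \<tau> I (\<lambda>y. of_bool (pivotal i f y)) x
      * noise \<rho>' I (noise \<tau> I (\<lambda>y. of_bool (pivotal j g y))) x))"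
    unfolding S_def T_def noise_sum sum_product cube_mean_sum by simp
  also have "\<dots> = (\<Sum>i\<in>U. \<Sum>j\<in>V. joint_pivotality \<rho> I i f j g)"
  proof (intro sum.cong refl)
    fix i j
    let ?F = "\<lambda>y. of_bool (pivotal i f y) :: real" and ?G = "\<lambda>y. of_bool (pivotal j g y) :: real"
    have "noise \<tau> I (noise \<rho>' I (noise \<tau> I ?G)) x = noise \<rho> I ?G x" if x: "x \<subseteq> I" for x
    proof -
      have "noise \<tau> I (noise \<rho>' I (noise \<tau> I ?G)) x = noise \<tau> I (noise (\<rho>' * \<tau>) I ?G) x"
        by (rule noise_cong) (rule noise_noise[OF I(1)])
      also have "\<dots> = noise \<rho> I ?G x"
        using noise_noise[OF I(1) x, of \<tau> "\<rho>' * \<tau>" ?G] unfolding \<rho>'\<rho> .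
      finally show ?thesis .
    qed
    then show "cube_mean I (\<lambda>x. noise \<tau> I ?F x * noise \<rho>' I (noise \<tau> I ?G) x)
      = joint_pivotality \<rho> I i f j g"
      unfolding joint_pivotality_def cube_mean_noise_sym[symmetric] by (intro cube_mean_cong) simp
  qed
  finally show ?thesis .
qed

section \<open>Splitting variance between blocks of voters\<close>

lemma block_variance_eq:
  assumes "finite I" "U \<subseteq> I"
  shows "block_variance I U f = cube_mean I (\<lambda>x. of_bool (f x))
    - cube_mean (I - U) (\<lambda>z. (cube_mean U (\<lambda>u. of_bool (f (z \<union> u))))\<^sup>2)"
proof -
  have "cube_mean ((I - U) \<union> U) (\<lambda>x. of_bool (f x)) = cube_mean (I - U) (\<lambda>z. cube_mean U (\<lambda>u. of_bool (f (z \<union> u))))"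
    by (rule cube_mean_Un) (use assms finite_subset in auto)
  moreover have "(I - U) \<union> U = I" using assms by auto
  ultimately show ?thesis
    unfolding block_variance_def by (simp add: cube_mean_diff[symmetric] right_diff_distrib power2_eq_square)
qed

lemma block_variance_empty:
  assumes "finite I"
  shows "block_variance I {} f = 0"
proof -
  have "(\<lambda>z. of_bool (f z) * (1 - of_bool (f z))) = (\<lambda>_. 0 :: real)" by auto
  then show ?thesis by (simp add: block_variance_def cube_mean_const[OF assms])
qed

text \<open>
  Resampling more coordinates means averaging first, then squaring: Jensen's inequality.
\<close>

lemma block_variance_mono:
  assumes I: "finite I" "U \<subseteq> W" "W \<subseteq> I"
  shows "block_variance I U f \<le> block_variance I W f"
proof -
  have "finite W" using I(1,3) by (rule rev_finite_subset)
  then have fin: "finite (W - U)" "finite U" "finite (I - W)" using I rev_finite_subset by auto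
  have eq: "I - U = (I - W) \<union> (W - U)" "(W - U) \<union> U = W" using I by auto
  have "cube_mean (I - W) (\<lambda>z. (cube_mean W (\<lambda>u. of_bool (f (z \<union> u))))\<^sup>2)
    = cube_mean (I - W) (\<lambda>z. (cube_mean (W - U) (\<lambda>y. cube_mean U (\<lambda>u. of_bool (f (z \<union> (y \<union> u))))))\<^sup>2)"
    using cube_mean_Un[OF fin(1,2)] unfolding eq(2) by (simp add: Diff_disjoint Int_commute)
  also have "\<dots> \<le> cube_mean (I - W) (\<lambda>z. cube_mean (W - U) (\<lambda>y. (cube_mean U (\<lambda>u. of_bool (f (z \<union> (y \<union> u)))))\<^sup>2))"
    by (intro cube_mean_mono cube_mean_square_ge fin)
  also have "\<dots> = cube_mean (I - U) (\<lambda>z. (cube_mean U (\<lambda>u. of_bool (f (z \<union> u))))\<^sup>2)"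
    unfolding eq(1) using fin by (subst cube_mean_Un) (auto simp: Un_assoc)
  finally show ?thesis using I by (simp add: block_variance_eq)
qed

text \<open>
  With \<open>p\<close>, \<open>q\<close> the partial means and \<open>t\<close> the mean of a function \<open>\<phi>\<close> of two variables, the
  defect is the mean of \<open>(\<phi> - p - q + t)\<^sup>2\<close>.
\<close>

lemma block_variance_subadditive:
  assumes I: "finite I" "A \<subseteq> I" "B \<subseteq> I" "A \<inter> B = {}"
  shows "block_variance I (A \<union> B) f \<le> block_variance I A f + block_variance I B f"
proof -
  let ?C = "I - (A \<union> B)"
  let ?f = "\<lambda>z a b. of_bool (f (z \<union> a \<union> b)) :: real"
  have fin: "finite A" "finite B" "finite ?C" using I finite_subset by auto
  have eqA: "I - A = ?C \<union> B" and eqB: "I - B = ?C \<union> A" using I by auto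
  have e1: "cube_mean (I - A) (\<lambda>z. (cube_mean A (\<lambda>u. of_bool (f (z \<union> u))))\<^sup>2)
    = cube_mean ?C (\<lambda>z. cube_mean B (\<lambda>b. (cube_mean A (\<lambda>a. ?f z a b))\<^sup>2))"
    unfolding eqA using fin I by (subst cube_mean_Un) (auto simp: Un_ac)
  have e2: "cube_mean (I - B) (\<lambda>z. (cube_mean B (\<lambda>u. of_bool (f (z \<union> u))))\<^sup>2)
    = cube_mean ?C (\<lambda>z. cube_mean A (\<lambda>a. (cube_mean B (\<lambda>b. ?f z a b))\<^sup>2))"
    unfolding eqB using fin I by (subst cube_mean_Un) (auto simp: Un_ac)
  have e3: "cube_mean ?C (\<lambda>z. (cube_mean (A \<union> B) (\<lambda>u. of_bool (f (z \<union> u))))\<^sup>2)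
    = cube_mean ?C (\<lambda>z. (cube_mean A (\<lambda>a. cube_mean B (\<lambda>b. ?f z a b)))\<^sup>2)"
    using cube_mean_Un[OF fin(1,2) I(4)] by (simp add: Un_assoc)
  have e4: "cube_mean I (\<lambda>x. of_bool (f x)) = cube_mean ?C (\<lambda>z. cube_mean A (\<lambda>a. cube_mean B (\<lambda>b. ?f z a b)))"
  proof -
    have "I = ?C \<union> (A \<union> B)" using I by auto
    then have "cube_mean I (\<lambda>x. of_bool (f x)) = cube_mean (?C \<union> (A \<union> B)) (\<lambda>x. of_bool (f x))" by simp
    also have "\<dots> = cube_mean ?C (\<lambda>z. cube_mean (A \<union> B) (\<lambda>u. of_bool (f (z \<union> u))))"
      using fin by (intro cube_mean_Un) auto
    finally show ?thesis using cube_mean_Un[OF fin(1,2) I(4)] by (simp add: Un_assoc)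
  qed
  have key: "cube_mean B (\<lambda>b. (cube_mean A (\<lambda>a. \<phi> a b))\<^sup>2) + cube_mean A (\<lambda>a. (cube_mean B (\<lambda>b. \<phi> a b))\<^sup>2)
      \<le> cube_mean A (\<lambda>a. cube_mean B (\<lambda>b. (\<phi> a b)\<^sup>2)) + (cube_mean A (\<lambda>a. cube_mean B (\<lambda>b. \<phi> a b)))\<^sup>2"
    for \<phi> :: "'a set \<Rightarrow> 'a set \<Rightarrow> real"
  proof -
    define p where "p b = cube_mean A (\<lambda>a. \<phi> a b)" for b
    define q where "q a = cube_mean B (\<lambda>b. \<phi> a b)" for a
    define t where "t = cube_mean A q"
    have pt: "cube_mean B p = t" unfolding p_def t_def q_def by (rule cube_mean_swap)
    have const: "cube_mean A (\<lambda>_. c) = c" "cube_mean B (\<lambda>_. c) = c" for c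
      using fin by (auto intro: cube_mean_const)
    have "0 \<le> cube_mean A (\<lambda>a. cube_mean B (\<lambda>b. (\<phi> a b - p b - q a + t)\<^sup>2))"
      by (intro cube_mean_nonneg) auto
    also have "\<dots> = cube_mean A (\<lambda>a. cube_mean B (\<lambda>b. (\<phi> a b)\<^sup>2 + (p b)\<^sup>2 - 2 * (p b * \<phi> a b)
        + 2 * (q a - t) * p b - 2 * (q a - t) * \<phi> a b + (q a - t)\<^sup>2))"
      by (intro cube_mean_cong) (simp add: power2_eq_square algebra_simps)
    also have "\<dots> = cube_mean A (\<lambda>a. cube_mean B (\<lambda>b. (\<phi> a b)\<^sup>2)) + cube_mean B (\<lambda>b. (p b)\<^sup>2)
        - 2 * cube_mean A (\<lambda>a. cube_mean B (\<lambda>b. p b * \<phi> a b))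
        + cube_mean A (\<lambda>a. 2 * (q a - t) * t - 2 * (q a - t) * q a + (q a - t)\<^sup>2)"
      unfolding cube_mean_add cube_mean_diff cube_mean_cmult pt q_def[symmetric] const by simp
    also have "cube_mean A (\<lambda>a. cube_mean B (\<lambda>b. p b * \<phi> a b)) = cube_mean B (\<lambda>b. (p b)\<^sup>2)"
      by (subst cube_mean_swap) (simp add: cube_mean_cmult p_def[symmetric] power2_eq_square)
    also have "cube_mean A (\<lambda>a. 2 * (q a - t) * t - 2 * (q a - t) * q a + (q a - t)\<^sup>2)
        = cube_mean A (\<lambda>a. (2 * t) * q a - (q a)\<^sup>2 - t\<^sup>2)"
      by (intro cube_mean_cong) (simp add: power2_eq_square algebra_simps)
    also have "\<dots> = t\<^sup>2 - cube_mean A (\<lambda>a. (q a)\<^sup>2)"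
      unfolding cube_mean_diff cube_mean_cmult const t_def[symmetric] by (simp add: power2_eq_square)
    finally show ?thesis unfolding t_def p_def q_def by linarith
  qed
  have sq: "(of_bool P)\<^sup>2 = (of_bool P :: real)" for P by (cases P) auto
  have "cube_mean ?C (\<lambda>z. cube_mean B (\<lambda>b. (cube_mean A (\<lambda>a. ?f z a b))\<^sup>2) + cube_mean A (\<lambda>a. (cube_mean B (\<lambda>b. ?f z a b))\<^sup>2))
    \<le> cube_mean ?C (\<lambda>z. cube_mean A (\<lambda>a. cube_mean B (\<lambda>b. (?f z a b)\<^sup>2)) + (cube_mean A (\<lambda>a. cube_mean B (\<lambda>b. ?f z a b)))\<^sup>2)"
    by (intro cube_mean_mono key)
  then have "cube_mean ?C (\<lambda>z. cube_mean B (\<lambda>b. (cube_mean A (\<lambda>a. ?f z a b))\<^sup>2))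
      + cube_mean ?C (\<lambda>z. cube_mean A (\<lambda>a. (cube_mean B (\<lambda>b. ?f z a b))\<^sup>2))
    \<le> cube_mean I (\<lambda>x. of_bool (f x)) + cube_mean ?C (\<lambda>z. (cube_mean A (\<lambda>a. cube_mean B (\<lambda>b. ?f z a b)))\<^sup>2)"
    by (simp only: cube_mean_add e4 sq)
  then show ?thesis
    using I by (simp add: block_variance_eq e1 e2 e3)
qed

lemma block_variance_complement:
  assumes "finite I" "U \<subseteq> I" and g: "\<And>x. x \<subseteq> I \<Longrightarrow> g (I - x) \<longleftrightarrow> \<not> f x"
  shows "block_variance I U g = block_variance I U f"
proof -
  have U: "finite U" using assms finite_subset by auto
  let ?\<theta> = "\<lambda>f z. cube_mean U (\<lambda>u. of_bool (f (z \<union> u))) :: real"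
  have *: "?\<theta> g ((I - U) - z) = 1 - ?\<theta> f z" if z: "z \<subseteq> I - U" for z
  proof -
    have "?\<theta> g ((I - U) - z) = cube_mean U (\<lambda>u. of_bool (g (((I - U) - z) \<union> (U - u))))"
      by (rule cube_mean_complement[symmetric])
    also have "\<dots> = cube_mean U (\<lambda>u. 1 - of_bool (f (z \<union> u)))"
    proof (rule cube_mean_cong)
      fix u assume u: "u \<subseteq> U"
      have "((I - U) - z) \<union> (U - u) = I - (z \<union> u)" using z u assms(2) by auto
      moreover have "z \<union> u \<subseteq> I" using z u assms(2) by auto
      ultimately show "of_bool (g (((I - U) - z) \<union> (U - u))) = 1 - (of_bool (f (z \<union> u)) :: real)"
        using g[of "z \<union> u"] by simp
    qed
    also have "\<dots> = 1 - ?\<theta> f z" by (simp add: cube_mean_diff cube_mean_const[OF U])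
    finally show ?thesis .
  qed
  have "block_variance I U g = cube_mean (I - U) (\<lambda>z. ?\<theta> g ((I - U) - z) * (1 - ?\<theta> g ((I - U) - z)))"
    unfolding block_variance_def by (rule cube_mean_complement[symmetric])
  also have "\<dots> = block_variance I U f"
    unfolding block_variance_def by (rule cube_mean_cong) (simp add: *)
  finally show ?thesis .
qed

lemma block_variance_whole:
  "block_variance I I f = cube_mean I (\<lambda>x. of_bool (f x)) * (1 - cube_mean I (\<lambda>x. of_bool (f x)))"
  by (simp add: block_variance_def)

text \<open>
  Let \<open>t\<close> be the voter at which the variance of \<open>f\<close> on the initial segment first reaches \<open>\<kappa>\<close>. The
  segment up to \<open>t\<close> and, by subadditivity, the segment from \<open>t\<close> onwards both carry variance \<open>\<kappa>\<close>
  of \<open>f\<close>, so \<open>g\<close> has little variance after \<open>t\<close> and before \<open>t\<close>. Hence \<open>g\<close> has variance \<open>\<kappa>\<close> on \<open>{t}\<close>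
  itself, and \<open>f\<close> can have little outside \<open>t\<close>.
\<close>

lemma block_variance_split:
  fixes n :: nat
  assumes \<kappa>: "0 < \<kappa>"
    and no: "\<And>U V. U \<subseteq> {..<n} \<Longrightarrow> V \<subseteq> {..<n} \<Longrightarrow> U \<inter> V = {}
        \<Longrightarrow> block_variance {..<n} U f < \<kappa> \<or> block_variance {..<n} V g < \<kappa>"
    and f: "2 * \<kappa> \<le> block_variance {..<n} {..<n} f" and g: "3 * \<kappa> \<le> block_variance {..<n} {..<n} g"
  obtains t where "t < n" "block_variance {..<n} ({..<n} - {t}) f < 2 * \<kappa>"
    "block_variance {..<n} ({..<n} - {t}) g < 2 * \<kappa>"
proof -
  let ?V = "block_variance {..<n}"
  define t where "t = (LEAST t. \<kappa> \<le> ?V {..<Suc t} f)"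
  have ex: "\<kappa> \<le> ?V {..<Suc (n - 1)} f"
  proof (cases n)
    case 0
    then show ?thesis using f \<kappa> by (simp add: block_variance_empty)
  next
    case (Suc k)
    then show ?thesis using f \<kappa> by simp
  qed
  have t: "\<kappa> \<le> ?V {..<Suc t} f" unfolding t_def by (rule LeastI[of "\<lambda>t. \<kappa> \<le> ?V {..<Suc t} f", OF ex])
  have n0: "n \<noteq> 0" using f \<kappa> by (intro notI) (simp add: block_variance_empty)
  have "t \<le> n - 1" unfolding t_def by (rule Least_le[of "\<lambda>t. \<kappa> \<le> ?V {..<Suc t} f", OF ex])
  with n0 have tn: "t < n" by simp
  have lt: "?V {..<t} f < \<kappa>"
  proof (cases t)
    case 0
    then show ?thesis using \<kappa> by (simp add: block_variance_empty)
  next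
    case (Suc s)
    then have "\<not> \<kappa> \<le> ?V {..<Suc s} f" using not_less_Least[of s "\<lambda>t. \<kappa> \<le> ?V {..<Suc t} f"] by (simp add: t_def)
    then show ?thesis by (simp add: Suc)
  qed
  have sub: "?V (A \<union> B) h \<le> ?V A h + ?V B h" if "A \<subseteq> {..<n}" "B \<subseteq> {..<n}" "A \<inter> B = {}" for A B h
    using that by (intro block_variance_subadditive) auto
  have g1: "?V {Suc t..<n} g < \<kappa>"
  proof -
    have "?V {..<Suc t} f < \<kappa> \<or> ?V {Suc t..<n} g < \<kappa>" by (rule no) (use tn in auto)
    with t show ?thesis by linarith
  qed
  have "?V ({..<t} \<union> {t..<n}) f \<le> ?V {..<t} f + ?V {t..<n} f" using tn by (intro sub) auto
  moreover have "{..<t} \<union> {t..<n} = {..<n}" using tn by auto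
  ultimately have "\<kappa> \<le> ?V {t..<n} f" using lt f by simp
  moreover have "?V {t..<n} f < \<kappa> \<or> ?V {..<t} g < \<kappa>" by (rule no) (use tn in auto)
  ultimately have g2: "?V {..<t} g < \<kappa>" by linarith
  have "?V ({..<t} \<union> {Suc t..<n}) g \<le> ?V {..<t} g + ?V {Suc t..<n} g" using tn by (intro sub) auto
  moreover have e: "{..<t} \<union> {Suc t..<n} = {..<n} - {t}" using tn by auto
  ultimately have g3: "?V ({..<n} - {t}) g < 2 * \<kappa>" using g1 g2 by simp
  have "?V (({..<n} - {t}) \<union> {t}) g \<le> ?V ({..<n} - {t}) g + ?V {t} g" using tn by (intro sub) auto
  moreover have "({..<n} - {t}) \<union> {t} = {..<n}" using tn by auto
  ultimately have "\<kappa> \<le> ?V {t} g" using g g3 by simp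
  moreover have "?V ({..<n} - {t}) f < \<kappa> \<or> ?V {t} g < \<kappa>" by (rule no) (use tn in auto)
  ultimately have "?V ({..<n} - {t}) f < \<kappa>" by linarith
  then show ?thesis using that[OF tn _ g3] \<kappa> by simp
qed

section \<open>Random rankings and correlated votes\<close>

abbreviation expect :: "'a pmf \<Rightarrow> ('a \<Rightarrow> real) \<Rightarrow> real" where
  "expect \<equiv> measure_pmf.expectation"

lemma expectation_pair_pmf:
  fixes h :: "'a \<times> 'b \<Rightarrow> real"
  assumes "finite (set_pmf A)" "finite (set_pmf B)"
  shows "expect (pair_pmf A B) h
    = expect A (\<lambda>a. expect B (\<lambda>b. h (a, b)))"
proof -
  have "expect (pair_pmf A B) h
    = (\<Sum>(a, b)\<in>set_pmf A \<times> set_pmf B. h (a, b) * pmf (pair_pmf A B) (a, b))"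
    using assms by (subst integral_measure_pmf_real[of "set_pmf A \<times> set_pmf B"]) (auto intro!: sum.cong)
  also have "\<dots> = (\<Sum>a\<in>set_pmf A. (\<Sum>b\<in>set_pmf B. h (a, b) * pmf B b) * pmf A a)"
    by (simp add: sum.cartesian_product[symmetric] pmf_pair sum_distrib_right sum_distrib_left mult_ac)
  also have "\<dots> = expect A (\<lambda>a. expect B (\<lambda>b. h (a, b)))"
    using assms by (simp add: integral_measure_pmf_real[of "set_pmf A"] integral_measure_pmf_real[of "set_pmf B"])
  finally show ?thesis .
qed

lemma finite_set_Pi_pmf:
  assumes "finite I" "finite (set_pmf \<mu>)"
  shows "finite (set_pmf (Pi_pmf I d (\<lambda>_. \<mu>)))"
  using assms by (simp add: set_Pi_pmf finite_PiE_dflt)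

lemma expectation_Pi_pmf_insert:
  fixes h :: "('i \<Rightarrow> 's) \<Rightarrow> real"
  assumes "finite I" "i \<notin> I" "finite (set_pmf \<mu>)"
  shows "expect (Pi_pmf (insert i I) d (\<lambda>_. \<mu>)) h
    = expect \<mu> (\<lambda>s. expect (Pi_pmf I d (\<lambda>_. \<mu>)) (\<lambda>\<sigma>. h (\<sigma>(i := s))))"
  using assms
  by (simp add: Pi_pmf_insert case_prod_unfold expectation_pair_pmf finite_set_Pi_pmf)

lemma expectation_two_bits:
  fixes G :: "bool \<Rightarrow> bool \<Rightarrow> real"
  assumes "finite (set_pmf \<mu>)"
  shows "expect \<mu> (\<lambda>s. G (p s) (q s))
    = G True True * measure_pmf.prob \<mu> {s. p s \<and> q s} + G False False * measure_pmf.prob \<mu> {s. \<not> p s \<and> \<not> q s}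
    + G True False * measure_pmf.prob \<mu> {s. p s \<and> \<not> q s} + G False True * measure_pmf.prob \<mu> {s. \<not> p s \<and> q s}"
proof -
  note int = integrable_measure_pmf_finite[OF assms]
  have "(\<lambda>s. G (p s) (q s)) = (\<lambda>s. G True True * indicator {s. p s \<and> q s} s + G False False * indicator {s. \<not> p s \<and> \<not> q s} s
    + G True False * indicator {s. p s \<and> \<not> q s} s + G False True * indicator {s. \<not> p s \<and> q s} s)"
    by (auto simp: fun_eq_iff indicator_def)
  then show ?thesis
    by (simp add: int Bochner_Integration.integral_add)
qed

text \<open>
  Two bits read off independent samples form a pair of \<open>\<rho>\<close>-correlated points of the cube.
\<close>

lemma Pi_pmf_cube_law:
  fixes \<phi> \<psi> :: "'i set \<Rightarrow> real"
  assumes I: "finite I" and \<mu>: "finite (set_pmf \<mu>)"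
    and pr: "measure_pmf.prob \<mu> {s. p s \<and> q s} = (1 + \<rho>) / 4" "measure_pmf.prob \<mu> {s. \<not> p s \<and> \<not> q s} = (1 + \<rho>) / 4"
      "measure_pmf.prob \<mu> {s. p s \<and> \<not> q s} = (1 - \<rho>) / 4" "measure_pmf.prob \<mu> {s. \<not> p s \<and> q s} = (1 - \<rho>) / 4"
  shows "expect (Pi_pmf I d (\<lambda>_. \<mu>)) (\<lambda>\<sigma>. \<phi> {i\<in>I. p (\<sigma> i)} * \<psi> {i\<in>I. q (\<sigma> i)})
    = cube_mean I (\<lambda>x. \<phi> x * noise \<rho> I \<psi> x)"
  using I
proof (induction I arbitrary: \<phi> \<psi> rule: finite_induct)
  case empty
  then show ?case by simp
next
  case (insert i I)
  let ?\<phi> = "\<lambda>b x. \<phi> (if b then insert i x else x)" and ?\<psi> = "\<lambda>b x. \<psi> (if b then insert i x else x)"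
  define G where "G b c = expect (Pi_pmf I d (\<lambda>_. \<mu>)) (\<lambda>\<sigma>. ?\<phi> b {i\<in>I. p (\<sigma> i)} * ?\<psi> c {i\<in>I. q (\<sigma> i)})" for b c
  have split: "{j\<in>insert i I. r ((\<sigma>(i := s)) j)} = (if r s then insert i {j\<in>I. r (\<sigma> j)} else {j\<in>I. r (\<sigma> j)})"
    for r \<sigma> s using insert.hyps by auto
  have G: "G b c = cube_mean I (\<lambda>x. ?\<phi> b x * noise \<rho> I (?\<psi> c) x)" for b c
    unfolding G_def by (rule insert.IH)
  have "expect (Pi_pmf (insert i I) d (\<lambda>_. \<mu>)) (\<lambda>\<sigma>. \<phi> {j\<in>insert i I. p (\<sigma> j)} * \<psi> {j\<in>insert i I. q (\<sigma> j)})
    = expect \<mu> (\<lambda>s. G (p s) (q s))"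
    unfolding expectation_Pi_pmf_insert[OF insert.hyps \<mu>] split G_def ..
  also have "\<dots> = (1 + \<rho>) / 4 * (G True True + G False False) + (1 - \<rho>) / 4 * (G True False + G False True)"
    unfolding expectation_two_bits[OF \<mu>] pr by (simp add: field_simps)
  also have "\<dots> = cube_mean (insert i I) (\<lambda>x. \<phi> x * noise \<rho> (insert i I) \<psi> x)"
    unfolding cube_mean_noise_insert[OF insert.hyps] G by (simp add: add.commute)
  finally show ?case .
qed

lemma rankingsD:
  assumes "s \<in> rankings k"
  shows "(a, b) \<in> s \<Longrightarrow> (b, c) \<in> s \<Longrightarrow> (a, c) \<in> s" "(a, b) \<in> s \<Longrightarrow> (b, a) \<notin> s"
    "a < k \<Longrightarrow> b < k \<Longrightarrow> a \<noteq> b \<Longrightarrow> (a, b) \<notin> s \<longleftrightarrow> (b, a) \<in> s"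
proof -
  have s: "trans s" "irrefl s" "total_on {..<k} s"
    using assms by (auto simp: rankings_def strict_linear_order_on_def)
  show t: "(a, b) \<in> s \<Longrightarrow> (b, c) \<in> s \<Longrightarrow> (a, c) \<in> s" for a b c using s(1) by (rule transD)
  show as: "(a, b) \<in> s \<Longrightarrow> (b, a) \<notin> s" for a b
    using t[of a b a] s(2) by (auto simp: irrefl_def)
  show "a < k \<Longrightarrow> b < k \<Longrightarrow> a \<noteq> b \<Longrightarrow> (a, b) \<notin> s \<longleftrightarrow> (b, a) \<in> s"
    using s(3) as by (auto simp: total_on_def)
qed

lemma order_exists:
  assumes "s \<in> rankings k" "a < k" "b < k" "c < k" "a \<noteq> b" "b \<noteq> c" "a \<noteq> c"
  shows "(a, b) \<in> s \<and> (b, c) \<in> s \<or> (a, c) \<in> s \<and> (c, b) \<in> s \<or> (b, a) \<in> s \<and> (a, c) \<in> s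
    \<or> (b, c) \<in> s \<and> (c, a) \<in> s \<or> (c, a) \<in> s \<and> (a, b) \<in> s \<or> (c, b) \<in> s \<and> (b, a) \<in> s"
  using rankingsD(3)[OF assms(1) assms(2,3,5)] rankingsD(3)[OF assms(1) assms(3,4,6)]
    rankingsD(3)[OF assms(1) assms(2,4,7)] by blast

lemma converse_rankings: "s \<in> rankings k \<Longrightarrow> s\<inverse> \<in> rankings k"
  by (auto simp: rankings_def strict_linear_order_on_def irrefl_def)

lemma prob_eq_sum:
  assumes "set_pmf \<mu> \<subseteq> rankings k"
  shows "measure_pmf.prob \<mu> {s. P s} = (\<Sum>s\<in>{s\<in>rankings k. P s}. pmf \<mu> s)"
proof -
  have "measure_pmf.prob \<mu> {s. P s} = measure_pmf.prob \<mu> {s\<in>rankings k. P s}"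
    using assms by (intro measure_pmf.finite_measure_eq_AE) (auto simp: AE_measure_pmf_iff)
  also have "\<dots> = (\<Sum>s\<in>{s\<in>rankings k. P s}. pmf \<mu> s)"
    using finite_rankings by (intro measure_measure_pmf_finite) auto
  finally show ?thesis .
qed

lemma prob_converse:
  assumes "set_pmf \<mu> \<subseteq> rankings k" "symmetric_distribution k \<mu>"
  shows "measure_pmf.prob \<mu> {s. P (s\<inverse>)} = measure_pmf.prob \<mu> {s. P s}"
  unfolding prob_eq_sum[OF assms(1)]
  by (rule sum.reindex_bij_witness[where i = converse and j = converse])
    (use assms(2) converse_rankings in \<open>auto simp: symmetric_distribution_def\<close>)

definition triple_bound :: "nat \<Rightarrow> nat rel pmf \<Rightarrow> real \<Rightarrow> bool" where
  "triple_bound k \<mu> \<beta> \<longleftrightarrow> (\<forall>a<k. \<forall>b<k. \<forall>c<k. a \<noteq> b \<longrightarrow> b \<noteq> c \<longrightarrow> a \<noteq> c \<longrightarrow>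
     \<beta> \<le> measure_pmf.prob \<mu> {s. (a, b) \<in> s \<and> (b, c) \<in> s})"

text \<open>
  Reversing the ranking flips both bits, so equal bits and different bits are each split evenly.
  Of the six orders of \<open>a, b, c\<close> two give equal bits and four give different ones.
\<close>

lemma pair_correlation:
  assumes \<mu>: "set_pmf \<mu> \<subseteq> rankings k" "symmetric_distribution k \<mu>" and \<beta>: "triple_bound k \<mu> \<beta>" "0 \<le> \<beta>"
    and abc: "a < k" "b < k" "c < k" "a \<noteq> b" "b \<noteq> c" "a \<noteq> c"
  obtains \<rho> where "\<bar>\<rho>\<bar> \<le> 1 - 4 * \<beta>" "6 * \<beta> \<le> 1"
    "measure_pmf.prob \<mu> {s. (a, b) \<in> s \<and> (b, c) \<in> s} = (1 + \<rho>) / 4"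
    "measure_pmf.prob \<mu> {s. (a, b) \<notin> s \<and> (b, c) \<notin> s} = (1 + \<rho>) / 4"
    "measure_pmf.prob \<mu> {s. (a, b) \<in> s \<and> (b, c) \<notin> s} = (1 - \<rho>) / 4"
    "measure_pmf.prob \<mu> {s. (a, b) \<notin> s \<and> (b, c) \<in> s} = (1 - \<rho>) / 4"
proof -
  let ?P = "\<lambda>A. measure_pmf.prob \<mu> A"
  define p where "p = ?P {s. (a, b) \<in> s \<and> (b, c) \<in> s}"
  define q where "q = ?P {s. (a, b) \<in> s \<and> (b, c) \<notin> s}"
  have neg: "(x, y) \<notin> s \<longleftrightarrow> (x, y) \<in> s\<inverse>" if "s \<in> rankings k" "x < k" "y < k" "x \<noteq> y" for s x y
    using rankingsD(3)[OF that] by simp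
  have flip: "?P {s. (a, b) \<notin> s \<and> (b, c) \<notin> s} = p" "?P {s. (a, b) \<notin> s \<and> (b, c) \<in> s} = q"
  proof -
    have "?P {s. (a, b) \<notin> s \<and> (b, c) \<notin> s} = ?P {s. (a, b) \<in> s\<inverse> \<and> (b, c) \<in> s\<inverse>}"
      unfolding prob_eq_sum[OF \<mu>(1)] using neg abc by (intro sum.cong) auto
    also have "\<dots> = p" unfolding p_def using prob_converse[OF \<mu>, of "\<lambda>s. (a, b) \<in> s \<and> (b, c) \<in> s"] .
    finally show "?P {s. (a, b) \<notin> s \<and> (b, c) \<notin> s} = p" .
    have "?P {s. (a, b) \<notin> s \<and> (b, c) \<in> s} = ?P {s. (a, b) \<in> s\<inverse> \<and> (b, c) \<notin> s\<inverse>}"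
      unfolding prob_eq_sum[OF \<mu>(1)] using neg abc by (intro sum.cong) auto
    also have "\<dots> = q" unfolding q_def using prob_converse[OF \<mu>, of "\<lambda>s. (a, b) \<in> s \<and> (b, c) \<notin> s"] .
    finally show "?P {s. (a, b) \<notin> s \<and> (b, c) \<in> s} = q" .
  qed
  have total: "2 * p + 2 * q = 1"
  proof -
    have fin: "finite (set_pmf \<mu>)" using \<mu>(1) finite_rankings finite_subset by blast
    show ?thesis
      using expectation_two_bits[OF fin, of "\<lambda>_ _. 1" "\<lambda>s. (a, b) \<in> s" "\<lambda>s. (b, c) \<in> s"]
      unfolding flip p_def[symmetric] q_def[symmetric] by simp
  qed
  have p: "\<beta> \<le> p" using \<beta>(1) abc by (auto simp: triple_bound_def p_def)
  have q: "2 * \<beta> \<le> q"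
  proof -
    let ?A = "{s\<in>rankings k. (a, c) \<in> s \<and> (c, b) \<in> s}" and ?B = "{s\<in>rankings k. (c, a) \<in> s \<and> (a, b) \<in> s}"
    have "\<beta> \<le> sum (pmf \<mu>) ?A" "\<beta> \<le> sum (pmf \<mu>) ?B"
      using \<beta>(1) abc unfolding triple_bound_def prob_eq_sum[OF \<mu>(1)] by auto
    then have "2 * \<beta> \<le> sum (pmf \<mu>) ?A + sum (pmf \<mu>) ?B" by simp
    also have "\<dots> = sum (pmf \<mu>) (?A \<union> ?B)"
      using finite_rankings rankingsD(2) by (intro sum.union_disjoint[symmetric]) auto
    also have "\<dots> \<le> sum (pmf \<mu>) {s\<in>rankings k. (a, b) \<in> s \<and> (b, c) \<notin> s}"
    proof (rule sum_mono2)
      show "?A \<union> ?B \<subseteq> {s\<in>rankings k. (a, b) \<in> s \<and> (b, c) \<notin> s}"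
        using rankingsD(1,2) by blast
    qed (use finite_rankings in auto)
    finally show ?thesis by (simp add: q_def prob_eq_sum[OF \<mu>(1)])
  qed
  show ?thesis
  proof (rule that[of "4 * p - 1"])
    show "\<bar>4 * p - 1\<bar> \<le> 1 - 4 * \<beta>" using p q total \<beta>(2) by (simp add: abs_le_iff)
    show "6 * \<beta> \<le> 1" using p q total by simp
    have "q = (1 - (4 * p - 1)) / 4" using total by simp
    then show "?P {s. (a, b) \<in> s \<and> (b, c) \<notin> s} = (1 - (4 * p - 1)) / 4"
      "?P {s. (a, b) \<notin> s \<and> (b, c) \<in> s} = (1 - (4 * p - 1)) / 4"
      by (simp_all add: flip q_def)
  qed (simp_all add: flip p_def[symmetric])
qed

section \<open>Two pivotal voters produce a cycle\<close>

definition votes :: "nat \<Rightarrow> nat \<Rightarrow> nat \<Rightarrow> (nat \<Rightarrow> nat rel) \<Rightarrow> nat set" where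
  "votes n a b \<sigma> = {i\<in>{..<n}. (a, b) \<in> \<sigma> i}"

text \<open>
  Under IIA all profiles with the votes \<open>X\<close> agree on the pair \<open>a, b\<close>, so that it makes no
  difference which of them is chosen.
\<close>

definition pair_rule ::
    "nat \<Rightarrow> nat \<Rightarrow> ((nat \<Rightarrow> nat rel) \<Rightarrow> nat rel) \<Rightarrow> nat \<Rightarrow> nat \<Rightarrow> nat set \<Rightarrow> bool" where
  "pair_rule k n F a b X \<longleftrightarrow> (\<exists>\<sigma>\<in>profiles k n. votes n a b \<sigma> = X \<and> (a, b) \<in> F \<sigma>)"

lemma pair_rule_votes:
  assumes "IIA k n F" "a < k" "b < k" "a \<noteq> b" "\<sigma> \<in> profiles k n"
  shows "pair_rule k n F a b (votes n a b \<sigma>) \<longleftrightarrow> (a, b) \<in> F \<sigma>"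
proof
  assume "pair_rule k n F a b (votes n a b \<sigma>)"
  then obtain \<tau> where \<tau>: "\<tau> \<in> profiles k n" "votes n a b \<tau> = votes n a b \<sigma>" "(a, b) \<in> F \<tau>"
    by (auto simp: pair_rule_def)
  have "(a, b) \<in> \<tau> i \<longleftrightarrow> (a, b) \<in> \<sigma> i" if "i < n" for i
  proof -
    have "i \<in> votes n a b \<tau> \<longleftrightarrow> i \<in> votes n a b \<sigma>" by (simp only: \<tau>(2))
    then show ?thesis using that by (simp add: votes_def)
  qed
  then show "(a, b) \<in> F \<sigma>" using assms \<tau>(1,3) unfolding IIA_def by metis
qed (use assms in \<open>auto simp: pair_rule_def\<close>)

lemma votes_upd:
  "i < n \<Longrightarrow> votes n a b (\<sigma>(i := s)) = (if (a, b) \<in> s then insert i (votes n a b \<sigma>) else votes n a b \<sigma> - {i})"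
  by (auto simp: votes_def)

lemma pivotal_choice:
  assumes "pivotal i f X"
  obtains p where "f (if p then insert i X else X - {i}) = v"
proof (cases "f X = v")
  case True
  then show ?thesis using that[of "i \<in> X"] by (cases "i \<in> X") (auto simp: insert_absorb)
next
  case False
  then have "f (flip i X) = v" using assms by (auto simp: pivotal_def)
  then show ?thesis using that[of "i \<notin> X"] by (cases "i \<in> X") (auto simp: flip_def)
qed

lemma ranking_order_bits:
  assumes "s \<in> rankings k" "(x, y) \<in> s" "(y, z) \<in> s"
  shows "(x, y) \<in> s \<and> (y, z) \<in> s \<and> (x, z) \<in> s \<and> (y, x) \<notin> s \<and> (z, y) \<notin> s \<and> (z, x) \<notin> s"
  using assms rankingsD(1)[OF assms] rankingsD(2)[OF assms(1,2)] rankingsD(2)[OF assms(1,3)]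
    rankingsD(2)[OF assms(1) rankingsD(1)[OF assms]] by simp

text \<open>
  Voter \<open>i\<close> keeps the vote on \<open>b, c\<close> and ranks \<open>a\<close> next to \<open>b\<close>, so that the vote on \<open>a, b\<close> can be chosen
  freely without affecting the one on \<open>a, c\<close>; voter \<open>j\<close> keeps the vote on \<open>a, b\<close> and ranks \<open>c\<close> next
  to \<open>b\<close>. Now the outcome on \<open>a, c\<close> is fixed, and the two pivotal voters turn the other two
  outcomes into a cycle with it.
\<close>

lemma pivotal_pair_paradox:
  assumes F: "F \<in> constitutions k n" "IIA k n F"
    and abc: "a < k" "b < k" "c < k" "a \<noteq> b" "b \<noteq> c" "a \<noteq> c"
    and ij: "i < n" "j < n" "i \<noteq> j" and \<sigma>: "\<sigma> \<in> profiles k n"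
    and piv: "pivotal i (pair_rule k n F a b) (votes n a b \<sigma>)" "pivotal j (pair_rule k n F b c) (votes n b c \<sigma>)"
  obtains x y z x' y' z' where "{x, y, z} = {a, b, c}" "{x', y', z'} = {a, b, c}"
    "\<And>s s'. s \<in> rankings k \<Longrightarrow> s' \<in> rankings k \<Longrightarrow> (x, y) \<in> s \<Longrightarrow> (y, z) \<in> s
      \<Longrightarrow> (x', y') \<in> s' \<Longrightarrow> (y', z') \<in> s' \<Longrightarrow> \<not> trans (F (\<sigma>(i := s, j := s')))"
proof -
  let ?r = "pair_rule k n F"
  \<comment> \<open>the votes of \<open>i\<close> on \<open>b, c\<close> and of \<open>j\<close> on \<open>a, b\<close>, which are kept\<close>
  define P where "P \<longleftrightarrow> (b, c) \<in> \<sigma> i"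
  define Q where "Q \<longleftrightarrow> (a, b) \<in> \<sigma> j"
  \<comment> \<open>the votes on \<open>a, c\<close> once \<open>a\<close> is next to \<open>b\<close> for voter \<open>i\<close>, and \<open>c\<close> next to \<open>b\<close> for voter \<open>j\<close>\<close>
  define Z where "Z = (let Z' = (if P then insert i (votes n a c \<sigma>) else votes n a c \<sigma> - {i})
      in if Q then insert j Z' else Z' - {j})"
  define w where "w \<longleftrightarrow> ?r a c Z"
  obtain p where p: "?r a b (if p then insert i (votes n a b \<sigma>) else votes n a b \<sigma> - {i}) = (\<not> w)"
    using pivotal_choice[OF piv(1)] by blast
  obtain q where q: "?r b c (if q then insert j (votes n b c \<sigma>) else votes n b c \<sigma> - {j}) = (\<not> w)"
    using pivotal_choice[OF piv(2)] by blast
  have core: "\<not> trans (F (\<sigma>(i := s, j := s')))"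
    if s: "s \<in> rankings k" "s' \<in> rankings k"
      and bits: "(a, b) \<in> s \<longleftrightarrow> p" "(b, c) \<in> s \<longleftrightarrow> P" "(a, c) \<in> s \<longleftrightarrow> P"
        "(a, b) \<in> s' \<longleftrightarrow> Q" "(b, c) \<in> s' \<longleftrightarrow> q" "(a, c) \<in> s' \<longleftrightarrow> Q" for s s'
  proof -
    let ?\<sigma> = "\<sigma>(i := s, j := s')"
    have \<sigma>': "?\<sigma> \<in> profiles k n"
      using \<sigma> s ij unfolding profiles_def by (auto simp: PiE_def extensional_def)
    have "F ?\<sigma> \<in> strict_preferences k" using F(1) \<sigma>' by (auto simp: constitutions_def)
    then have asym: "asym (F ?\<sigma>)" and total: "total_on {..<k} (F ?\<sigma>)" by (auto simp: strict_preferences_def)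
    have tot: "(u, v) \<in> F ?\<sigma> \<or> (v, u) \<in> F ?\<sigma>" if "u < k" "v < k" "u \<noteq> v" for u v
      using total that by (simp add: total_on_def)
    have "votes n a b ?\<sigma> = (if p then insert i (votes n a b \<sigma>) else votes n a b \<sigma> - {i})"
      using ij bits by (auto simp: votes_def Q_def split: if_splits)
    then have 1: "(a, b) \<in> F ?\<sigma> \<longleftrightarrow> \<not> w"
      using pair_rule_votes[OF F(2) abc(1,2,4) \<sigma>'] p by simp
    have "votes n b c ?\<sigma> = (if q then insert j (votes n b c \<sigma>) else votes n b c \<sigma> - {j})"
      using ij bits by (auto simp: votes_def P_def split: if_splits)
    then have 2: "(b, c) \<in> F ?\<sigma> \<longleftrightarrow> \<not> w"
      using pair_rule_votes[OF F(2) abc(2,3,5) \<sigma>'] q by simp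
    have "votes n a c ?\<sigma> = Z"
      using ij bits by (simp add: votes_upd Z_def)
    then have 3: "(a, c) \<in> F ?\<sigma> \<longleftrightarrow> w"
      using pair_rule_votes[OF F(2) abc(1,3,6) \<sigma>'] by (simp add: w_def)
    show ?thesis
    proof
      assume tr: "trans (F ?\<sigma>)"
      show False
      proof (cases w)
        case True
        then have "(b, a) \<in> F ?\<sigma>" "(c, b) \<in> F ?\<sigma>"
          using 1 2 tot[OF abc(1,2,4)] tot[OF abc(2,3,5)] by simp_all
        then have "(c, a) \<in> F ?\<sigma>" by (meson transD[OF tr])
        then show False using 3 True asymD[OF asym] by simp
      next
        case False
        then have "(a, c) \<in> F ?\<sigma>" using 1 2 transD[OF tr, of a b c] by simp
        then show False using 3 False by simp
      qed
    qed
  qed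
  note bits = ranking_order_bits[where k = k]
  obtain x y z where xyz: "{x, y, z} = {a, b, c}"
    "\<And>s. s \<in> rankings k \<Longrightarrow> (x, y) \<in> s \<Longrightarrow> (y, z) \<in> s
      \<Longrightarrow> ((a, b) \<in> s \<longleftrightarrow> p) \<and> ((b, c) \<in> s \<longleftrightarrow> P) \<and> ((a, c) \<in> s \<longleftrightarrow> P)"
  proof (cases P; cases p)
    assume "P" "p" then show ?thesis using bits[of _ a b c] by (intro that[of a b c]) auto
  next
    assume "P" "\<not> p" then show ?thesis using bits[of _ b a c] by (intro that[of b a c]) auto
  next
    assume "\<not> P" "p" then show ?thesis using bits[of _ c a b] by (intro that[of c a b]) auto
  next
    assume "\<not> P" "\<not> p" then show ?thesis using bits[of _ c b a] by (intro that[of c b a]) auto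
  qed
  obtain x' y' z' where xyz': "{x', y', z'} = {a, b, c}"
    "\<And>s. s \<in> rankings k \<Longrightarrow> (x', y') \<in> s \<Longrightarrow> (y', z') \<in> s
      \<Longrightarrow> ((a, b) \<in> s \<longleftrightarrow> Q) \<and> ((b, c) \<in> s \<longleftrightarrow> q) \<and> ((a, c) \<in> s \<longleftrightarrow> Q)"
  proof (cases Q; cases q)
    assume "Q" "q" then show ?thesis using bits[of _ a b c] by (intro that[of a b c]) auto
  next
    assume "Q" "\<not> q" then show ?thesis using bits[of _ a c b] by (intro that[of a c b]) auto
  next
    assume "\<not> Q" "q" then show ?thesis using bits[of _ b c a] by (intro that[of b c a]) auto
  next
    assume "\<not> Q" "\<not> q" then show ?thesis using bits[of _ c b a] by (intro that[of c b a]) auto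
  qed
  show ?thesis
  proof (rule that[OF xyz(1) xyz'(1)])
    fix s s' assume s: "s \<in> rankings k" "s' \<in> rankings k"
      and o: "(x, y) \<in> s" "(y, z) \<in> s" "(x', y') \<in> s'" "(y', z') \<in> s'"
    show "\<not> trans (F (\<sigma>(i := s, j := s')))"
      by (rule core[OF s]) (use xyz(2)[OF s(1) o(1,2)] xyz'(2)[OF s(2) o(3,4)] in simp_all)
  qed
qed

lemma expectation_swap:
  fixes h :: "'a \<Rightarrow> 'b \<Rightarrow> real"
  assumes "finite (set_pmf A)" "finite (set_pmf B)"
  shows "expect A (\<lambda>a. expect B (\<lambda>b. h a b))
    = expect B (\<lambda>b. expect A (\<lambda>a. h a b))"
proof -
  have "expect (pair_pmf A B) (\<lambda>(a, b). h a b) = expect (pair_pmf B A) (\<lambda>(b, a). h a b)"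
    by (subst pair_commute_pmf) (simp add: case_prod_unfold)
  then show ?thesis using assms by (simp add: expectation_pair_pmf)
qed

lemma prob_eq_expectation: "measure_pmf.prob p {x. P x} = expect p (\<lambda>x. of_bool (P x))"
proof -
  have "(\<lambda>x. of_bool (P x) :: real) = indicator {x. P x}" by (auto simp: indicator_def)
  then show ?thesis by simp
qed

text \<open>
  Condition on the other voters. If the event is possible at all, then the orders required from
  \<open>i\<close> and \<open>j\<close> for the cycle have probability at least \<open>\<beta>\<close> each.
\<close>

lemma nontransitive_prob_ge_pivotal:
  assumes F: "F \<in> constitutions k n" "IIA k n F"
    and \<mu>: "set_pmf \<mu> \<subseteq> rankings k" and \<beta>: "triple_bound k \<mu> \<beta>" "0 \<le> \<beta>"
    and abc: "a < k" "b < k" "c < k" "a \<noteq> b" "b \<noteq> c" "a \<noteq> c" and ij: "i < n" "j < n" "i \<noteq> j"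
  shows "\<beta>\<^sup>2 * measure_pmf.prob (profile_pmf n \<mu>) {\<sigma>. pivotal i (pair_rule k n F a b) (votes n a b \<sigma>)
      \<and> pivotal j (pair_rule k n F b c) (votes n b c \<sigma>)} \<le> nontransitive_prob n \<mu> F"
proof -
  let ?E = "\<lambda>\<sigma>. pivotal i (pair_rule k n F a b) (votes n a b \<sigma>) \<and> pivotal j (pair_rule k n F b c) (votes n b c \<sigma>)"
  let ?N = "\<lambda>\<sigma>. \<not> trans (F \<sigma>)"
  have fin: "finite (set_pmf \<mu>)" using \<mu> finite_rankings finite_subset by blast
  define J where "J = {..<n} - {i, j}"
  let ?Q = "Pi_pmf J undefined (\<lambda>_. \<mu>)"
  have J: "finite J" "i \<notin> J" "finite (insert i J)" "j \<notin> insert i J" "insert j (insert i J) = {..<n}"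
    using ij by (auto simp: J_def)
  have finQ: "finite (set_pmf ?Q)" by (rule finite_set_Pi_pmf[OF J(1) fin])
  \<comment> \<open>the mean over the rankings of the voters \<open>i\<close> and \<open>j\<close> alone\<close>
  define D where "D h = expect \<mu> (\<lambda>s'. expect \<mu> (\<lambda>s. h s s'))"
    for h :: "nat rel \<Rightarrow> nat rel \<Rightarrow> real"
  have int: "integrable (measure_pmf \<mu>) h" for h :: "nat rel \<Rightarrow> real"
    by (rule integrable_measure_pmf_finite[OF fin])
  have D_mono: "D h \<le> D h'" if "\<And>s s'. s \<in> rankings k \<Longrightarrow> s' \<in> rankings k \<Longrightarrow> h s s' \<le> h' s s'" for h h'
    unfolding D_def
  proof (rule integral_mono_AE[OF int int], unfold AE_measure_pmf_iff, intro ballI)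
    fix s' assume "s' \<in> set_pmf \<mu>"
    then have "s' \<in> rankings k" using \<mu> by blast
    then show "expect \<mu> (\<lambda>s. h s s') \<le> expect \<mu> (\<lambda>s. h' s s')"
      using that \<mu> by (intro integral_mono_AE[OF int int], unfold AE_measure_pmf_iff, intro ballI) blast
  qed
  have D_const: "D (\<lambda>_ _. r) = r" for r unfolding D_def by simp
  have split: "expect (profile_pmf n \<mu>) h
    = expect ?Q (\<lambda>\<tau>. D (\<lambda>s s'. h (\<tau>(i := s, j := s'))))" for h :: "(nat \<Rightarrow> nat rel) \<Rightarrow> real"
  proof -
    have "expect (profile_pmf n \<mu>) h = expect \<mu> (\<lambda>s'. expect \<mu>
        (\<lambda>s. expect ?Q (\<lambda>\<tau>. h (\<tau>(i := s, j := s')))))"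
      unfolding profile_pmf_def J(5)[symmetric] expectation_Pi_pmf_insert[OF J(3,4) fin] expectation_Pi_pmf_insert[OF J(1,2) fin] ..
    also have "\<dots> = expect \<mu> (\<lambda>s'. expect ?Q
        (\<lambda>\<tau>. expect \<mu> (\<lambda>s. h (\<tau>(i := s, j := s')))))"
      by (subst expectation_swap[OF fin finQ]) (rule refl)
    also have "\<dots> = expect ?Q (\<lambda>\<tau>. D (\<lambda>s s'. h (\<tau>(i := s, j := s'))))"
      unfolding D_def by (rule expectation_swap[OF fin finQ])
    finally show ?thesis .
  qed
  have inner: "\<beta>\<^sup>2 * D (\<lambda>s s'. of_bool (?E (\<tau>(i := s, j := s')))) \<le> D (\<lambda>s s'. of_bool (?N (\<tau>(i := s, j := s'))))"
    if \<tau>: "\<tau> \<in> set_pmf ?Q" for \<tau>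
  proof (cases "\<exists>s\<in>rankings k. \<exists>s'\<in>rankings k. ?E (\<tau>(i := s, j := s'))")
    case False
    then have "D (\<lambda>s s'. of_bool (?E (\<tau>(i := s, j := s')))) \<le> D (\<lambda>_ _. 0)"
      by (intro D_mono) auto
    moreover have "D (\<lambda>_ _. 0) \<le> D (\<lambda>s s'. of_bool (?N (\<tau>(i := s, j := s'))))" by (intro D_mono) auto
    ultimately show ?thesis
      unfolding D_const using mult_left_mono[of "D (\<lambda>s s'. of_bool (?E (\<tau>(i := s, j := s'))))" 0 "\<beta>\<^sup>2"] by simp
  next
    case True
    then obtain s0 s0' where s0: "s0 \<in> rankings k" "s0' \<in> rankings k" "?E (\<tau>(i := s0, j := s0'))" by blast
    let ?\<sigma> = "\<tau>(i := s0, j := s0')"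
    have \<sigma>: "?\<sigma> \<in> profiles k n"
      unfolding profiles_def
    proof (rule PiE_I)
      have \<tau>': "\<tau> \<in> PiE_dflt J undefined (\<lambda>_. set_pmf \<mu>)" using \<tau> J(1) by (simp add: set_Pi_pmf)
      show "?\<sigma> l \<in> rankings k" if "l \<in> {..<n}" for l
      proof (cases "l = i \<or> l = j")
        case True
        then show ?thesis using s0(1,2) by auto
      next
        case False
        then have "\<tau> l \<in> set_pmf \<mu>" using \<tau>' that by (simp add: PiE_dflt_def J_def)
        then show ?thesis using False \<mu> by auto
      qed
      show "?\<sigma> l = undefined" if "l \<notin> {..<n}" for l
        using \<tau>' that ij by (auto simp: PiE_dflt_def J_def)
    qed
    obtain x y z x' y' z' where xyz: "{x, y, z} = {a, b, c}" "{x', y', z'} = {a, b, c}"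
      and par: "\<And>s s'. s \<in> rankings k \<Longrightarrow> s' \<in> rankings k \<Longrightarrow> (x, y) \<in> s \<Longrightarrow> (y, z) \<in> s
      \<Longrightarrow> (x', y') \<in> s' \<Longrightarrow> (y', z') \<in> s' \<Longrightarrow> ?N (?\<sigma>(i := s, j := s'))"
      by (rule pivotal_pair_paradox[OF F abc ij \<sigma> conjunct1[OF s0(3)] conjunct2[OF s0(3)]]) (rule that)
    have upd: "?\<sigma>(i := s, j := s') = \<tau>(i := s, j := s')" for s s' using ij by auto
    define A where "A = {s. (x, y) \<in> s \<and> (y, z) \<in> s}"
    define A' where "A' = {s. (x', y') \<in> s \<and> (y', z') \<in> s}"
    have "card {x, y, z} = 3" "card {x', y', z'} = 3" "{x, y, z} \<subseteq> {..<k}" "{x', y', z'} \<subseteq> {..<k}"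
      unfolding xyz using abc by auto
    then have d: "x \<noteq> y" "y \<noteq> z" "x \<noteq> z" "x' \<noteq> y'" "y' \<noteq> z'" "x' \<noteq> z'" "x < k" "y < k" "z < k" "x' < k" "y' < k" "z' < k"
      by (auto simp: card_insert_if split: if_splits)
    have A: "\<beta> \<le> measure_pmf.prob \<mu> A" "\<beta> \<le> measure_pmf.prob \<mu> A'"
      using \<beta>(1) d unfolding triple_bound_def A_def A'_def by auto
    have "\<beta>\<^sup>2 * D (\<lambda>s s'. of_bool (?E (\<tau>(i := s, j := s')))) \<le> \<beta>\<^sup>2 * D (\<lambda>_ _. 1)"
      by (intro mult_left_mono D_mono) auto
    also have "\<dots> = \<beta> * \<beta>" unfolding D_const by (simp add: power2_eq_square)
    also have "\<dots> \<le> measure_pmf.prob \<mu> A * measure_pmf.prob \<mu> A'"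
      using A \<beta>(2) by (intro mult_mono) auto
    also have "\<dots> = D (\<lambda>s s'. indicator A s * indicator A' s')"
      unfolding D_def by (simp add: mult.commute)
    also have "\<dots> \<le> D (\<lambda>s s'. of_bool (?N (\<tau>(i := s, j := s'))))"
    proof (rule D_mono)
      fix s s' assume s: "s \<in> rankings k" "s' \<in> rankings k"
      show "indicator A s * indicator A' s' \<le> (of_bool (?N (\<tau>(i := s, j := s'))) :: real)"
        using par[OF s] unfolding upd by (auto simp: A_def A'_def indicator_def)
    qed
    finally show ?thesis .
  qed
  have "\<beta>\<^sup>2 * expect (profile_pmf n \<mu>) (\<lambda>\<sigma>. of_bool (?E \<sigma>))
    = expect ?Q (\<lambda>\<tau>. \<beta>\<^sup>2 * D (\<lambda>s s'. of_bool (?E (\<tau>(i := s, j := s')))))"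
    unfolding split by simp
  also have "\<dots> \<le> expect ?Q (\<lambda>\<tau>. D (\<lambda>s s'. of_bool (?N (\<tau>(i := s, j := s')))))"
    using inner by (intro integral_mono_AE integrable_measure_pmf_finite finQ) (simp add: AE_measure_pmf_iff)
  also have "\<dots> = expect (profile_pmf n \<mu>) (\<lambda>\<sigma>. of_bool (?N \<sigma>))"
    unfolding split ..
  finally have "\<beta>\<^sup>2 * expect (profile_pmf n \<mu>) (\<lambda>\<sigma>. of_bool (?E \<sigma>))
    \<le> expect (profile_pmf n \<mu>) (\<lambda>\<sigma>. of_bool (?N \<sigma>))" .
  then show ?thesis
    unfolding nontransitive_prob_def prob_eq_expectation .
qed

section \<open>Pair rules of a rarely intransitive constitution\<close>

lemma small_min_of_product:
  fixes x :: real
  assumes "0 \<le> x" "x \<le> 1"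
  shows "min x (1 - x) \<le> 2 * (x * (1 - x))"
proof (cases "x \<le> 1/2")
  case True
  then have "x * 1 \<le> x * (2 * (1 - x))" using assms by (intro mult_left_mono) auto
  then have "x \<le> 2 * (x * (1 - x))" by (simp add: algebra_simps)
  then show ?thesis by (rule min.coboundedI1)
next
  case False
  then have "(1 - x) * 1 \<le> (1 - x) * (2 * x)" using assms by (intro mult_left_mono) auto
  then have "1 - x \<le> 2 * (x * (1 - x))" by (simp add: algebra_simps)
  then show ?thesis by (rule min.coboundedI2)
qed

text \<open>
  The common hypotheses of both parts, with \<open>\<beta>\<close> in place of \<open>1/6\<close> and of \<open>\<alpha>\<close>.
\<close>

locale near_transitive_rule =
  fixes k n :: nat and \<mu> :: "nat rel pmf" and \<beta> \<epsilon> :: real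
    and F :: "(nat \<Rightarrow> nat rel) \<Rightarrow> nat rel"
  assumes k3: "3 \<le> k"
    and F: "F \<in> constitutions k n" and iia: "IIA k n F"
    and supp: "set_pmf \<mu> \<subseteq> rankings k" and sym: "symmetric_distribution k \<mu>"
    and triple: "triple_bound k \<mu> \<beta>"
    and \<beta>0: "0 < \<beta>" and \<epsilon>0: "0 < \<epsilon>" and \<epsilon>\<beta>: "\<epsilon> < \<beta>\<^sup>2 / 9"
    and small: "nontransitive_prob n \<mu> F < \<beta>\<^sup>2 * \<epsilon> powr (1 / (2 * \<beta>)) * real n powi (-3)"
begin

abbreviation I :: "nat set" where "I \<equiv> {..<n}"
abbreviation f :: "nat \<Rightarrow> nat \<Rightarrow> nat set \<Rightarrow> bool" where "f \<equiv> pair_rule k n F"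
abbreviation V :: "nat set \<Rightarrow> nat \<Rightarrow> nat \<Rightarrow> real" where "V U a b \<equiv> block_variance I U (f a b)"
abbreviation \<theta> :: "nat \<Rightarrow> nat \<Rightarrow> real" where "\<theta> a b \<equiv> cube_mean I (\<lambda>x. of_bool (f a b x))"
abbreviation Pr :: "((nat \<Rightarrow> nat rel) \<Rightarrow> bool) \<Rightarrow> real" where
  "Pr P \<equiv> measure_pmf.prob (profile_pmf n \<mu>) {\<sigma>. P \<sigma>}"
abbreviation distinct3 :: "nat \<Rightarrow> nat \<Rightarrow> nat \<Rightarrow> bool" where
  "distinct3 a b c \<equiv> a < k \<and> b < k \<and> c < k \<and> a \<noteq> b \<and> b \<noteq> c \<and> a \<noteq> c"

lemma fin_\<mu>: "finite (set_pmf \<mu>)"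
  using supp finite_rankings finite_subset by blast

lemma correlation:
  assumes "distinct3 a b c"
  obtains \<rho> where "\<bar>\<rho>\<bar> \<le> 1 - 4 * \<beta>" "6 * \<beta> \<le> 1"
    "\<And>\<phi> \<psi>. expect (profile_pmf n \<mu>) (\<lambda>\<sigma>. \<phi> (votes n a b \<sigma>) * \<psi> (votes n b c \<sigma>))
      = cube_mean I (\<lambda>x. \<phi> x * noise \<rho> I \<psi> x)"
proof -
  have abc: "a < k" "b < k" "c < k" "a \<noteq> b" "b \<noteq> c" "a \<noteq> c" using assms by auto
  obtain \<rho> where \<rho>: "\<bar>\<rho>\<bar> \<le> 1 - 4 * \<beta>" "6 * \<beta> \<le> 1"
    and pr: "measure_pmf.prob \<mu> {s. (a, b) \<in> s \<and> (b, c) \<in> s} = (1 + \<rho>) / 4"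
    "measure_pmf.prob \<mu> {s. (a, b) \<notin> s \<and> (b, c) \<notin> s} = (1 + \<rho>) / 4"
    "measure_pmf.prob \<mu> {s. (a, b) \<in> s \<and> (b, c) \<notin> s} = (1 - \<rho>) / 4"
    "measure_pmf.prob \<mu> {s. (a, b) \<notin> s \<and> (b, c) \<in> s} = (1 - \<rho>) / 4"
    by (rule pair_correlation[OF supp sym triple less_imp_le[OF \<beta>0] abc])
  show ?thesis
    by (rule that[OF \<rho>]) (unfold profile_pmf_def votes_def, rule Pi_pmf_cube_law[OF finite_lessThan fin_\<mu> pr])
qed

lemma \<beta>6: "6 * \<beta> \<le> 1"
proof -
  have "distinct3 0 1 2" using k3 by simp
  then show ?thesis by (rule correlation)
qed

lemma \<epsilon>_small: "324 * \<epsilon> < 1"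
proof -
  have "\<beta>\<^sup>2 \<le> (1/6)\<^sup>2" using \<beta>6 \<beta>0 by (intro power_mono) auto
  then show ?thesis using \<epsilon>\<beta> by (simp add: power2_eq_square)
qed

lemma \<epsilon>_small_\<beta>: "54 * \<epsilon> < \<beta>"
proof -
  have "\<beta> * \<beta> \<le> \<beta> * (1/6)" using \<beta>6 \<beta>0 by (intro mult_left_mono) auto
  then show ?thesis using \<epsilon>\<beta> by (simp add: power2_eq_square)
qed

lemma n0: "0 < n"
proof (rule ccontr)
  assume "\<not> 0 < n"
  then have "nontransitive_prob n \<mu> F < 0" using small by (simp add: power_int_def)
  then show False by (simp add: nontransitive_prob_def not_less[symmetric])
qed

lemma n3: "real n powi (-3) = 1 / real n ^ 3"
  by (simp add: power_int_def field_simps)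

lemma nontransitive_less: "nontransitive_prob n \<mu> F < \<epsilon>"
proof -
  have m: "3 \<le> 1 / (2 * \<beta>)" using \<beta>6 \<beta>0 by (simp add: field_simps)
  have "\<epsilon> powr (1 / (2 * \<beta>)) \<le> \<epsilon> powr 1"
    using \<epsilon>0 \<epsilon>_small m by (intro powr_mono') auto
  then have e: "\<epsilon> powr (1 / (2 * \<beta>)) \<le> \<epsilon>" using \<epsilon>0 by simp
  have "real n powi (-3) \<le> 1" using n0 by (simp add: n3 power_le_one_iff)
  moreover have "\<beta>\<^sup>2 \<le> 1" using \<beta>6 \<beta>0 by (intro power_le_one) auto
  ultimately have "\<beta>\<^sup>2 * \<epsilon> powr (1 / (2 * \<beta>)) * real n powi (-3) \<le> 1 * \<epsilon> * 1"
    using e \<epsilon>0 by (intro mult_mono) (auto simp: n3)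
  then show ?thesis using small by simp
qed

lemma Pr_mono: "(\<And>\<sigma>. \<sigma> \<in> profiles k n \<Longrightarrow> P \<sigma> \<Longrightarrow> Q \<sigma>) \<Longrightarrow> Pr P \<le> Pr Q"
  using set_profile_pmf[OF supp, of n]
  by (intro measure_pmf.finite_measure_mono_AE) (auto simp: AE_measure_pmf_iff)

lemma Pr_disj: "Pr (\<lambda>\<sigma>. P \<sigma> \<or> Q \<sigma>) \<le> Pr P + Pr Q"
  unfolding Collect_disj_eq by (rule measure_Un_le) auto

lemma third_alternative:
  assumes "a < k" "b < k"
  obtains c where "c < k" "c \<noteq> a" "c \<noteq> b"
proof -
  have "card {a, b} < card {..<k}" using k3 by (auto simp: card_insert_if)
  then have "\<not> {..<k} \<subseteq> {a, b}" using card_mono[of "{a, b}" "{..<k}"] by auto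
  then show ?thesis using that by auto
qed

lemma Pr_votes:
  assumes "a < k" "b < k" "a \<noteq> b"
  shows "Pr (\<lambda>\<sigma>. P (votes n a b \<sigma>)) = cube_mean I (\<lambda>x. of_bool (P x))"
proof -
  obtain c where c: "c < k" "c \<noteq> a" "c \<noteq> b" by (rule third_alternative[OF assms(1,2)])
  have abc: "distinct3 a b c" using c assms by simp
  obtain \<rho> where law: "\<And>\<phi> \<psi>. expect (profile_pmf n \<mu>) (\<lambda>\<sigma>. \<phi> (votes n a b \<sigma>) * \<psi> (votes n b c \<sigma>))
      = cube_mean I (\<lambda>x. \<phi> x * noise \<rho> I \<psi> x)"
    by (rule correlation[OF abc]) (rule that)
  have "Pr (\<lambda>\<sigma>. P (votes n a b \<sigma>)) = expect (profile_pmf n \<mu>) (\<lambda>\<sigma>. of_bool (P (votes n a b \<sigma>)) * 1)"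
    by (simp add: prob_eq_expectation)
  also have "\<dots> = cube_mean I (\<lambda>x. of_bool (P x) * noise \<rho> I (\<lambda>_. 1) x)"
    by (rule law[of "\<lambda>x. of_bool (P x)" "\<lambda>_. 1"])
  also have "\<dots> = cube_mean I (\<lambda>x. of_bool (P x))"
    by (intro cube_mean_cong) (simp add: noise_const)
  finally show ?thesis .
qed

text \<open>
  Otherwise the sum in \<open>joint_pivotality_lower_bound\<close> is at least \<open>\<epsilon>\<^sup>m\<close> with \<open>m = 1/(2\<beta>)\<close>, while
  it has at most \<open>n\<^sup>2\<close> terms, each smaller than \<open>\<epsilon>\<^sup>m / n\<^sup>3\<close>. Disjointness guarantees that the two
  pivotal voters differ.
\<close>

lemma no_disjoint_influence:
  assumes abc: "distinct3 a b c" and UV: "U \<subseteq> I" "W \<subseteq> I" "U \<inter> W = {}"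
  shows "V U a b < 3 * \<epsilon> / 2 \<or> V W b c < 3 * \<epsilon> / 2"
proof (rule ccontr)
  assume neg: "\<not> ?thesis"
  define m where "m = 1 / (2 * \<beta>)"
  obtain \<rho> where \<rho>: "\<bar>\<rho>\<bar> \<le> 1 - 4 * \<beta>"
    and law: "\<And>\<phi> \<psi>. expect (profile_pmf n \<mu>) (\<lambda>\<sigma>. \<phi> (votes n a b \<sigma>) * \<psi> (votes n b c \<sigma>))
      = cube_mean I (\<lambda>x. \<phi> x * noise \<rho> I \<psi> x)"
    by (rule correlation[OF abc]) (rule that)
  have m: "3 \<le> m" using \<beta>6 \<beta>0 by (simp add: m_def field_simps)
  have \<rho>': "\<bar>\<rho>\<bar> \<le> 1 - 2 / m" using \<rho> by (simp add: m_def)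
  define N where "N = nontransitive_prob n \<mu> F / \<beta>\<^sup>2"
  have N0: "0 \<le> N" by (simp add: N_def nontransitive_prob_def)
  have term_le: "joint_pivotality \<rho> I i (f a b) j (f b c) \<le> N"
    if "i \<in> U" "j \<in> W" for i j
  proof -
    have ij: "i < n" "j < n" "i \<noteq> j" using that UV by auto
    have "joint_pivotality \<rho> I i (f a b) j (f b c)
      = expect (profile_pmf n \<mu>) (\<lambda>\<sigma>. of_bool (pivotal i (f a b) (votes n a b \<sigma>)) * of_bool (pivotal j (f b c) (votes n b c \<sigma>)))"
      unfolding joint_pivotality_def by (rule law[symmetric])
    also have "\<dots> = Pr (\<lambda>\<sigma>. pivotal i (f a b) (votes n a b \<sigma>) \<and> pivotal j (f b c) (votes n b c \<sigma>))"
      by (simp add: prob_eq_expectation of_bool_conj)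
    also have "\<dots> \<le> N"
      using nontransitive_prob_ge_pivotal[OF F iia supp triple less_imp_le[OF \<beta>0], of a b c i j] abc ij \<beta>0
      by (simp add: N_def field_simps)
    finally show ?thesis .
  qed
  have "\<epsilon> powr m \<le> (2/3 * sqrt (V U a b * V W b c)) powr m"
  proof (rule powr_mono2)
    have "3 * \<epsilon> / 2 * (3 * \<epsilon> / 2) \<le> V U a b * V W b c" using neg \<epsilon>0 by (intro mult_mono) auto
    then have "sqrt ((3 * \<epsilon> / 2)\<^sup>2) \<le> sqrt (V U a b * V W b c)"
      by (simp add: power2_eq_square)
    then show "\<epsilon> \<le> 2/3 * sqrt (V U a b * V W b c)" using \<epsilon>0 by simp
  qed (use m \<epsilon>0 in auto)
  also have "\<dots> \<le> (\<Sum>i\<in>U. \<Sum>j\<in>W. joint_pivotality \<rho> I i (f a b) j (f b c))"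
    using m by (intro joint_pivotality_lower_bound UV \<rho>') auto
  also have "\<dots> \<le> (\<Sum>i\<in>U. \<Sum>j\<in>W. N)"
    by (intro sum_mono term_le)
  also have "\<dots> = real (card U) * real (card W) * N" by simp
  also have "\<dots> \<le> real n * real n * N"
    using card_mono[OF _ UV(1)] card_mono[OF _ UV(2)] N0 by (intro mult_right_mono mult_mono) auto
  also have "\<dots> < real n * real n * (\<epsilon> powr m * real n powi (-3))"
  proof (rule mult_strict_left_mono)
    show "N < \<epsilon> powr m * real n powi (-3)"
      using small \<beta>0 by (simp add: N_def m_def field_simps)
  qed (use n0 in auto)
  also have "\<dots> = \<epsilon> powr m / real n"
    using n0 by (simp add: n3 field_simps power3_eq_cube)
  also have "\<dots> \<le> \<epsilon> powr m" using n0 mult_left_mono[of 1 "real n" "\<epsilon> powr m"] by (simp add: field_simps)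
  finally show False by simp
qed

lemma pair_rule_reverse:
  assumes ab: "a < k" "b < k" "a \<noteq> b" and X: "X \<subseteq> I"
  shows "f b a (I - X) \<longleftrightarrow> \<not> f a b X"
proof -
  have ex: "\<exists>s\<in>rankings k. (x, y) \<in> s" if "x < k" "y < k" "x \<noteq> y" for x y
  proof -
    obtain c where c: "c < k" "c \<noteq> x" "c \<noteq> y" by (rule third_alternative[OF \<open>x < k\<close> \<open>y < k\<close>])
    then have "\<beta> \<le> measure_pmf.prob \<mu> {s. (x, y) \<in> s \<and> (y, c) \<in> s}"
      using triple that unfolding triple_bound_def by simp
    then have "0 < measure_pmf.prob \<mu> {s. (x, y) \<in> s \<and> (y, c) \<in> s}" using \<beta>0 by linarith
    then have "{s \<in> rankings k. (x, y) \<in> s \<and> (y, c) \<in> s} \<noteq> {}"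
      unfolding prob_eq_sum[OF supp] by (intro notI) simp
    then show ?thesis by auto
  qed
  obtain r1 where r1: "r1 \<in> rankings k" "(a, b) \<in> r1" using ex[OF ab] by blast
  obtain r2 where r2: "r2 \<in> rankings k" "(b, a) \<in> r2" using ex[OF ab(2,1) not_sym[OF ab(3)]] by blast
  define \<sigma> where "\<sigma> = (\<lambda>i\<in>I. if i \<in> X then r1 else r2)"
  have \<sigma>: "\<sigma> \<in> profiles k n" using r1 r2 by (auto simp: \<sigma>_def profiles_def)
  have v: "votes n a b \<sigma> = X" "votes n b a \<sigma> = I - X"
    using X r1(2) r2(2) rankingsD(2)[OF r1] rankingsD(2)[OF r2]
    by (auto simp: votes_def \<sigma>_def split: if_splits)
  have "F \<sigma> \<in> strict_preferences k" using F \<sigma> by (auto simp: constitutions_def)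
  then have as: "asym (F \<sigma>)" and tot: "total_on {..<k} (F \<sigma>)" by (auto simp: strict_preferences_def)
  have "(b, a) \<in> F \<sigma> \<longleftrightarrow> (a, b) \<notin> F \<sigma>"
    using ab tot asymD[OF as, of a b] asymD[OF as, of b a] by (auto simp: total_on_def)
  then show ?thesis
    using pair_rule_votes[OF iia ab \<sigma>] pair_rule_votes[OF iia ab(2,1) not_sym[OF ab(3)] \<sigma>] v by simp
qed

lemma V_sym: "a < k \<Longrightarrow> b < k \<Longrightarrow> a \<noteq> b \<Longrightarrow> U \<subseteq> I \<Longrightarrow> V U b a = V U a b"
  by (rule block_variance_complement) (auto simp: pair_rule_reverse)

lemma \<theta>_sym:
  assumes "a < k" "b < k" "a \<noteq> b"
  shows "\<theta> b a = 1 - \<theta> a b"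
proof -
  have "\<theta> b a = cube_mean I (\<lambda>x. of_bool (f b a (I - x)))" by (rule cube_mean_complement[symmetric])
  also have "\<dots> = cube_mean I (\<lambda>x. 1 - of_bool (f a b x))"
    using assms by (intro cube_mean_cong) (simp add: pair_rule_reverse of_bool_not_iff)
  finally show ?thesis by (simp add: cube_mean_diff cube_mean_const)
qed

lemma \<theta>_bounds: "0 \<le> \<theta> a b" "\<theta> a b \<le> 1"
  by (rule cube_mean_of_bool_bounds, simp)+

text \<open>
  The threshold \<open>9\<epsilon>\<close> exceeds the bound \<open>23\<epsilon>/3\<close> that \<open>two_near_const\<close> obtains for the third pair,
  and pairs beyond it have variance at least \<open>6\<epsilon>\<close>.
\<close>

definition near_const :: "nat \<Rightarrow> nat \<Rightarrow> bool" where
  "near_const a b \<longleftrightarrow> \<theta> a b < 9 * \<epsilon> \<or> 1 - \<theta> a b < 9 * \<epsilon>"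

text \<open>
  The constant \<open>6\<close> is chosen for \<open>voter_unique\<close>.
\<close>

lemma V_ge: "\<not> near_const a b \<Longrightarrow> 6 * \<epsilon> \<le> V I a b"
proof -
  assume "\<not> near_const a b"
  then have t: "9 * \<epsilon> \<le> \<theta> a b" "\<theta> a b \<le> 1 - 9 * \<epsilon>" by (auto simp: near_const_def)
  then have "0 \<le> (\<theta> a b - 9 * \<epsilon>) * (1 - 9 * \<epsilon> - \<theta> a b)" by (intro mult_nonneg_nonneg) auto
  then have "9 * \<epsilon> * (1 - 9 * \<epsilon>) \<le> \<theta> a b * (1 - \<theta> a b)" by (simp add: algebra_simps)
  moreover have "9 * \<epsilon> * (2/3) \<le> 9 * \<epsilon> * (1 - 9 * \<epsilon>)" using \<epsilon>_small \<epsilon>0 by (intro mult_left_mono) auto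
  ultimately show ?thesis unfolding block_variance_whole by linarith
qed

end

context near_transitive_rule
begin

text \<open>
  This is \<open>block_variance_split\<close> with \<open>\<kappa> = 3\<epsilon>/2\<close>.
\<close>

lemma common_voter:
  assumes abc: "distinct3 a b c" and "\<not> near_const b c"
  shows "V I a b < 3 * \<epsilon> \<or> (\<exists>t<n. V (I - {t}) a b < 3 * \<epsilon> \<and> V (I - {t}) b c < 3 * \<epsilon>)"
proof (rule disjCI)
  assume "\<not> (\<exists>t<n. V (I - {t}) a b < 3 * \<epsilon> \<and> V (I - {t}) b c < 3 * \<epsilon>)"
  then have no_t: False if "t < n" "V (I - {t}) a b < 2 * (3 * \<epsilon> / 2)" "V (I - {t}) b c < 2 * (3 * \<epsilon> / 2)" for t
    using that by simp
  show "V I a b < 3 * \<epsilon>"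
  proof (rule ccontr)
    assume "\<not> V I a b < 3 * \<epsilon>"
    then have 1: "2 * (3 * \<epsilon> / 2) \<le> V I a b" by simp
    have 2: "3 * (3 * \<epsilon> / 2) \<le> V I b c" using V_ge[OF assms(2)] \<epsilon>0 by simp
    have 0: "0 < 3 * \<epsilon> / 2" using \<epsilon>0 by simp
    show False
      by (rule block_variance_split[OF 0 no_disjoint_influence[OF abc] 1 2]) (use no_t in auto)
  qed
qed

lemma common_voter':
  assumes abc: "distinct3 a b c" and "\<not> near_const a b"
  shows "V I b c < 3 * \<epsilon> \<or> (\<exists>t<n. V (I - {t}) a b < 3 * \<epsilon> \<and> V (I - {t}) b c < 3 * \<epsilon>)"
proof -
  have cba: "distinct3 c b a" using abc by auto
  have V: "V U c b = V U b c" "V U b a = V U a b" if "U \<subseteq> I" for U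
    using V_sym[OF _ _ _ that] abc by auto
  have nc: "\<not> near_const b a" using assms \<theta>_sym[of a b] by (auto simp: near_const_def)
  show ?thesis using common_voter[OF cba nc] by (auto simp: V)
qed

text \<open>
  Two such voters would make the total variance less than \<open>6\<epsilon>\<close>.
\<close>

lemma voter_unique:
  assumes "\<not> near_const a b" "t < n" "t' < n" "V (I - {t}) a b < 3 * \<epsilon>" "V (I - {t'}) a b < 3 * \<epsilon>"
  shows "t = t'"
proof (rule ccontr)
  assume "t \<noteq> t'"
  have "V ((I - {t}) \<union> {t}) a b \<le> V (I - {t}) a b + V {t} a b"
    using assms by (intro block_variance_subadditive) auto
  moreover have "(I - {t}) \<union> {t} = I" using assms by auto
  moreover have "V {t} a b \<le> V (I - {t'}) a b"
    using assms \<open>t \<noteq> t'\<close> by (intro block_variance_mono) auto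
  ultimately show False using assms V_ge[OF assms(1)] by simp
qed

definition mean_given_vote :: "nat \<Rightarrow> nat \<Rightarrow> nat \<Rightarrow> bool \<Rightarrow> real" where
  "mean_given_vote t a b y = cube_mean (I - {t}) (\<lambda>u. of_bool (f a b ((if y then {t} else {}) \<union> u)))"

lemma mean_given_vote_bounds: "0 \<le> mean_given_vote t a b y" "mean_given_vote t a b y \<le> 1"
  unfolding mean_given_vote_def by (rule cube_mean_of_bool_bounds, simp)+

lemma cube_mean_halves:
  assumes "t < n"
  shows "cube_mean I \<phi> = (cube_mean (I - {t}) \<phi> + cube_mean (I - {t}) (\<lambda>u. \<phi> (insert t u))) / 2"
  using cube_mean_insert[of "I - {t}" t \<phi>] assms by (simp add: insert_absorb)

lemma \<theta>_halves: "t < n \<Longrightarrow> \<theta> a b = (mean_given_vote t a b False + mean_given_vote t a b True) / 2"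
  by (simp add: cube_mean_halves mean_given_vote_def)

lemma V_halves:
  assumes "t < n"
  shows "V (I - {t}) a b = (mean_given_vote t a b False * (1 - mean_given_vote t a b False) + mean_given_vote t a b True * (1 - mean_given_vote t a b True)) / 2"
proof -
  have "I - (I - {t}) = {t}" using assms by auto
  then show ?thesis by (simp add: block_variance_def cube_mean_singleton mean_given_vote_def)
qed

text \<open>
  A function that is rarely true cannot depend much on a single voter: the two variances differ
  by \<open>(p - q)\<^sup>2 / 4\<close>, with \<open>p\<close>, \<open>q\<close> the conditional means, and this is at most \<open>((p + q) / 2)\<^sup>2\<close>.
\<close>

lemma V_le_halves:
  assumes "t < n"
  shows "V I a b \<le> V (I - {t}) a b + (\<theta> a b)\<^sup>2"
proof -
  let ?p = "mean_given_vote t a b False" and ?q = "mean_given_vote t a b True"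
  have "0 \<le> ?p * ?q" using mean_given_vote_bounds by simp
  then have "(?p - ?q)\<^sup>2 / 4 \<le> ((?p + ?q) / 2)\<^sup>2" by (simp add: power2_eq_square field_simps)
  then show ?thesis
    unfolding block_variance_whole V_halves[OF assms] \<theta>_halves[OF assms]
    by (simp add: power2_eq_square field_simps)
qed

lemma not_transitive_of_cycle:
  assumes "distinct3 a b c" "\<sigma> \<in> profiles k n"
    "f a b (votes n a b \<sigma>)" "f b c (votes n b c \<sigma>)" "f c a (votes n c a \<sigma>)"
  shows "\<not> trans (F \<sigma>)"
proof
  assume tr: "trans (F \<sigma>)"
  have e: "(a, b) \<in> F \<sigma>" "(b, c) \<in> F \<sigma>" "(c, a) \<in> F \<sigma>"
    using assms pair_rule_votes[OF iia _ _ _ assms(2)] by auto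
  have "asym (F \<sigma>)" using F assms(2) by (auto simp: constitutions_def strict_preferences_def)
  then show False using transD[OF tr e(1,2)] e(3) by (meson asymD)
qed

lemma chain_bound:
  assumes "distinct3 a b c"
  shows "\<theta> c a \<le> \<epsilon> + (1 - \<theta> a b) + (1 - \<theta> b c)"
proof -
  have neg: "Pr (\<lambda>\<sigma>. \<not> f x y (votes n x y \<sigma>)) = 1 - \<theta> x y" if "x < k" "y < k" "x \<noteq> y" for x y
    unfolding Pr_votes[OF that, of "\<lambda>X. \<not> f x y X"] of_bool_not_iff by (simp add: cube_mean_diff cube_mean_const)
  have "\<theta> c a = Pr (\<lambda>\<sigma>. f c a (votes n c a \<sigma>))" using assms by (intro Pr_votes[symmetric]) auto
  also have "\<dots> \<le> Pr (\<lambda>\<sigma>. \<not> trans (F \<sigma>) \<or> (\<not> f a b (votes n a b \<sigma>) \<or> \<not> f b c (votes n b c \<sigma>)))"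
    using not_transitive_of_cycle[OF assms] by (intro Pr_mono) blast
  also have "\<dots> \<le> Pr (\<lambda>\<sigma>. \<not> trans (F \<sigma>)) + (Pr (\<lambda>\<sigma>. \<not> f a b (votes n a b \<sigma>)) + Pr (\<lambda>\<sigma>. \<not> f b c (votes n b c \<sigma>)))"
    by (intro order_trans[OF Pr_disj] add_left_mono Pr_disj)
  also have "Pr (\<lambda>\<sigma>. \<not> trans (F \<sigma>)) \<le> \<epsilon>"
    using nontransitive_less by (simp add: nontransitive_prob_def)
  finally show ?thesis using neg[of a b] neg[of b c] assms by simp
qed

text \<open>
  The obvious bound for \<open>\<theta> c a\<close> is \<open>19\<epsilon>\<close>. Suppose \<open>\<theta> c a \<ge> 9\<epsilon>\<close>. Being rare, \<open>f\<^sub>c\<^sub>a\<close> is not nearly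
  decided by one voter, so \<open>common_voter\<close> applied to \<open>f\<^sub>c\<^sub>a\<close> and each neighbouring pair improves the
  neighbour's distance from a constant from \<open>9\<epsilon>\<close> to \<open>10\<epsilon>/3\<close>; then \<open>\<theta> c a \<le> 23\<epsilon>/3\<close>.
\<close>

lemma two_near_const:
  assumes abc: "distinct3 a b c" and ab: "1 - \<theta> a b < 9 * \<epsilon>" and bc: "1 - \<theta> b c < 9 * \<epsilon>"
  shows "\<theta> c a < 9 * \<epsilon>"
proof (rule ccontr)
  assume big: "\<not> \<theta> c a < 9 * \<epsilon>"
  have t19: "\<theta> c a \<le> 19 * \<epsilon>" using chain_bound[OF abc] ab bc by simp
  have nc: "\<not> near_const c a" using big t19 \<epsilon>_small by (auto simp: near_const_def)
  have cab: "distinct3 c a b" and bca: "distinct3 b c a" using abc by auto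
  have no_t: False if "t < n" "V (I - {t}) c a < 3 * \<epsilon>" for t
  proof -
    have "(\<theta> c a)\<^sup>2 \<le> (19 * \<epsilon>)\<^sup>2" using t19 \<theta>_bounds by (intro power_mono) auto
    also have "\<dots> = (361 * \<epsilon>) * \<epsilon>" by (simp add: power2_eq_square)
    also have "\<dots> \<le> 3 * \<epsilon>" using \<epsilon>_small \<epsilon>0 by (intro mult_right_mono) auto
    finally show False using V_le_halves[OF that(1), of c a] that(2) V_ge[OF nc] by simp
  qed
  have small: "1 - \<theta> x y \<le> 10/3 * \<epsilon>" if "1 - \<theta> x y < 9 * \<epsilon>" "V I x y < 3 * \<epsilon>" for x y
  proof -
    have "(1 - \<theta> x y) * (9/10) \<le> (1 - \<theta> x y) * \<theta> x y"
      using that \<epsilon>_small \<theta>_bounds[of x y] by (intro mult_left_mono) auto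
    then show ?thesis using that by (simp add: block_variance_whole mult.commute)
  qed
  have "V I a b < 3 * \<epsilon>" using common_voter'[OF cab nc] no_t by blast
  moreover have "V I b c < 3 * \<epsilon>" using common_voter[OF bca nc] no_t by blast
  ultimately have "\<theta> c a \<le> \<epsilon> + 10/3 * \<epsilon> + 10/3 * \<epsilon>"
    using chain_bound[OF abc] small[OF ab] small[OF bc] by linarith
  then show False using big \<epsilon>0 by linarith
qed

end

section \<open>Rounding to a transitive constitution\<close>

context near_transitive_rule
begin

definition near_dictated :: "nat \<Rightarrow> nat \<Rightarrow> bool" where
  "near_dictated a b \<longleftrightarrow> (\<exists>t<n. V (I - {t}) a b < 3 * \<epsilon>)"

text \<open>
  Meaningful if \<open>near_dictated a b\<close>; unique if moreover the pair is not \<open>near_const\<close>.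
\<close>

definition voter :: "nat \<Rightarrow> nat \<Rightarrow> nat" where
  "voter a b = (SOME t. t < n \<and> V (I - {t}) a b < 3 * \<epsilon>)"

text \<open>
  In the last case every pair sharing exactly one alternative with \<open>a, b\<close> is nearly constant, and
  \<open>f\<^sub>a\<^sub>b\<close> may stay as it is.
\<close>

definition rounded :: "nat \<Rightarrow> nat \<Rightarrow> nat set \<Rightarrow> bool" where
  "rounded a b X \<longleftrightarrow>
     (if near_const a b then 1/2 < \<theta> a b
      else if near_dictated a b then 1/2 < mean_given_vote (voter a b) a b (voter a b \<in> X)
      else f a b X)"

lemma voter: "near_dictated a b \<Longrightarrow> voter a b < n \<and> V (I - {voter a b}) a b < 3 * \<epsilon>"
  unfolding near_dictated_def voter_def by (rule someI_ex)

lemma sym_facts: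
  assumes "a < k" "b < k" "a \<noteq> b"
  shows "near_const b a \<longleftrightarrow> near_const a b" "near_dictated b a \<longleftrightarrow> near_dictated a b" "voter b a = voter a b"
proof -
  show "near_const b a \<longleftrightarrow> near_const a b"
    using \<theta>_sym[OF assms] by (auto simp: near_const_def)
  have "V (I - {t}) b a = V (I - {t}) a b" for t by (rule V_sym[OF assms]) auto
  then show "near_dictated b a \<longleftrightarrow> near_dictated a b" "voter b a = voter a b"
    by (simp_all add: near_dictated_def voter_def)
qed

lemma mean_given_vote_reverse:
  assumes "a < k" "b < k" "a \<noteq> b" "t < n"
  shows "mean_given_vote t b a (\<not> y) = 1 - mean_given_vote t a b y"
proof -
  let ?s = "\<lambda>y. if y then {t} else {}"
  have "mean_given_vote t b a (\<not> y) = cube_mean (I - {t}) (\<lambda>u. of_bool (f b a (?s (\<not> y) \<union> ((I - {t}) - u))))"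
    unfolding mean_given_vote_def by (rule cube_mean_complement[symmetric])
  also have "\<dots> = cube_mean (I - {t}) (\<lambda>u. 1 - of_bool (f a b (?s y \<union> u)))"
  proof (rule cube_mean_cong)
    fix u assume u: "u \<subseteq> I - {t}"
    then have "?s (\<not> y) \<union> ((I - {t}) - u) = I - (?s y \<union> u)" "?s y \<union> u \<subseteq> I" using assms(4) by auto
    then show "of_bool (f b a (?s (\<not> y) \<union> ((I - {t}) - u))) = 1 - (of_bool (f a b (?s y \<union> u)) :: real)"
      using pair_rule_reverse[OF assms(1-3), of "?s y \<union> u"] by (simp only: of_bool_not_iff)
  qed
  finally show ?thesis by (simp add: mean_given_vote_def cube_mean_diff cube_mean_const)
qed

lemma mean_given_vote_not_half:
  assumes "t < n" "V (I - {t}) a b < 3 * \<epsilon>"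
  shows "mean_given_vote t a b y \<noteq> 1/2"
proof
  assume h: "mean_given_vote t a b y = 1/2"
  have "0 \<le> mean_given_vote t a b z * (1 - mean_given_vote t a b z)" for z
    using mean_given_vote_bounds by (intro mult_nonneg_nonneg) auto
  from this[of False] this[of True] have "mean_given_vote t a b y * (1 - mean_given_vote t a b y) / 2 \<le> V (I - {t}) a b"
    unfolding V_halves[OF assms(1)] by (cases y) simp_all
  then have "1/8 \<le> V (I - {t}) a b" unfolding h by simp
  then show False using assms(2) \<epsilon>_small by simp
qed

lemma rounded_reverse:
  assumes ab: "a < k" "b < k" "a \<noteq> b" and X: "X \<subseteq> I"
  shows "rounded b a (I - X) \<longleftrightarrow> \<not> rounded a b X"
proof -
  consider "near_const a b" | "\<not> near_const a b" "near_dictated a b" | "\<not> near_const a b" "\<not> near_dictated a b"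
    by blast
  then show ?thesis
  proof cases
    case 1
    then have "\<theta> a b \<noteq> 1/2" using \<epsilon>_small by (auto simp: near_const_def)
    then show ?thesis using 1 \<theta>_sym[OF ab] by (auto simp: rounded_def sym_facts[OF ab])
  next
    case 2
    note t = voter[OF 2(2)]
    have "(voter a b \<in> I - X) = (\<not> voter a b \<in> X)" using t by simp
    then have "rounded b a (I - X) \<longleftrightarrow> 1/2 < mean_given_vote (voter a b) b a (\<not> voter a b \<in> X)"
      using 2 by (simp add: rounded_def sym_facts[OF ab])
    also have "\<dots> \<longleftrightarrow> \<not> 1/2 < mean_given_vote (voter a b) a b (voter a b \<in> X)"
      using mean_given_vote_not_half[of "voter a b" a b "voter a b \<in> X"] t
      unfolding mean_given_vote_reverse[OF ab conjunct1[OF t]] by auto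
    finally show ?thesis using 2 by (simp add: rounded_def)
  next
    case 3
    then show ?thesis using pair_rule_reverse[OF ab X] by (simp add: rounded_def sym_facts[OF ab])
  qed
qed

lemma mean_ne_const:
  assumes "finite J"
  shows "cube_mean J (\<lambda>x. of_bool (P x \<noteq> c)) = (if c then 1 - cube_mean J (\<lambda>x. of_bool (P x)) else cube_mean J (\<lambda>x. of_bool (P x)))"
  using assms by (auto simp: of_bool_not_iff cube_mean_diff cube_mean_const)

lemma rounded_close: "cube_mean I (\<lambda>x. of_bool (f a b x \<noteq> rounded a b x)) \<le> 9 * \<epsilon>"
proof -
  consider "near_const a b" | "\<not> near_const a b" "near_dictated a b" | "\<not> near_const a b" "\<not> near_dictated a b"
    by blast
  then show ?thesis
  proof cases
    case 1
    then have "(\<lambda>x. of_bool (f a b x \<noteq> rounded a b x)) = (\<lambda>x. of_bool (f a b x \<noteq> (1/2 < \<theta> a b)) :: real)"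
      by (simp add: rounded_def)
    then have "cube_mean I (\<lambda>x. of_bool (f a b x \<noteq> rounded a b x)) = (if 1/2 < \<theta> a b then 1 - \<theta> a b else \<theta> a b)"
      by (simp only: mean_ne_const finite_lessThan)
    then show ?thesis using 1 \<epsilon>_small by (auto simp: near_const_def)
  next
    case 2
    define t where "t = voter a b"
    have t: "t < n" "V (I - {t}) a b < 3 * \<epsilon>" using voter[OF 2(2)] by (auto simp: t_def)
    let ?h = "mean_given_vote t a b" and ?s = "\<lambda>y u. (if y then {t} else {}) \<union> u"
    have r: "rounded a b x = (1/2 < ?h (t \<in> x))" for x using 2 by (simp add: rounded_def t_def)
    have half: "cube_mean (I - {t}) (\<lambda>u. of_bool (f a b (?s y u) \<noteq> rounded a b (?s y u)))
      \<le> 2 * (?h y * (1 - ?h y))" for y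
    proof -
      have "cube_mean (I - {t}) (\<lambda>u. of_bool (f a b (?s y u) \<noteq> rounded a b (?s y u)))
        = cube_mean (I - {t}) (\<lambda>u. of_bool (f a b (?s y u) \<noteq> (1/2 < ?h y)))"
      proof (rule cube_mean_cong)
        fix u assume "u \<subseteq> I - {t}"
        then have "(t \<in> ?s y u) = y" by auto
        then show "of_bool (f a b (?s y u) \<noteq> rounded a b (?s y u))
          = (of_bool (f a b (?s y u) \<noteq> (1/2 < ?h y)) :: real)" by (simp only: r)
      qed
      also have "\<dots> = (if 1/2 < ?h y then 1 - ?h y else ?h y)"
        unfolding mean_given_vote_def by (subst mean_ne_const) auto
      also have "\<dots> = min (?h y) (1 - ?h y)" by auto
      also have "\<dots> \<le> 2 * (?h y * (1 - ?h y))" by (rule small_min_of_product) (rule mean_given_vote_bounds)+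
      finally show ?thesis .
    qed
    have "cube_mean I (\<lambda>x. of_bool (f a b x \<noteq> rounded a b x)) \<le> 2 * V (I - {t}) a b"
      unfolding cube_mean_halves[OF t(1)] V_halves[OF t(1)] using half[of True] half[of False] by simp
    then show ?thesis using t(2) \<epsilon>0 by simp
  next
    case 3
    then have "(\<lambda>x. of_bool (f a b x \<noteq> rounded a b x)) = (\<lambda>_. 0 :: real)" by (simp add: rounded_def)
    then show ?thesis using \<epsilon>0 by (simp add: cube_mean_const)
  qed
qed

lemma Pr_rounded:
  assumes "a < k" "b < k" "a \<noteq> b"
  shows "Pr (\<lambda>\<sigma>. f a b (votes n a b \<sigma>) \<noteq> rounded a b (votes n a b \<sigma>)) \<le> 9 * \<epsilon>"
  unfolding Pr_votes[OF assms, of "\<lambda>X. f a b X \<noteq> rounded a b X"] by (rule rounded_close)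

lemma ranking_order:
  assumes "s \<in> rankings k" "distinct3 a b c"
  obtains x y z where "{x, y, z} = {a, b, c}" "(x, y) \<in> s" "(y, z) \<in> s"
proof -
  consider "(a, b) \<in> s" "(b, c) \<in> s" | "(a, c) \<in> s" "(c, b) \<in> s" | "(b, a) \<in> s" "(a, c) \<in> s"
    | "(b, c) \<in> s" "(c, a) \<in> s" | "(c, a) \<in> s" "(a, b) \<in> s" | "(c, b) \<in> s" "(b, a) \<in> s"
    using order_exists[OF assms(1), of a b c] assms(2) by blast
  then show ?thesis
  proof cases
    case 1 then show ?thesis by (intro that[of a b c]) auto
  next
    case 2 then show ?thesis by (intro that[of a c b]) auto
  next
    case 3 then show ?thesis by (intro that[of b a c]) auto
  next
    case 4 then show ?thesis by (intro that[of b c a]) auto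
  next
    case 5 then show ?thesis by (intro that[of c a b]) auto
  next
    case 6 then show ?thesis by (intro that[of c b a]) auto
  qed
qed

lemma same_order_same_bits:
  assumes s: "s \<in> rankings k" "(x, y) \<in> s" "(y, z) \<in> s" and s': "s' \<in> rankings k" "(x, y) \<in> s'" "(y, z) \<in> s'"
    and uv: "u \<in> {x, y, z}" "v \<in> {x, y, z}"
  shows "(u, v) \<in> s \<longleftrightarrow> (u, v) \<in> s'"
proof -
  have irr: "(w, w) \<notin> r" if "r \<in> rankings k" for w r using rankingsD(2)[OF that, of w w] by blast
  show ?thesis
    using uv ranking_order_bits[OF s] ranking_order_bits[OF s'] irr[OF s(1)] irr[OF s'(1)]
    by (elim insertE emptyE) simp_all
qed

lemma voter_eq:
  assumes "\<not> near_const a b" "t < n" "V (I - {t}) a b < 3 * \<epsilon>"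
  shows "near_dictated a b" "voter a b = t"
proof -
  show d: "near_dictated a b" using assms by (auto simp: near_dictated_def)
  show "voter a b = t"
    by (rule voter_unique[OF assms(1) conjunct1[OF voter[OF d]] assms(2) conjunct2[OF voter[OF d]] assms(3)])
qed

text \<open>
  The pairs \<open>a, b\<close> and \<open>b, c\<close> have a common voter, and so have \<open>b, c\<close> and \<open>c, a\<close> if \<open>c, a\<close> is not
  nearly constant; by uniqueness it is the same voter.
\<close>

lemma rounded_one_voter:
  assumes abc: "distinct3 a b c" and nc: "\<not> near_const a b" "\<not> near_const b c"
  obtains t where "t < n"
    "\<And>X Y. (t \<in> X \<longleftrightarrow> t \<in> Y) \<Longrightarrow> rounded a b X = rounded a b Y"
    "\<And>X Y. (t \<in> X \<longleftrightarrow> t \<in> Y) \<Longrightarrow> rounded b c X = rounded b c Y"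
    "\<And>X Y. (t \<in> X \<longleftrightarrow> t \<in> Y) \<Longrightarrow> rounded c a X = rounded c a Y"
proof -
  have large: "\<not> V I a b < 3 * \<epsilon>" "\<not> V I b c < 3 * \<epsilon>"
    using V_ge[OF nc(1)] V_ge[OF nc(2)] \<epsilon>0 by linarith+
  obtain t where t: "t < n" "V (I - {t}) a b < 3 * \<epsilon>" "V (I - {t}) b c < 3 * \<epsilon>"
    using common_voter[OF abc nc(2)] large(1) by blast
  have const: "near_const x y \<Longrightarrow> rounded x y X = rounded x y Y" for x y X Y by (simp add: rounded_def)
  have dict: "rounded x y X = rounded x y Y"
    if "\<not> near_const x y" "V (I - {t}) x y < 3 * \<epsilon>" "t \<in> X \<longleftrightarrow> t \<in> Y" for x y X Y
    using that(1,3) by (simp add: rounded_def voter_eq[OF that(1) t(1) that(2)])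
  have ca: "rounded c a X = rounded c a Y" if XY: "t \<in> X \<longleftrightarrow> t \<in> Y" for X Y
  proof (cases "near_const c a")
    case False
    have bca: "distinct3 b c a" using abc by auto
    obtain t' where t': "t' < n" "V (I - {t'}) b c < 3 * \<epsilon>" "V (I - {t'}) c a < 3 * \<epsilon>"
      using common_voter[OF bca False] large(2) by blast
    have "t' = t" by (rule voter_unique[OF nc(2) t'(1) t(1) t'(2) t(3)])
    then have "V (I - {t}) c a < 3 * \<epsilon>" using t'(3) by simp
    then show ?thesis by (rule dict[OF False _ XY])
  qed (rule const)
  show ?thesis
    by (rule that[OF t(1) dict[OF nc(1) t(2)] dict[OF nc(2) t(3)] ca])
qed

lemma Pr_voter:
  assumes "t < n"
  shows "Pr (\<lambda>\<sigma>. P (\<sigma> t)) = measure_pmf.prob \<mu> {s. P s}"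
proof -
  have "map_pmf (\<lambda>\<sigma>. \<sigma> t) (profile_pmf n \<mu>) = \<mu>"
    unfolding profile_pmf_def by (subst Pi_pmf_component) (use assms in auto)
  then have "measure_pmf.prob \<mu> {s. P s} = measure_pmf.prob (map_pmf (\<lambda>\<sigma>. \<sigma> t) (profile_pmf n \<mu>)) {s. P s}" by simp
  then show ?thesis by (simp add: vimage_def)
qed

text \<open>
  The cycle persists at all profiles where voter \<open>t\<close> orders \<open>a, b, c\<close> in the same way, an event of
  probability at least \<open>\<beta>\<close>. There \<open>F\<close> has the same cycle or differs from the rounded rule on one of
  the three pairs, which has probability at most \<open>\<epsilon> + 27\<epsilon>\<close>.
\<close>

lemma no_cycle_one_voter:
  assumes abc: "distinct3 a b c" and nc: "\<not> near_const a b" "\<not> near_const b c" and \<sigma>: "\<sigma> \<in> profiles k n"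
    and cyc: "rounded a b (votes n a b \<sigma>)" "rounded b c (votes n b c \<sigma>)" "rounded c a (votes n c a \<sigma>)"
  shows False
proof -
  obtain t where t: "t < n"
    and loc: "\<And>X Y. (t \<in> X \<longleftrightarrow> t \<in> Y) \<Longrightarrow> rounded a b X = rounded a b Y"
    "\<And>X Y. (t \<in> X \<longleftrightarrow> t \<in> Y) \<Longrightarrow> rounded b c X = rounded b c Y"
    "\<And>X Y. (t \<in> X \<longleftrightarrow> t \<in> Y) \<Longrightarrow> rounded c a X = rounded c a Y"
    by (rule rounded_one_voter[OF abc nc]) (rule that)
  have st: "\<sigma> t \<in> rankings k" using \<sigma> t by (auto simp: profiles_def)
  obtain x y z where xyz: "{x, y, z} = {a, b, c}" "(x, y) \<in> \<sigma> t" "(y, z) \<in> \<sigma> t"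
    by (rule ranking_order[OF st abc])
  have "card {x, y, z} = 3" "{x, y, z} \<subseteq> {..<k}" unfolding xyz(1) using abc by auto
  then have d: "x \<noteq> y" "y \<noteq> z" "x \<noteq> z" "x < k" "y < k" "z < k"
    by (auto simp: card_insert_if split: if_splits)
  let ?bad = "\<lambda>u v \<sigma>. f u v (votes n u v \<sigma>) \<noteq> rounded u v (votes n u v \<sigma>)"
  have "\<beta> \<le> measure_pmf.prob \<mu> {s. (x, y) \<in> s \<and> (y, z) \<in> s}"
    using triple d by (simp add: triple_bound_def)
  also have "\<dots> = Pr (\<lambda>\<sigma>'. (x, y) \<in> \<sigma>' t \<and> (y, z) \<in> \<sigma>' t)"
    by (rule Pr_voter[OF t, symmetric])
  also have "\<dots> \<le> Pr (\<lambda>\<sigma>'. \<not> trans (F \<sigma>') \<or> (?bad a b \<sigma>' \<or> (?bad b c \<sigma>' \<or> ?bad c a \<sigma>')))"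
  proof (rule Pr_mono)
    fix \<sigma>' assume \<sigma>': "\<sigma>' \<in> profiles k n" and o: "(x, y) \<in> \<sigma>' t \<and> (y, z) \<in> \<sigma>' t"
    have st': "\<sigma>' t \<in> rankings k" using \<sigma>' t by (auto simp: profiles_def)
    have bit: "t \<in> votes n u v \<sigma> \<longleftrightarrow> t \<in> votes n u v \<sigma>'" if "u \<in> {a, b, c}" "v \<in> {a, b, c}" for u v
    proof -
      have "u \<in> {x, y, z}" "v \<in> {x, y, z}" using that unfolding xyz(1) .
      from same_order_same_bits[OF st xyz(2,3) st' conjunct1[OF o] conjunct2[OF o] this]
      show ?thesis by (simp add: votes_def t)
    qed
    have "rounded a b (votes n a b \<sigma>')" "rounded b c (votes n b c \<sigma>')" "rounded c a (votes n c a \<sigma>')"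
      using cyc loc(1)[OF bit[of a b]] loc(2)[OF bit[of b c]] loc(3)[OF bit[of c a]] by auto
    then show "\<not> trans (F \<sigma>') \<or> (?bad a b \<sigma>' \<or> (?bad b c \<sigma>' \<or> ?bad c a \<sigma>'))"
      using not_transitive_of_cycle[OF abc \<sigma>'] by blast
  qed
  also have "\<dots> \<le> Pr (\<lambda>\<sigma>'. \<not> trans (F \<sigma>')) + (Pr (?bad a b) + (Pr (?bad b c) + Pr (?bad c a)))"
    by (intro order_trans[OF Pr_disj] add_left_mono Pr_disj)
  also have "\<dots> \<le> \<epsilon> + (9 * \<epsilon> + (9 * \<epsilon> + 9 * \<epsilon>))"
    using nontransitive_less abc by (intro add_mono Pr_rounded) (auto simp: nontransitive_prob_def)
  finally show False using \<epsilon>_small_\<beta> \<epsilon>0 by simp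
qed

lemma no_cycle_two_const:
  assumes abc: "distinct3 a b c" and nc: "near_const a b" "near_const b c"
    and cyc: "rounded a b X" "rounded b c Y" "rounded c a Z"
  shows False
proof -
  have "1 - \<theta> a b < 9 * \<epsilon>" "1 - \<theta> b c < 9 * \<epsilon>"
    using nc cyc \<epsilon>_small by (auto simp: near_const_def rounded_def)
  then have "\<theta> c a < 9 * \<epsilon>" by (rule two_near_const[OF abc])
  then show False using cyc(3) \<epsilon>_small by (auto simp: near_const_def rounded_def split: if_splits)
qed

lemma no_cycle:
  assumes abc: "distinct3 a b c" and \<sigma>: "\<sigma> \<in> profiles k n"
    and cyc: "rounded a b (votes n a b \<sigma>)" "rounded b c (votes n b c \<sigma>)" "rounded c a (votes n c a \<sigma>)"
  shows False
proof -
  have bca: "distinct3 b c a" and cab: "distinct3 c a b" using abc by auto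
  have "\<not> (near_const a b \<and> near_const b c)" "\<not> (near_const b c \<and> near_const c a)" "\<not> (near_const c a \<and> near_const a b)"
    using no_cycle_two_const[OF abc _ _ cyc] no_cycle_two_const[OF bca _ _ cyc(2,3,1)]
      no_cycle_two_const[OF cab _ _ cyc(3,1,2)] by blast+
  moreover have "near_const a b \<or> near_const b c" "near_const b c \<or> near_const c a" "near_const c a \<or> near_const a b"
    using no_cycle_one_voter[OF abc _ _ \<sigma> cyc] no_cycle_one_voter[OF bca _ _ \<sigma> cyc(2,3,1)]
      no_cycle_one_voter[OF cab _ _ \<sigma> cyc(3,1,2)] by blast+
  ultimately show False by blast
qed

definition G :: "(nat \<Rightarrow> nat rel) \<Rightarrow> nat rel" where
  "G = (\<lambda>\<sigma>\<in>profiles k n. {(a, b). a < k \<and> b < k \<and> a \<noteq> b \<and> rounded a b (votes n a b \<sigma>)})"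

lemma in_G:
  assumes "\<sigma> \<in> profiles k n"
  shows "(a, b) \<in> G \<sigma> \<longleftrightarrow> a < k \<and> b < k \<and> a \<noteq> b \<and> rounded a b (votes n a b \<sigma>)"
  using assms by (simp add: G_def)

lemma votes_reverse:
  assumes "\<sigma> \<in> profiles k n" "a < k" "b < k" "a \<noteq> b"
  shows "votes n b a \<sigma> = I - votes n a b \<sigma>"
proof -
  have "(b, a) \<in> \<sigma> i \<longleftrightarrow> (a, b) \<notin> \<sigma> i" if "i < n" for i
    using rankingsD(3)[of "\<sigma> i" k a b] assms that by (auto simp: profiles_def)
  then show ?thesis by (auto simp: votes_def)
qed

lemma G_reverse:
  assumes "\<sigma> \<in> profiles k n" "a < k" "b < k" "a \<noteq> b"
  shows "(b, a) \<in> G \<sigma> \<longleftrightarrow> (a, b) \<notin> G \<sigma>"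
proof -
  have "votes n a b \<sigma> \<subseteq> I" by (auto simp: votes_def)
  from rounded_reverse[OF assms(2-4) this] show ?thesis
    unfolding in_G[OF assms(1)] votes_reverse[OF assms] using assms(2-4) by blast
qed

lemma G_strict: "\<sigma> \<in> profiles k n \<Longrightarrow> G \<sigma> \<in> strict_preferences k"
  unfolding strict_preferences_def
proof (intro CollectI conjI)
  assume \<sigma>: "\<sigma> \<in> profiles k n"
  show "G \<sigma> \<subseteq> {..<k} \<times> {..<k}" using in_G[OF \<sigma>] by auto
  show "asym (G \<sigma>)"
  proof (rule asymI)
    fix a b assume "(a, b) \<in> G \<sigma>"
    moreover have "a < k" "b < k" "a \<noteq> b" using calculation unfolding in_G[OF \<sigma>] by blast+
    then have "(b, a) \<in> G \<sigma> \<longleftrightarrow> (a, b) \<notin> G \<sigma>" by (intro G_reverse[OF \<sigma>])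
    ultimately show "(b, a) \<notin> G \<sigma>" by blast
  qed
  show "total_on {..<k} (G \<sigma>)"
    unfolding total_on_def
  proof (intro ballI impI)
    fix a b assume "a \<in> {..<k}" "b \<in> {..<k}" "a \<noteq> b"
    then have "(b, a) \<in> G \<sigma> \<longleftrightarrow> (a, b) \<notin> G \<sigma>" by (intro G_reverse[OF \<sigma>]) auto
    then show "(a, b) \<in> G \<sigma> \<or> (b, a) \<in> G \<sigma>" by blast
  qed
qed

lemma G_trans:
  assumes \<sigma>: "\<sigma> \<in> profiles k n"
  shows "trans (G \<sigma>)"
proof (rule transI)
  fix a b c assume ab: "(a, b) \<in> G \<sigma>" and bc: "(b, c) \<in> G \<sigma>"
  note ab' = ab[unfolded in_G[OF \<sigma>]] and bc' = bc[unfolded in_G[OF \<sigma>]]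
  have ac: "a \<noteq> c"
  proof
    assume "a = c"
    then have "(b, a) \<in> G \<sigma>" using bc by simp
    moreover have "(b, a) \<in> G \<sigma> \<longleftrightarrow> (a, b) \<notin> G \<sigma>" using ab' by (intro G_reverse[OF \<sigma>]) auto
    ultimately show False using ab by blast
  qed
  show "(a, c) \<in> G \<sigma>"
  proof (rule ccontr)
    assume "(a, c) \<notin> G \<sigma>"
    moreover have "(c, a) \<in> G \<sigma> \<longleftrightarrow> (a, c) \<notin> G \<sigma>" using ac ab' bc' by (intro G_reverse[OF \<sigma>]) auto
    ultimately have ca: "rounded c a (votes n c a \<sigma>)" unfolding in_G[OF \<sigma>] by blast
    have "distinct3 a b c" using ab' bc' ac by blast
    then show False by (rule no_cycle[OF _ \<sigma>]) (use ab' bc' ca in blast)+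
  qed
qed

lemma G_in: "G \<in> IIA_transitive_constitutions k n"
proof -
  have "G \<in> constitutions k n"
    unfolding constitutions_def by (rule PiE_I) (simp_all add: G_strict, simp add: G_def)
  moreover have "IIA k n G"
    unfolding IIA_def
  proof (intro allI impI ballI)
    fix a b \<sigma> \<tau>
    assume \<sigma>: "\<sigma> \<in> profiles k n" and \<tau>: "\<tau> \<in> profiles k n" and "\<forall>i<n. (a, b) \<in> \<sigma> i \<longleftrightarrow> (a, b) \<in> \<tau> i"
    then have "votes n a b \<sigma> = votes n a b \<tau>" unfolding votes_def by (intro Collect_cong) auto
    then show "(a, b) \<in> G \<sigma> \<longleftrightarrow> (a, b) \<in> G \<tau>" by (simp add: in_G[OF \<sigma>] in_G[OF \<tau>])
  qed
  moreover have "transitive_constitution k n G"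
    using G_trans by (simp add: transitive_constitution_def)
  ultimately show ?thesis by (simp add: IIA_transitive_constitutions_def)
qed

lemma G_close: "constitution_dist n \<mu> F G \<le> 9 * (real k)\<^sup>2 * \<epsilon>"
proof -
  let ?S = "{(a, b). a < k \<and> b < k \<and> a \<noteq> b}"
  let ?B = "\<lambda>(a, b). {\<sigma>. f a b (votes n a b \<sigma>) \<noteq> rounded a b (votes n a b \<sigma>)}"
  have sub: "?S \<subseteq> {..<k} \<times> {..<k}" by auto
  then have fin: "finite ?S" by (rule finite_subset) simp
  have "card ?S \<le> card ({..<k} \<times> {..<k})" by (rule card_mono[OF _ sub]) simp
  then have cS: "real (card ?S) \<le> (real k)\<^sup>2"
    unfolding card_cartesian_product card_lessThan power2_eq_square of_nat_mult[symmetric] of_nat_le_iff .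
  have "constitution_dist n \<mu> F G = Pr (\<lambda>\<sigma>. F \<sigma> \<noteq> G \<sigma>)" by (simp add: constitution_dist_def)
  also have "\<dots> \<le> Pr (\<lambda>\<sigma>. \<sigma> \<in> (\<Union>p\<in>?S. ?B p))"
  proof (rule Pr_mono)
    fix \<sigma> assume \<sigma>: "\<sigma> \<in> profiles k n" and ne: "F \<sigma> \<noteq> G \<sigma>"
    then obtain p where "(p \<in> F \<sigma>) \<noteq> (p \<in> G \<sigma>)" by blast
    then obtain a b where ab: "((a, b) \<in> F \<sigma>) \<noteq> ((a, b) \<in> G \<sigma>)" by (cases p) simp
    have Fs: "F \<sigma> \<subseteq> {..<k} \<times> {..<k}" "asym (F \<sigma>)"
      using F \<sigma> by (auto simp: constitutions_def strict_preferences_def)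
    have lt: "a < k" "b < k" using ab Fs(1) in_G[OF \<sigma>, of a b] by blast+
    have "(a, a) \<notin> F \<sigma>" using asymD[OF Fs(2), of a a] by blast
    then have ne: "a \<noteq> b" using ab in_G[OF \<sigma>, of a b] by blast
    have "f a b (votes n a b \<sigma>) \<noteq> rounded a b (votes n a b \<sigma>)"
      using ab lt ne pair_rule_votes[OF iia lt ne \<sigma>] in_G[OF \<sigma>, of a b] by simp
    then show "\<sigma> \<in> (\<Union>p\<in>?S. ?B p)" using lt ne by (intro UN_I[of "(a, b)"]) simp_all
  qed
  also have "\<dots> = measure_pmf.prob (profile_pmf n \<mu>) (\<Union>p\<in>?S. ?B p)" by (simp only: Collect_mem_eq)
  also have "\<dots> \<le> (\<Sum>p\<in>?S. measure_pmf.prob (profile_pmf n \<mu>) (?B p))"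
    by (rule measure_pmf.finite_measure_subadditive_finite[OF fin]) simp
  also have "\<dots> \<le> (\<Sum>p\<in>?S. 9 * \<epsilon>)"
  proof (rule sum_mono)
    fix p assume "p \<in> ?S"
    then obtain a b where "p = (a, b)" "a < k" "b < k" "a \<noteq> b" by blast
    then show "measure_pmf.prob (profile_pmf n \<mu>) (?B p) \<le> 9 * \<epsilon>" using Pr_rounded[of a b] by simp
  qed
  also have "\<dots> = real (card ?S) * (9 * \<epsilon>)" by simp
  also have "\<dots> \<le> (real k)\<^sup>2 * (9 * \<epsilon>)" using cS \<epsilon>0 by (intro mult_right_mono) auto
  finally show ?thesis by (simp add: mult_ac)
qed

theorem exists_transitive_nearby:
  "\<exists>G\<in>IIA_transitive_constitutions k n. constitution_dist n \<mu> F G \<le> 10 * (real k)\<^sup>2 * \<epsilon>"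
proof (rule bexI[OF _ G_in])
  have "9 * (real k)\<^sup>2 * \<epsilon> \<le> 10 * (real k)\<^sup>2 * \<epsilon>" using \<epsilon>0 by (intro mult_right_mono) auto
  with G_close show "constitution_dist n \<mu> F G \<le> 10 * (real k)\<^sup>2 * \<epsilon>" by linarith
qed

end

section \<open>Uniform and symmetric distributions\<close>

text \<open>
  Renaming the alternatives. Only involutions \<open>\<pi>\<close> occur, so that \<open>\<pi>\<close> and its inverse need not be
  distinguished.
\<close>

definition relabel :: "(nat \<Rightarrow> nat) \<Rightarrow> nat rel \<Rightarrow> nat rel" where
  "relabel \<pi> s = {(u, v). (\<pi> u, \<pi> v) \<in> s}"

lemma relabel_rankings:
  assumes s: "s \<in> rankings k" and \<pi>: "\<And>u. \<pi> (\<pi> u) = u" "\<And>u. \<pi> u < k \<longleftrightarrow> u < k"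
  shows "relabel \<pi> s \<in> rankings k"
proof -
  have s': "s \<subseteq> {..<k} \<times> {..<k}" "trans s" "irrefl s" "total_on {..<k} s"
    using s by (auto simp: rankings_def strict_linear_order_on_def)
  have inj: "\<pi> u = \<pi> v \<longleftrightarrow> u = v" for u v using \<pi>(1) by metis
  have "relabel \<pi> s \<subseteq> {..<k} \<times> {..<k}" using s'(1) \<pi>(2) by (auto simp: relabel_def)
  moreover have "trans (relabel \<pi> s)" using s'(2) unfolding relabel_def trans_def by blast
  moreover have "irrefl (relabel \<pi> s)" using s'(3) by (auto simp: relabel_def irrefl_def)
  moreover have "total_on {..<k} (relabel \<pi> s)"
    using s'(4) \<pi>(2) inj by (auto simp: relabel_def total_on_def)
  ultimately show ?thesis by (simp add: rankings_def strict_linear_order_on_def)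
qed

definition order_count :: "nat \<Rightarrow> nat \<Rightarrow> nat \<Rightarrow> nat \<Rightarrow> nat" where
  "order_count k a b c = card {s\<in>rankings k. (a, b) \<in> s \<and> (b, c) \<in> s}"

lemma order_count_relabel:
  assumes \<pi>: "\<And>u. \<pi> (\<pi> u) = u" "\<And>u. \<pi> u < k \<longleftrightarrow> u < k"
  shows "order_count k (\<pi> a) (\<pi> b) (\<pi> c) = order_count k a b c"
proof -
  have inv: "relabel \<pi> (relabel \<pi> s) = s" for s by (simp add: relabel_def \<pi>(1))
  have "bij_betw (relabel \<pi>) {s\<in>rankings k. (\<pi> a, \<pi> b) \<in> s \<and> (\<pi> b, \<pi> c) \<in> s} {s\<in>rankings k. (a, b) \<in> s \<and> (b, c) \<in> s}"
  proof (rule bij_betw_byWitness[where f' = "relabel \<pi>"])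
    show "relabel \<pi> ` {s\<in>rankings k. (\<pi> a, \<pi> b) \<in> s \<and> (\<pi> b, \<pi> c) \<in> s} \<subseteq> {s\<in>rankings k. (a, b) \<in> s \<and> (b, c) \<in> s}"
      using relabel_rankings[OF _ \<pi>] by (auto simp: relabel_def)
    show "relabel \<pi> ` {s\<in>rankings k. (a, b) \<in> s \<and> (b, c) \<in> s} \<subseteq> {s\<in>rankings k. (\<pi> a, \<pi> b) \<in> s \<and> (\<pi> b, \<pi> c) \<in> s}"
      using relabel_rankings[OF _ \<pi>] by (auto simp: relabel_def \<pi>(1))
  qed (simp_all add: inv)
  then show ?thesis unfolding order_count_def by (rule bij_betw_same_card)
qed

lemma order_count_swap:
  assumes "a < k" "b < k" "c < k" "a \<noteq> b" "b \<noteq> c" "a \<noteq> c"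
  shows "order_count k b a c = order_count k a b c" "order_count k a c b = order_count k a b c"
  using order_count_relabel[of "id(a := b, b := a)" k a b c] order_count_relabel[of "id(b := c, c := b)" k a b c] assms
  by simp_all

text \<open>
  Transpositions of alternatives show that the six orders of \<open>a, b, c\<close> are equally frequent.
\<close>

lemma triple_bound_uniform: "triple_bound k (pmf_of_set (rankings k)) (1/6)"
  unfolding triple_bound_def
proof (intro allI impI)
  fix a b c assume abc: "a < k" "b < k" "c < k" "a \<noteq> b" "b \<noteq> c" "a \<noteq> c"
  let ?A = "\<lambda>a b c. {s\<in>rankings k. (a, b) \<in> s \<and> (b, c) \<in> s}"
  let ?N = "order_count k a b c"
  have eq: "order_count k a c b = ?N" "order_count k b a c = ?N" "order_count k b c a = ?N"
    "order_count k c a b = ?N" "order_count k c b a = ?N"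
    using order_count_swap[of a k b c] order_count_swap(2)[of b k a c] order_count_swap(1)[of a k c b]
      order_count_swap(1)[of b k c a] abc by simp_all
  have "rankings k \<subseteq> ?A a b c \<union> (?A a c b \<union> (?A b a c \<union> (?A b c a \<union> (?A c a b \<union> ?A c b a))))"
    using order_exists[OF _ abc] by blast
  then have "card (rankings k) \<le> card (?A a b c \<union> (?A a c b \<union> (?A b a c \<union> (?A b c a \<union> (?A c a b \<union> ?A c b a)))))"
    by (rule card_mono[rotated]) (simp add: finite_rankings)
  also have "\<dots> \<le> ?N + (?N + (?N + (?N + (?N + ?N))))"
    by (intro order_trans[OF card_Un_le] add_mono) (simp_all add: order_count_def[symmetric] eq)
  finally have "real (card (rankings k)) \<le> 6 * real ?N" by simp
  moreover have "0 < card (rankings k)" using finite_rankings rankings_nonempty by (simp add: card_gt_0_iff)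
  ultimately have "1/6 \<le> real ?N / real (card (rankings k))" by (simp add: field_simps)
  also have "\<dots> = measure_pmf.prob (pmf_of_set (rankings k)) {s. (a, b) \<in> s \<and> (b, c) \<in> s}"
    unfolding order_count_def by (subst measure_pmf_of_set[OF rankings_nonempty finite_rankings]) (simp add: Int_def)
  finally show "1/6 \<le> measure_pmf.prob (pmf_of_set (rankings k)) {s. (a, b) \<in> s \<and> (b, c) \<in> s}" .
qed

lemma triple_bound_Min: "triple_bound k \<mu> (Min (pmf \<mu> ` rankings k))"
  unfolding triple_bound_def
proof (intro allI impI)
  fix a b c assume abc: "a < k" "b < k" "c < k" "a \<noteq> b" "b \<noteq> c" "a \<noteq> c"
  have "1/6 \<le> measure_pmf.prob (pmf_of_set (rankings k)) {s. (a, b) \<in> s \<and> (b, c) \<in> s}"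
    using triple_bound_uniform[of k] abc by (simp add: triple_bound_def)
  also have "\<dots> = real (card {s\<in>rankings k. (a, b) \<in> s \<and> (b, c) \<in> s}) / real (card (rankings k))"
    by (subst measure_pmf_of_set[OF rankings_nonempty finite_rankings]) (simp add: Int_def)
  finally have "{s\<in>rankings k. (a, b) \<in> s \<and> (b, c) \<in> s} \<noteq> {}" by (intro notI) simp
  then obtain s where s: "s \<in> rankings k" "(a, b) \<in> s" "(b, c) \<in> s" by blast
  have "Min (pmf \<mu> ` rankings k) \<le> pmf \<mu> s"
    using s finite_rankings by (intro Min_le) auto
  also have "\<dots> = measure_pmf.prob \<mu> {s}" by (simp add: measure_pmf_single)
  also have "\<dots> \<le> measure_pmf.prob \<mu> {s. (a, b) \<in> s \<and> (b, c) \<in> s}"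
    using s by (intro measure_pmf.finite_measure_mono) auto
  finally show "Min (pmf \<mu> ` rankings k) \<le> measure_pmf.prob \<mu> {s. (a, b) \<in> s \<and> (b, c) \<in> s}" .
qed

lemma symmetric_uniform: "symmetric_distribution k (pmf_of_set (rankings k))"
  unfolding symmetric_distribution_def
  using converse_rankings by (simp add: pmf_of_set[OF rankings_nonempty finite_rankings] indicator_def)

theorem theorem1p8:
  fixes k n :: nat
  assumes "k \<ge> 3" and "n \<ge> 1"
  shows
    "(\<forall>(\<epsilon>::real) F.
        0 < \<epsilon> \<and> \<epsilon> < 1 / 324 \<and>
        F \<in> constitutions k n \<and> IIA k n F \<and>
        nontransitive_prob n (pmf_of_set (rankings k)) F < 1 / 36 * \<epsilon> ^ 3 * real n powi (-3)
        \<longrightarrow> (\<exists>G \<in> IIA_transitive_constitutions k n.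
              constitution_dist n (pmf_of_set (rankings k)) F G \<le> 10 * (real k)\<^sup>2 * \<epsilon>))
     \<and>
     (\<forall>(\<mu> :: nat rel pmf) (\<alpha>::real) (\<epsilon>::real) F.
        set_pmf \<mu> \<subseteq> rankings k \<and> symmetric_distribution k \<mu> \<and>
        \<alpha> = Min (pmf \<mu> ` rankings k) \<and>
        0 < \<epsilon> \<and> \<epsilon> < \<alpha>\<^sup>2 / 9 \<and>
        F \<in> constitutions k n \<and> IIA k n F \<and>
        nontransitive_prob n \<mu> F < \<alpha>\<^sup>2 * \<epsilon> powr (1 / (2 * \<alpha>)) * real n powi (-3)
        \<longrightarrow> (\<exists>G \<in> IIA_transitive_constitutions k n.
              constitution_dist n \<mu> F G \<le> 10 * (real k)\<^sup>2 * \<epsilon>))"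
proof (intro conjI allI impI; elim conjE)
  fix \<epsilon> :: real and F
  let ?\<mu> = "pmf_of_set (rankings k)"
  assume h: "0 < \<epsilon>" "\<epsilon> < 1 / 324" "F \<in> constitutions k n" "IIA k n F"
    "nontransitive_prob n ?\<mu> F < 1 / 36 * \<epsilon> ^ 3 * real n powi (-3)"
  have "near_transitive_rule k n ?\<mu> (1/6) \<epsilon> F"
  proof
    show "nontransitive_prob n ?\<mu> F < (1/6)\<^sup>2 * \<epsilon> powr (1 / (2 * (1/6))) * real n powi (-3)"
      using h(1,5) by (simp add: power2_eq_square powr_numeral)
    show "\<epsilon> < (1/6)\<^sup>2 / 9" using h(2) by (simp add: power2_eq_square)
    show "set_pmf ?\<mu> \<subseteq> rankings k" by (simp add: set_pmf_of_set[OF rankings_nonempty finite_rankings])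
  qed (use h assms symmetric_uniform triple_bound_uniform in simp_all)
  then show "\<exists>G \<in> IIA_transitive_constitutions k n. constitution_dist n ?\<mu> F G \<le> 10 * (real k)\<^sup>2 * \<epsilon>"
    by (rule near_transitive_rule.exists_transitive_nearby)
next
  fix \<mu> :: "nat rel pmf" and \<alpha> \<epsilon> :: real and F
  assume h: "set_pmf \<mu> \<subseteq> rankings k" "symmetric_distribution k \<mu>" "\<alpha> = Min (pmf \<mu> ` rankings k)"
    "0 < \<epsilon>" "\<epsilon> < \<alpha>\<^sup>2 / 9" "F \<in> constitutions k n" "IIA k n F"
    "nontransitive_prob n \<mu> F < \<alpha>\<^sup>2 * \<epsilon> powr (1 / (2 * \<alpha>)) * real n powi (-3)"
  have "0 \<le> \<alpha>" unfolding h(3) using finite_rankings rankings_nonempty by (intro Min.boundedI) auto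
  moreover have "\<alpha> \<noteq> 0" using h(4,5) by auto
  ultimately have "0 < \<alpha>" by simp
  then have "near_transitive_rule k n \<mu> \<alpha> \<epsilon> F"
    using h assms triple_bound_Min[of k \<mu>] by unfold_locales simp_all
  then show "\<exists>G \<in> IIA_transitive_constitutions k n. constitution_dist n \<mu> F G \<le> 10 * (real k)\<^sup>2 * \<epsilon>"
    by (rule near_transitive_rule.exists_transitive_nearby)
qed

end
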